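(* (i) For every eigenvalue $\lambda$ of the integral operator $\mathcal{K}$ on $L^2(0,\infty)$ with kernel $K(s,t)$ there exists at least one non-zero function $G_{\lambda}$, holomorphic on $\mathbb{C}\setminus[1,\infty)$, such that for all $z\in\mathbb{C}\setminus[0,\infty)$ $$2G_{\lambda}(z+1)=G_{\lambda}(z)+\frac{1}{\lambda z^{2}}\,G_{\lambda}\left(\frac{1}{z}\right),\qquad (\ast)$$ and moreover $G_\lambda$ is, in the half-plane $\Re z<0$, an image under the Laplace transform, i.e. there is a function $g$ on $(0,\infty)$ with $G_{\lambda}(z)=\int_{0}^{\infty}g(t)e^{tz}\,dt$ for $\Re z<0$. (ii) Conversely, for every $\lambda\neq 0$ such that there exists a non-zero function $G_\lambda$, holomorphic on $\mathbb{C}\setminus[1,\infty)$, which satisfies $(\ast)$ for all $z\in\mathbb{C}\setminus[0,\infty)$ and is an image under the Laplace transform in the half-plane $\Re z<0$, i.e. there is a function $g$ on $(0,\infty)$ with $G_{\lambda}(z)=\int_{0}^{\infty}g(t)e^{tz}\,dt$ for $\Re z<0$, $\lambda$ is an eigenvalue of $\mathcal{K}$. (iii) The set of all such $\lambda$ is countable, and, enumerating it as $(\lambda_n)$, $\lambda_{n}\to 0$ as $n\to\infty$.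
   Context: For $s,t>0$ put $\psi(s)=(2e^{s}-1)^{1/2}$ and $$K(s,t)=\frac{J_{1}(2\sqrt{st})}{\psi(s)\psi(t)},$$ where $J_1$ is the Bessel function of the first kind of order $1$. The operator $\mathcal{K}$ is the Hilbert–Schmidt integral operator $(\mathcal{K}A)(s)=\int_{0}^{\infty}K(s,t)A(t)\,dt$ on $L^2(0,\infty)$; an eigenvalue is a number $\lambda$ for which there is a non-zero $A\in L^2(0,\infty)$ with $\mathcal{K}A=\lambda A$. *)

theory Defs
  imports "HOL-Complex_Analysis.Complex_Analysis"
begin

definition bessel_J :: "nat \<Rightarrow> real \<Rightarrow> real" where
  "bessel_J n x = (\<Sum>k. (-1) ^ k / (fact k * fact (k + n)) * (x / 2) ^ (2 * k + n))"

lemma summable_bessel_J: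
  "summable (\<lambda>k. (-1) ^ k / (fact k * fact (k + n)) * (x / 2) ^ (2 * k + n) :: real)"
proof (rule summable_comparison_test')
  show "summable (\<lambda>k. inverse (fact k) * ((x / 2)\<^sup>2) ^ k * \<bar>x / 2\<bar> ^ n)"
    by (intro summable_mult2 summable_exp)
  fix k :: nat
  have "norm ((-1) ^ k / (fact k * fact (k + n)) * (x / 2) ^ (2 * k + n))
      = \<bar>x / 2\<bar> ^ (2 * k + n) / (fact k * fact (k + n))"
    by (simp add: abs_mult power_abs)
  also have "\<dots> \<le> \<bar>x / 2\<bar> ^ (2 * k + n) / (fact k * 1)"
    by (intro divide_left_mono mult_left_mono fact_ge_1) auto
  also have "\<dots> = inverse (fact k) * ((x / 2)\<^sup>2) ^ k * \<bar>x / 2\<bar> ^ n"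
    by (simp only: power_add power_mult power2_abs divide_inverse) simp
  finally show "norm ((-1) ^ k / (fact k * fact (k + n)) * (x / 2) ^ (2 * k + n))
      \<le> inverse (fact k) * ((x / 2)\<^sup>2) ^ k * \<bar>x / 2\<bar> ^ n" .
qed

definition psi :: "real \<Rightarrow> real" where
  "psi s = sqrt (2 * exp s - 1)"

definition kernel_K :: "real \<Rightarrow> real \<Rightarrow> real" where
  "kernel_K s t = bessel_J 1 (2 * sqrt (s * t)) / (psi s * psi t)"

text \<open>Elements of \<open>L\<^sup>2(0,\<infinity>)\<close> are represented by complex-valued
  functions; identities between them are understood almost everywhere.\<close>

abbreviation pos_measure :: "real measure" where
  "pos_measure \<equiv> lebesgue_on {0<..}"

definition L2_pos :: "(real \<Rightarrow> complex) \<Rightarrow> bool" where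
  "L2_pos A \<longleftrightarrow> A \<in> borel_measurable pos_measure \<and>
     integrable pos_measure (\<lambda>t. (cmod (A t))\<^sup>2)"

definition op_K :: "(real \<Rightarrow> complex) \<Rightarrow> real \<Rightarrow> complex" where
  "op_K A s = (\<integral>t. complex_of_real (kernel_K s t) * A t \<partial>pos_measure)"

definition eigenvalue_K :: "complex \<Rightarrow> bool" where
  "eigenvalue_K lam \<longleftrightarrow>
     (\<exists>A. L2_pos A \<and> \<not> (AE t in pos_measure. A t = 0) \<and>
          (AE s in pos_measure. op_K A s = lam * A s))"

definition slit_from :: "real \<Rightarrow> complex set" where
  "slit_from a = UNIV - complex_of_real ` {a..}"

text \<open>The equation is meaningful only for \<open>lam \<noteq> 0\<close>; for \<open>lam = 0\<close> the
  last summand is \<open>0\<close> by the division convention.\<close>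

definition three_term_equation :: "complex \<Rightarrow> (complex \<Rightarrow> complex) \<Rightarrow> bool" where
  "three_term_equation lam G \<longleftrightarrow>
     (\<forall>z \<in> slit_from 0. 2 * G (z + 1) = G z + 1 / (lam * z\<^sup>2) * G (1 / z))"

text \<open>The Laplace integral is an absolutely convergent Lebesgue integral. Integrability
  is required explicitly because the integral of a non-integrable function is \<open>0\<close>.\<close>

definition laplace_image :: "(complex \<Rightarrow> complex) \<Rightarrow> bool" where
  "laplace_image G \<longleftrightarrow>
     (\<exists>g :: real \<Rightarrow> complex. \<forall>z. Re z < 0 \<longrightarrow>
        integrable pos_measure (\<lambda>t. g t * exp (complex_of_real t * z)) \<and>
        G z = (\<integral>t. g t * exp (complex_of_real t * z) \<partial>pos_measure))"

text \<open>Functions are total in HOL, so being non-zero refers to the domain of \<open>G\<close>.\<close>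

definition period_function :: "complex \<Rightarrow> (complex \<Rightarrow> complex) \<Rightarrow> bool" where
  "period_function lam G \<longleftrightarrow>
     (\<exists>z \<in> slit_from 1. G z \<noteq> 0) \<and>
     G holomorphic_on slit_from 1 \<and>
     three_term_equation lam G \<and>
     laplace_image G"

end

theory Submission imports Defs "HOL-Probability.Probability" begin

text \<open>Write \<open>T g s = \<integral> s * b (s * t) * g t dt\<close> with \<open>J\<^sub>1 (2 * sqrt x) = sqrt x * b x\<close>.
  For \<open>g t = sqrt t * A t / psi t\<close> the eigenvalue equation of \<open>A\<close> becomes
  \<open>T g s = lam * (2 * exp s - 1) * g s\<close>. If \<open>G\<close> is the Laplace transform of \<open>g\<close>, then those of the two
  sides are \<open>G (1 / z) / z\<^sup>2\<close> and \<open>lam * (2 * G (z + 1) - G z)\<close>, so by uniqueness of Laplace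
  transforms the eigenvalue equation is the three-term equation on \<open>Re z < 0\<close>.
  From an eigenfunction, \<open>G\<close> is obtained on \<open>Re z < 1\<close> and continued by the three-term equation.
  Conversely, the three-term equation determines \<open>(2 * exp s - 1) * g s\<close> as an inverse Laplace transform,
  and its growth shows that \<open>A\<close> is square integrable.

  The operator is symmetric and compact. Bessel's inequality for its kernel leaves only finitely many
  eigenvalues outside each neighbourhood of \<open>0\<close>. If there were finitely many nonzero
  eigenvalues, then a polynomial in the operator with nonzero constant term would send every function
  into the kernel of the operator, which is trivial; but the indicator of \<open>(0, 1]\<close> would then
  agree almost everywhere with a function in the range, and those are continuous.\<close>

section \<open>The Bessel function of order one\<close>

text \<open>The pivot is that, for fixed \<open>t\<close>, the Laplace transform of
  \<open>s * b (s * t)\<close> in \<open>s\<close> is \<open>exp (- t / r) / r^2\<close>: the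
  inversion of the three-term equation becomes an integral operator. The weight
  \<open>sqrt t / psi t\<close> strips the square roots off \<open>J\<^sub>1\<close> and collects
  both factors \<open>psi\<close> into \<open>2 * exp s - 1\<close>.

  The obstacle in the converse is growth. If \<open>V\<close> is the inverse Laplace transform of
  \<open>G (1 / z) / z^2\<close>, then \<open>A\<close> has the size of
  \<open>V s / (sqrt s * psi s)\<close>, so a bound by \<open>exp (c * s)\<close> with
  \<open>c < 1/2\<close> is wanted. The Taylor series of \<open>G\<close> at \<open>0\<close> has a
  guaranteed radius of only \<open>1\<close> and gives just \<open>c > 1\<close>; more of the cut
  plane has to be used. Moreover \<open>g\<close> is at first integrable only against decaying
  exponentials, so \<open>T g\<close> is available only once \<open>A\<close> is known to be square
  integrable.

  Two bounds carry the operator part. \<open>J\<^sub>1\<close> is bounded by \<open>1\<close>, hence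
  the kernel by the square integrable product \<open>1 / psi s * (1 / psi t)\<close>; and
  \<open>x * b x\<close> is Lipschitz, which makes the images of a bounded set equicontinuous. All
  limits are pointwise limits below a majorant.\<close>

definition bessel_series :: "real \<Rightarrow> real" where
  "bessel_series x = (\<Sum>k. (-1) ^ k / (fact k * fact (Suc k)) * x ^ k)"

text \<open>For \<open>x >= 0\<close> this is \<open>J\<^sub>0 (2 * sqrt x)\<close>. It is the
  derivative of \<open>x * bessel_series x\<close>, and its own derivative is
  \<open>- bessel_series x\<close>, so the two functions form a closed first-order system.\<close>

definition bessel_series0 :: "real \<Rightarrow> real" where
  "bessel_series0 x = (\<Sum>k. (-1) ^ k / (fact k)\<^sup>2 * x ^ k)"

lemma summable_bessel_series_aux:
  fixes x :: real
  assumes c: "\<And>k. (1::real) \<le> c k"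
  shows "summable (\<lambda>k. (-1) ^ k / (fact k * c k) * x ^ k)"
proof (rule summable_comparison_test')
  show "summable (\<lambda>k. inverse (fact k) * \<bar>x\<bar> ^ k)" by (rule summable_exp)
  fix k :: nat
  have "norm ((-1) ^ k / (fact k * c k) * x ^ k) = \<bar>x\<bar> ^ k / (fact k * c k)"
    using c[of k] by (simp add: abs_mult power_abs)
  also have "\<dots> \<le> \<bar>x\<bar> ^ k / (fact k * 1)"
    using c[of k] by (intro divide_left_mono mult_left_mono) auto
  finally show "norm ((-1) ^ k / (fact k * c k) * x ^ k) \<le> inverse (fact k) * \<bar>x\<bar> ^ k"
    by (simp add: field_simps)
qed

lemma summable_bessel_series: "summable (\<lambda>k. (-1) ^ k / (fact k * fact (Suc k)) * x ^ k :: real)"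
  by (rule summable_bessel_series_aux) (rule fact_ge_1)

lemma summable_bessel_series0: "summable (\<lambda>k. (-1) ^ k / (fact k)\<^sup>2 * x ^ k :: real)"
  unfolding power2_eq_square by (rule summable_bessel_series_aux) (rule fact_ge_1)

lemma bessel_series0_deriv: "(bessel_series0 has_real_derivative - bessel_series x) (at x)"
proof -
  let ?c = "\<lambda>k. (-1) ^ k / (fact k)\<^sup>2 :: real"
  have "(bessel_series0 has_real_derivative (\<Sum>k. diffs ?c k * x ^ k)) (at x)"
    unfolding bessel_series0_def by (rule termdiffs_strong_converges_everywhere) (rule summable_bessel_series0)
  moreover have "diffs ?c k = - ((-1) ^ k / (fact k * fact (Suc k)))" for k
    by (simp add: diffs_def power2_eq_square divide_simps)
  ultimately show ?thesis
    unfolding bessel_series_def suminf_minus[OF summable_bessel_series, symmetric]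
    by (simp del: fact_Suc)
qed

lemma mult_bessel_series_deriv: "((\<lambda>x. x * bessel_series x) has_real_derivative bessel_series0 x) (at x)"
proof -
  \<comment> \<open>The factor \<open>x\<close> shifts the coefficients by one place, with
    \<open>0\<close> at index \<open>0\<close>; the product is then a plain power series that can be
    differentiated termwise.\<close>
  let ?c = "\<lambda>k. (case k of 0 \<Rightarrow> 0 | Suc j \<Rightarrow> (-1) ^ j / (fact j * fact (Suc j))) :: real"
  have sm: "?c (Suc k) * y ^ Suc k = y * ((-1) ^ k / (fact k * fact (Suc k)) * y ^ k)" for k y
    by simp
  have s: "summable (\<lambda>k. ?c k * y ^ k)" for y
    unfolding summable_Suc_iff[symmetric, where f="\<lambda>k. ?c k * y ^ k"] sm
    by (intro summable_mult summable_bessel_series)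
  have eq: "y * bessel_series y = (\<Sum>k. ?c k * y ^ k)" for y
    unfolding suminf_split_head[OF s, symmetric, simplified] bessel_series_def
      suminf_mult[OF summable_bessel_series, symmetric]
    using suminf_split_head[OF s, of y] by (simp add: mult_ac)
  have "((\<lambda>y. \<Sum>k. ?c k * y ^ k) has_real_derivative (\<Sum>k. diffs ?c k * x ^ k)) (at x)"
    by (rule termdiffs_strong_converges_everywhere) (rule s)
  moreover have "diffs ?c k = (-1) ^ k / (fact k)\<^sup>2" for k
    by (simp add: diffs_def power2_eq_square divide_simps)
  ultimately show ?thesis
    unfolding eq by (simp add: bessel_series0_def)
qed

lemma isCont_bessel_series: "isCont bessel_series x"
proof -
  let ?c = "\<lambda>k. (-1) ^ k / (fact k * fact (Suc k)) :: real"
  have "(bessel_series has_real_derivative (\<Sum>k. diffs ?c k * x ^ k)) (at x)"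
    unfolding bessel_series_def by (rule termdiffs_strong_converges_everywhere) (rule summable_bessel_series)
  then show ?thesis by (rule DERIV_isCont)
qed

lemma bessel_series_at_0: "bessel_series0 0 = 1"
  unfolding bessel_series0_def using powser_zero[of "\<lambda>k. (-1) ^ k / (fact k)\<^sup>2 :: real"] by simp

text \<open>With \<open>u x = x * bessel_series x\<close> one has \<open>x u'' + u = 0\<close>, and the energy
  \<open>u'\<^sup>2 + u\<^sup>2 / x\<close> of this oscillator decreases from its value \<open>1\<close> at \<open>0\<close>.\<close>

lemma bessel_energy_le:
  assumes "0 \<le> x"
  shows "(bessel_series0 x)\<^sup>2 + x * (bessel_series x)\<^sup>2 \<le> 1"
proof (cases "x = 0")
  case False
  with assms have x: "0 < x" by simp
  define E where "E = (\<lambda>x. (bessel_series0 x)\<^sup>2 + x * (bessel_series x)\<^sup>2)"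
  have "\<exists>y. (E has_real_derivative y) (at t) \<and> y \<le> 0" if t: "0 < t" "t < x" for t
  proof -
    \<comment> \<open>Writing \<open>x * b^2\<close> as \<open>(x * b)^2 / x\<close> makes the two
      known derivatives sufficient; the mixed terms cancel and only \<open>- b^2\<close>
      remains.\<close>
    have eq: "\<forall>\<^sub>F y in nhds t. E y = (bessel_series0 y)\<^sup>2 + (y * bessel_series y)\<^sup>2 / y"
      by (rule eventually_mono[OF eventually_nhds_in_open[of "{0<..}"]])
        (use t in \<open>auto simp: E_def power2_eq_square\<close>)
    have "((\<lambda>y. (bessel_series0 y)\<^sup>2 + (y * bessel_series y)\<^sup>2 / y) has_real_derivative
      - (bessel_series t)\<^sup>2) (at t)"
      using t
      by (rule_tac DERIV_cong[OF DERIV_add[OF DERIV_power[OF bessel_series0_deriv, of 2]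
            DERIV_divide[OF DERIV_power[OF mult_bessel_series_deriv, of 2] DERIV_ident]]])
         (auto simp: field_simps power2_eq_square)
    then have "(E has_real_derivative - (bessel_series t)\<^sup>2) (at t)"
      using DERIV_cong_ev[OF refl eq refl] by blast
    then show ?thesis by (intro exI[of _ "- (bessel_series t)\<^sup>2"]) auto
  qed
  moreover have "continuous_on {0..x} E"
    unfolding E_def
    by (intro continuous_intros continuous_at_imp_continuous_on ballI isCont_bessel_series
        DERIV_isCont[OF bessel_series0_deriv])
  ultimately have "E x \<le> E 0"
    using DERIV_nonpos_imp_decreasing_open[of 0 x E] x by auto
  then show ?thesis by (simp add: E_def bessel_series_at_0)
qed (simp add: bessel_series_at_0)

lemma abs_bessel_series0_le: "0 \<le> x \<Longrightarrow> \<bar>bessel_series0 x\<bar> \<le> 1"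
  using bessel_energy_le[of x] zero_le_power2[of "bessel_series x"]
  by (simp add: abs_square_le_1[symmetric] mult_nonneg_nonneg order_trans[rotated])

text \<open>The derivative \<open>bessel_series0\<close> is bounded by \<open>1\<close> through the
  energy. Applied at \<open>s * t\<close> and \<open>s' * t\<close>, this later gives a Lipschitz
  constant in \<open>s\<close> that does not depend on \<open>t\<close>.\<close>

lemma mult_bessel_series_lipschitz:
  assumes "0 \<le> x" "0 \<le> y"
  shows "\<bar>x * bessel_series x - y * bessel_series y\<bar> \<le> \<bar>x - y\<bar>"
proof -
  have "norm (x * bessel_series x - y * bessel_series y) \<le> 1 * norm (x - y)"
  proof (rule field_differentiable_bound[where S = "{0..}" and f' = bessel_series0])
    show "((\<lambda>x. x * bessel_series x) has_real_derivative bessel_series0 z) (at z within {0..})" for z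
      by (rule has_field_derivative_at_within[OF mult_bessel_series_deriv])
  qed (use assms in \<open>auto intro: abs_bessel_series0_le\<close>)
  then show ?thesis by simp
qed

lemma abs_bessel_series_le:
  assumes "0 \<le> x"
  shows "\<bar>bessel_series x\<bar> \<le> 1"
proof (cases "x = 0")
  case True
  then show ?thesis using powser_zero[of "\<lambda>k. (-1) ^ k / (fact k * fact (Suc k)) :: real"]
    by (simp add: bessel_series_def)
next
  case False
  with mult_bessel_series_lipschitz[of x 0] assms show ?thesis
    by (simp add: abs_mult)
qed

lemma bessel_J_1_eq:
  assumes "0 \<le> x"
  shows "bessel_J 1 (2 * sqrt x) = sqrt x * bessel_series x"
proof -
  have "(-1) ^ k / (fact k * fact (k + 1)) * (2 * sqrt x / 2) ^ (2 * k + 1)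
      = sqrt x * ((-1) ^ k / (fact k * fact (Suc k)) * x ^ k)"
    for k
    using assms by (simp add: power_mult del: fact_Suc)
  then show ?thesis
    unfolding bessel_J_def bessel_series_def
    by (subst suminf_mult[OF summable_bessel_series, symmetric]) (simp only:)
qed

text \<open>The square of this value is the second summand of the energy. The bound supplies the
  majorant of the kernel.\<close>

lemma abs_bessel_J_1_le:
  assumes "0 \<le> x"
  shows "\<bar>bessel_J 1 (2 * sqrt x)\<bar> \<le> 1"
proof -
  have "(sqrt x * bessel_series x)\<^sup>2 \<le> 1"
    using bessel_energy_le[OF assms] assms by (simp add: power_mult_distrib) (meson add_increasing order_refl order_trans zero_le_power2)
  then show ?thesis
    by (simp only: bessel_J_1_eq[OF assms] abs_square_le_1)
qed

section \<open>Compact symmetric integral operators\<close>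

text \<open>Real-valued functions suffice: the kernel is real, and complex eigenfunctions are split
  into real and imaginary parts at the end. Functions are not identified almost everywhere, so
  equality of vectors appears as an \<open>AE\<close> statement.\<close>

definition square_integrable :: "'a measure \<Rightarrow> ('a \<Rightarrow> real) \<Rightarrow> bool" where
  "square_integrable M f \<longleftrightarrow> f \<in> borel_measurable M \<and> integrable M (\<lambda>x. (f x)\<^sup>2)"

definition L2_inner :: "'a measure \<Rightarrow> ('a \<Rightarrow> real) \<Rightarrow> ('a \<Rightarrow> real) \<Rightarrow> real" where
  "L2_inner M f g = (\<integral>x. f x * g x \<partial>M)"

lemma square_integrable_measurable [measurable_dest]:
  "square_integrable M f \<Longrightarrow> f \<in> borel_measurable M"
  by (simp add: square_integrable_def)

lemma square_integrable_bound:
  assumes f: "square_integrable M f" and [measurable]: "g \<in> borel_measurable M"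
    and le: "\<And>x. x \<in> space M \<Longrightarrow> (g x)\<^sup>2 \<le> c * (f x)\<^sup>2"
  shows "square_integrable M g"
proof -
  have "integrable M (\<lambda>x. c * (f x)\<^sup>2)"
    using f by (simp add: square_integrable_def)
  then have "integrable M (\<lambda>x. (g x)\<^sup>2)"
    by (rule Bochner_Integration.integrable_bound) (auto intro!: AE_I2 order_trans[OF le])
  then show ?thesis by (simp add: square_integrable_def)
qed

lemma integrable_mult_L2:
  assumes f: "square_integrable M f" and g: "square_integrable M g"
  shows "integrable M (\<lambda>x. f x * g x)"
proof (rule Bochner_Integration.integrable_bound)
  show "integrable M (\<lambda>x. (f x)\<^sup>2 + (g x)\<^sup>2)"
    using f g by (simp add: square_integrable_def)
  show "(\<lambda>x. f x * g x) \<in> borel_measurable M" using f g by measurable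
  show "AE x in M. norm (f x * g x) \<le> norm ((f x)\<^sup>2 + (g x)\<^sup>2)"
  proof (rule AE_I2)
    fix x
    have "2 * (\<bar>f x\<bar> * \<bar>g x\<bar>) \<le> (f x)\<^sup>2 + (g x)\<^sup>2"
      using zero_le_power2[of "\<bar>f x\<bar> - \<bar>g x\<bar>"] by (simp add: power2_diff)
    then show "norm (f x * g x) \<le> norm ((f x)\<^sup>2 + (g x)\<^sup>2)"
      using mult_nonneg_nonneg[of "\<bar>f x\<bar>" "\<bar>g x\<bar>"] unfolding real_norm_def abs_mult by linarith
  qed
qed

lemma square_integrable_cmult:
  assumes "square_integrable M f" shows "square_integrable M (\<lambda>x. c * f x)"
  using assms by (intro square_integrable_bound[OF assms, of _ "c\<^sup>2"]) (auto simp: power_mult_distrib)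

lemma square_integrable_add:
  assumes f: "square_integrable M f" and g: "square_integrable M g"
  shows "square_integrable M (\<lambda>x. f x + g x)"
proof -
  have "integrable M (\<lambda>x. (f x)\<^sup>2 + (g x)\<^sup>2 + 2 * (f x * g x))"
    using f g integrable_mult_L2[OF f g] by (simp add: square_integrable_def)
  moreover have "(\<lambda>x. f x + g x) \<in> borel_measurable M" using f g by measurable
  ultimately show ?thesis
    by (simp add: square_integrable_def power2_sum mult.assoc)
qed

lemma square_integrable_diff:
  assumes f: "square_integrable M f" and g: "square_integrable M g"
  shows "square_integrable M (\<lambda>x. f x - g x)"
  using square_integrable_add[OF f square_integrable_cmult[OF g, of "-1"]] by simp

lemma square_integrable_zero: "square_integrable M (\<lambda>x. 0)"
  by (simp add: square_integrable_def)

lemma square_integrable_sum: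
  assumes "\<And>i. i \<in> I \<Longrightarrow> square_integrable M (f i)"
  shows "square_integrable M (\<lambda>x. \<Sum>i\<in>I. f i x)"
  using assms
  by (induction I rule: infinite_finite_induct) (auto intro: square_integrable_zero square_integrable_add)

lemma L2_inner_commute: "L2_inner M f g = L2_inner M g f"
  by (simp add: L2_inner_def mult.commute)

lemma L2_inner_cmult_left: "L2_inner M (\<lambda>x. c * f x) g = c * L2_inner M f g"
  by (simp add: L2_inner_def mult.assoc)

lemma L2_inner_cmult_right: "L2_inner M f (\<lambda>x. c * g x) = c * L2_inner M f g"
  by (simp add: L2_inner_def mult.left_commute)

lemma L2_inner_add_left:
  assumes "square_integrable M f" "square_integrable M g" "square_integrable M h"
  shows "L2_inner M (\<lambda>x. f x + g x) h = L2_inner M f h + L2_inner M g h"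
  using assms by (simp add: L2_inner_def distrib_right integrable_mult_L2)

lemma L2_inner_diff_left:
  assumes "square_integrable M f" "square_integrable M g" "square_integrable M h"
  shows "L2_inner M (\<lambda>x. f x - g x) h = L2_inner M f h - L2_inner M g h"
  using assms by (simp add: L2_inner_def left_diff_distrib integrable_mult_L2)

lemma L2_inner_sum_left:
  assumes "\<And>i. i \<in> I \<Longrightarrow> square_integrable M (f i)" "square_integrable M h"
  shows "L2_inner M (\<lambda>x. \<Sum>i\<in>I. f i x) h = (\<Sum>i\<in>I. L2_inner M (f i) h)"
  using assms by (simp add: L2_inner_def sum_distrib_right integrable_mult_L2)

lemma L2_inner_cong_AE:
  assumes "AE x in M. f x = g x"
    and "f \<in> borel_measurable M" "g \<in> borel_measurable M" "h \<in> borel_measurable M"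
  shows "L2_inner M f h = L2_inner M g h"
  unfolding L2_inner_def using assms by (intro integral_cong_AE) auto

lemma L2_inner_self_nonneg: "0 \<le> L2_inner M f f"
  by (simp add: L2_inner_def)

lemma L2_inner_self_eq_0_iff:
  assumes "square_integrable M f"
  shows "L2_inner M f f = 0 \<longleftrightarrow> (AE x in M. f x = 0)"
proof -
  have "integrable M (\<lambda>x. f x * f x)" by (rule integrable_mult_L2[OF assms assms])
  from integral_nonneg_eq_0_iff_AE[OF this] show ?thesis
    by (simp add: L2_inner_def)
qed

lemma L2_inner_self_diff:
  assumes f: "square_integrable M f" and g: "square_integrable M g"
  shows "L2_inner M (\<lambda>x. f x - g x) (\<lambda>x. f x - g x)
    = L2_inner M f f - 2 * L2_inner M f g + L2_inner M g g"
  using L2_inner_diff_left[OF f g square_integrable_diff[OF f g]]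
    L2_inner_diff_left[OF f g f] L2_inner_diff_left[OF f g g]
  unfolding L2_inner_commute[of M f "\<lambda>x. f x - g x"] L2_inner_commute[of M g "\<lambda>x. f x - g x"]
    L2_inner_commute[of M g f]
  by simp

lemma L2_Cauchy_Schwarz:
  assumes f: "square_integrable M f" and g: "square_integrable M g"
  shows "(L2_inner M f g)\<^sup>2 \<le> L2_inner M f f * L2_inner M g g"
proof -
  define a b c where "a = L2_inner M f f" and "b = L2_inner M f g" and "c = L2_inner M g g"
  have pos: "0 \<le> a - 2 * t * b + t\<^sup>2 * c" for t
  proof -
    have "0 \<le> L2_inner M (\<lambda>x. f x - t * g x) (\<lambda>x. f x - t * g x)"
      by (rule L2_inner_self_nonneg)
    also have "\<dots> = a - 2 * t * b + t\<^sup>2 * c"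
      by (subst L2_inner_self_diff[OF f square_integrable_cmult[OF g]])
        (simp add: a_def b_def c_def L2_inner_cmult_left L2_inner_cmult_right power2_eq_square)
    finally show ?thesis .
  qed
  have "b\<^sup>2 \<le> a * c"
  proof (cases "c = 0")
    case True
    have "b = 0"
    proof (rule ccontr)
      assume "b \<noteq> 0"
      \<comment> \<open>With \<open>c = 0\<close> the polynomial is linear in \<open>t\<close>, and
        at this \<open>t\<close> it equals \<open>-1\<close>.\<close>
      with pos[of "(a + 1) / (2 * b)"] True show False by simp
    qed
    with True show ?thesis by simp
  next
    case False
    with L2_inner_self_nonneg[of M g] have c: "0 < c" by (simp add: c_def)
    have "0 \<le> a - b\<^sup>2 / c"
      using pos[of "b / c"] c by (simp add: power2_eq_square field_simps)
    with c show ?thesis by (simp add: field_simps)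
  qed
  then show ?thesis by (simp add: a_def b_def c_def)
qed

lemma L2_Bessel_inequality:
  assumes f: "square_integrable M f" and e: "\<And>i. i \<in> I \<Longrightarrow> square_integrable M (e i)"
    and fin: "finite I"
    and orth: "\<And>i j. i \<in> I \<Longrightarrow> j \<in> I \<Longrightarrow> L2_inner M (e i) (e j) = (if i = j then 1 else 0)"
  shows "(\<Sum>i\<in>I. (L2_inner M f (e i))\<^sup>2) \<le> L2_inner M f f"
proof -
  define c where "c = (\<lambda>i. L2_inner M f (e i))"
  define g where "g = (\<lambda>x. \<Sum>i\<in>I. c i * e i x)"
  have ce: "square_integrable M (\<lambda>x. c i * e i x)" if "i \<in> I" for i
    by (rule square_integrable_cmult[OF e[OF that]])
  have g: "square_integrable M g"
    unfolding g_def by (rule square_integrable_sum[OF ce])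
  have gi: "L2_inner M g h = (\<Sum>i\<in>I. c i * L2_inner M (e i) h)" if "square_integrable M h" for h
    unfolding g_def by (subst L2_inner_sum_left[OF ce that]) (simp_all add: L2_inner_cmult_left)
  have "L2_inner M (e i) g = c i" if "i \<in> I" for i
    using that fin
    by (simp add: L2_inner_commute[of M "e i" g] gi[OF e] orth if_distrib[of "\<lambda>x. _ * x"] cong: if_cong)
  then have "L2_inner M g g = (\<Sum>i\<in>I. (c i)\<^sup>2)"
    by (simp add: gi[OF g] power2_eq_square)
  moreover have "L2_inner M f g = (\<Sum>i\<in>I. (c i)\<^sup>2)"
    unfolding L2_inner_commute[of M f g] gi[OF f]
    by (simp add: c_def power2_eq_square L2_inner_commute[of M f])
  moreover have "0 \<le> L2_inner M (\<lambda>x. f x - g x) (\<lambda>x. f x - g x)"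
    by (rule L2_inner_self_nonneg)
  ultimately show ?thesis
    by (simp add: L2_inner_self_diff[OF f g] c_def)
qed

text \<open>Dominated convergence with majorant \<open>phi^2\<close>. It turns pointwise convergence
  into convergence of norms and inner products, and so takes the place of norm convergence.\<close>

lemma L2_inner_tendsto:
  assumes phi: "square_integrable M phi"
    and f: "\<And>n. square_integrable M (f n)" and g: "\<And>n. square_integrable M (g n)"
    and f': "f' \<in> borel_measurable M" and g': "g' \<in> borel_measurable M"
    and lf: "\<And>x. x \<in> space M \<Longrightarrow> (\<lambda>n. f n x) \<longlonglongrightarrow> f' x"
    and lg: "\<And>x. x \<in> space M \<Longrightarrow> (\<lambda>n. g n x) \<longlonglongrightarrow> g' x"
    and bf: "\<And>n x. x \<in> space M \<Longrightarrow> \<bar>f n x\<bar> \<le> phi x"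
    and bg: "\<And>n x. x \<in> space M \<Longrightarrow> \<bar>g n x\<bar> \<le> phi x"
  shows "(\<lambda>n. L2_inner M (f n) (g n)) \<longlonglongrightarrow> L2_inner M f' g'"
  unfolding L2_inner_def
proof (rule integral_dominated_convergence[where w = "\<lambda>x. phi x * phi x"])
  show "integrable M (\<lambda>x. phi x * phi x)" by (rule integrable_mult_L2[OF phi phi])
  show "AE x in M. norm (f n x * g n x) \<le> phi x * phi x" for n
    using bf bg by (auto intro!: AE_I2 mult_mono simp: abs_mult dest: order_trans[OF abs_ge_zero])
  show "AE x in M. (\<lambda>n. f n x * g n x) \<longlonglongrightarrow> f' x * g' x"
    using lf lg by (auto intro!: AE_I2 tendsto_mult)
qed (use f g f' g' in measurable)

lemma (in pair_sigma_finite) integrable_mult_pair: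
  fixes f g :: "_ \<Rightarrow> real"
  assumes f: "integrable M1 f" and g: "integrable M2 g"
  shows "integrable (M1 \<Otimes>\<^sub>M M2) (\<lambda>(x, y). f x * g y)"
proof (rule Fubini_integrable)
  show "(\<lambda>(x, y). f x * g y) \<in> borel_measurable (M1 \<Otimes>\<^sub>M M2)"
    using borel_measurable_integrable[OF f] borel_measurable_integrable[OF g] by measurable
  have "integrable M1 (\<lambda>x. \<bar>f x\<bar> * (\<integral>y. \<bar>g y\<bar> \<partial>M2))"
    using f by simp
  then show "integrable M1 (\<lambda>x. \<integral>y. norm (case (x, y) of (x, y) \<Rightarrow> f x * g y) \<partial>M2)"
    by (simp add: abs_mult)
qed (use g in simp)

section \<open>Integral operators with a dominated symmetric kernel\<close>

text \<open>The product bound says more than Hilbert-Schmidt: the images of the unit ball lie below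
  a fixed multiple of \<open>phi\<close> at every point. Compactness can therefore be required in
  the weak form of pointwise convergence along a subsequence; the majorant supplies the
  rest.\<close>

locale L2_kernel = sigma_finite_measure M for M :: "'a measure" +
  fixes k :: "'a \<Rightarrow> 'a \<Rightarrow> real" and phi :: "'a \<Rightarrow> real"
  assumes kernel_measurable [measurable]: "(\<lambda>(s, t). k s t) \<in> borel_measurable (M \<Otimes>\<^sub>M M)"
    and kernel_sym: "s \<in> space M \<Longrightarrow> t \<in> space M \<Longrightarrow> k s t = k t s"
    and kernel_bound: "s \<in> space M \<Longrightarrow> t \<in> space M \<Longrightarrow> \<bar>k s t\<bar> \<le> phi s * phi t"
    and phi_L2: "square_integrable M phi"
    and phi_nonneg: "s \<in> space M \<Longrightarrow> 0 \<le> phi s"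
    and compact_op: "(\<And>n. square_integrable M (h n)) \<Longrightarrow> (\<And>n. L2_inner M (h n) (h n) \<le> 1) \<Longrightarrow>
      \<exists>r. strict_mono (r :: nat \<Rightarrow> nat) \<and> (\<forall>s\<in>space M. convergent (\<lambda>n. \<integral>t. k s t * h (r n) t \<partial>M))"
begin

sublocale pair_sigma_finite M M ..

abbreviation "ip \<equiv> L2_inner M"
abbreviation "L2 \<equiv> square_integrable M"

definition op :: "('a \<Rightarrow> real) \<Rightarrow> 'a \<Rightarrow> real" where
  "op h s = (\<integral>t. k s t * h t \<partial>M)"

text \<open>The squared norm of \<open>phi\<close>, which bounds the operator norm
  (\<open>op_norm_le\<close>).\<close>

definition C where "C = ip phi phi"

definition eig :: "real \<Rightarrow> ('a \<Rightarrow> real) \<Rightarrow> bool" where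
  "eig l e \<longleftrightarrow> L2 e \<and> 0 < ip e e \<and> (AE s in M. op e s = l * e s)"

lemma C_nonneg: "0 \<le> C"
  unfolding C_def by (rule L2_inner_self_nonneg)

lemma op_eq_inner: "op h s = ip (k s) h"
  by (simp add: op_def L2_inner_def)

lemma kernel_L2: "s \<in> space M \<Longrightarrow> L2 (k s)"
  by (rule square_integrable_bound[OF phi_L2, of _ "(phi s)\<^sup>2"])
    (use kernel_bound[of s] phi_nonneg in \<open>auto simp: power_mult_distrib[symmetric]
      intro!: power2_le_iff_abs_le[THEN iffD2]\<close>)

lemma kernel_norm_le:
  assumes s: "s \<in> space M"
  shows "ip (k s) (k s) \<le> (phi s)\<^sup>2 * C"
proof -
  have "ip (k s) (k s) \<le> (\<integral>t. (phi s)\<^sup>2 * (phi t * phi t) \<partial>M)"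
    unfolding L2_inner_def
  proof (rule integral_mono)
    show "integrable M (\<lambda>t. k s t * k s t)" by (intro integrable_mult_L2 kernel_L2 s)
    show "integrable M (\<lambda>t. (phi s)\<^sup>2 * (phi t * phi t))"
      by (intro integrable_mult_right integrable_mult_L2 phi_L2)
    fix t assume t: "t \<in> space M"
    have "k s t * k s t = \<bar>k s t\<bar> * \<bar>k s t\<bar>" by simp
    also have "\<dots> \<le> (phi s * phi t) * (phi s * phi t)"
      by (intro mult_mono kernel_bound s t mult_nonneg_nonneg phi_nonneg) auto
    finally show "k s t * k s t \<le> (phi s)\<^sup>2 * (phi t * phi t)" by (simp add: power2_eq_square mult_ac)
  qed
  then show ?thesis by (simp add: C_def L2_inner_def)
qed

text \<open>Cauchy-Schwarz in the inner variable only, at a fixed point \<open>s\<close>. Keeping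
  the estimate pointwise is what yields the majorant needed for dominated convergence.\<close>

lemma op_square_le:
  assumes h: "L2 h" and s: "s \<in> space M"
  shows "(op h s)\<^sup>2 \<le> (phi s)\<^sup>2 * (C * ip h h)"
proof -
  have "(op h s)\<^sup>2 \<le> ip (k s) (k s) * ip h h"
    unfolding op_eq_inner by (rule L2_Cauchy_Schwarz[OF kernel_L2[OF s] h])
  also have "\<dots> \<le> (phi s)\<^sup>2 * C * ip h h"
    by (intro mult_right_mono kernel_norm_le s L2_inner_self_nonneg)
  finally show ?thesis by (simp add: mult_ac)
qed

lemma op_abs_le:
  assumes h: "L2 h" and s: "s \<in> space M" and D: "C * ip h h \<le> D\<^sup>2" "0 \<le> D"
  shows "\<bar>op h s\<bar> \<le> D * phi s"
proof -
  have "(op h s)\<^sup>2 \<le> (D * phi s)\<^sup>2"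
    using op_square_le[OF h s] mult_left_mono[OF D(1), of "(phi s)\<^sup>2"] by (simp add: power_mult_distrib mult_ac)
  then show ?thesis using D(2) phi_nonneg[OF s]
    by (metis abs_le_square_iff abs_of_nonneg mult_nonneg_nonneg)
qed

lemma op_measurable:
  assumes [measurable]: "h \<in> borel_measurable M"
  shows "op h \<in> borel_measurable M"
  unfolding op_def by measurable

lemma op_L2: "L2 h \<Longrightarrow> L2 (op h)"
  using op_square_le[of h]
  by (intro square_integrable_bound[OF phi_L2, of _ "C * ip h h"] op_measurable)
    (auto simp: square_integrable_def mult.commute)

lemma op_add: "L2 f \<Longrightarrow> L2 g \<Longrightarrow> s \<in> space M \<Longrightarrow> op (\<lambda>x. f x + g x) s = op f s + op g s"
  unfolding op_eq_inner L2_inner_commute[of M "k s"] by (rule L2_inner_add_left) (auto intro: kernel_L2)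

lemma op_diff: "L2 f \<Longrightarrow> L2 g \<Longrightarrow> s \<in> space M \<Longrightarrow> op (\<lambda>x. f x - g x) s = op f s - op g s"
  unfolding op_eq_inner L2_inner_commute[of M "k s"] by (rule L2_inner_diff_left) (auto intro: kernel_L2)

lemma op_cmult: "op (\<lambda>x. c * f x) s = c * op f s"
  unfolding op_eq_inner by (rule L2_inner_cmult_right)

text \<open>Fubini and the symmetry of the kernel; the integrable majorant is
  \<open>phi s * |g s| * (phi t * |f t|)\<close>.\<close>

lemma op_sym:
  assumes f: "L2 f" and g: "L2 g"
  shows "ip (op f) g = ip f (op g)"
proof -
  note [measurable] = square_integrable_measurable[OF f] square_integrable_measurable[OF g]
    square_integrable_measurable[OF phi_L2]
  have i1: "integrable M (\<lambda>t. phi t * \<bar>f t\<bar>)" if "L2 f" for f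
    using integrable_mult_L2[OF phi_L2 that, THEN integrable_abs]
    by (rule Bochner_Integration.integrable_cong[THEN iffD1, rotated -1])
      (auto simp: abs_mult phi_nonneg)
  have int: "integrable (M \<Otimes>\<^sub>M M) (\<lambda>(s, t). k s t * f t * g s)"
  proof (rule Bochner_Integration.integrable_bound)
    show "integrable (M \<Otimes>\<^sub>M M) (\<lambda>(s, t). (phi s * \<bar>g s\<bar>) * (phi t * \<bar>f t\<bar>))"
      by (intro integrable_mult_pair i1 f g)
    show "AE x in M \<Otimes>\<^sub>M M. norm (case x of (s, t) \<Rightarrow> k s t * f t * g s)
      \<le> norm (case x of (s, t) \<Rightarrow> (phi s * \<bar>g s\<bar>) * (phi t * \<bar>f t\<bar>))"
    proof (rule AE_I2, clarsimp simp: space_pair_measure)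
      fix s t assume st: "s \<in> space M" "t \<in> space M"
      have "\<bar>k s t\<bar> * (\<bar>f t\<bar> * \<bar>g s\<bar>) \<le> phi s * phi t * (\<bar>f t\<bar> * \<bar>g s\<bar>)"
        by (intro mult_right_mono kernel_bound st) auto
      then show "\<bar>k s t * f t * g s\<bar> \<le> \<bar>phi s * \<bar>g s\<bar> * (phi t * \<bar>f t\<bar>)\<bar>"
        using phi_nonneg[OF st(1)] phi_nonneg[OF st(2)] by (simp add: abs_mult mult_ac)
    qed
  qed measurable
  have "ip (op f) g = (\<integral>s. (\<integral>t. k s t * f t * g s \<partial>M) \<partial>M)"
    by (simp add: L2_inner_def op_def)
  also have "\<dots> = (\<integral>t. (\<integral>s. k s t * f t * g s \<partial>M) \<partial>M)"
    by (rule Fubini_integral[OF int, symmetric])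
  also have "\<dots> = (\<integral>t. (\<integral>s. f t * (k t s * g s) \<partial>M) \<partial>M)"
    by (intro Bochner_Integration.integral_cong refl) (simp_all add: kernel_sym)
  also have "\<dots> = ip f (op g)"
    by (simp add: L2_inner_def op_def)
  finally show ?thesis .
qed

lemma eig_inner:
  assumes e: "eig l e" and f: "L2 f"
  shows "ip (op f) e = l * ip f e"
proof -
  have "ip (op f) e = ip (op e) f"
    using e f by (simp add: op_sym eig_def L2_inner_commute[of M f])
  also have "\<dots> = ip (\<lambda>x. l * e x) f"
    using e f by (intro L2_inner_cong_AE) (auto simp: eig_def intro: square_integrable_measurable op_L2 square_integrable_cmult)
  finally show ?thesis by (simp add: L2_inner_cmult_left L2_inner_commute[of M e f])
qed

lemma eig_orthogonal:
  assumes "eig l e" "eig m f" "l \<noteq> m"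
  shows "ip e f = 0"
proof -
  have "l * ip f e = m * ip e f"
    using eig_inner[OF assms(1), of f] eig_inner[OF assms(2), of e] op_sym[of e f] assms
      L2_inner_commute[of M "op f" e] by (simp add: eig_def)
  with assms(3) show ?thesis by (simp add: L2_inner_commute[of M e f])
qed

lemma op_norm_le:
  assumes h: "L2 h"
  shows "ip (op h) (op h) \<le> C\<^sup>2 * ip h h"
proof -
  have "ip (op h) (op h) \<le> (\<integral>s. (C * ip h h) * (phi s * phi s) \<partial>M)"
    unfolding L2_inner_def[of M "op h"]
    by (intro integral_mono integrable_mult_right integrable_mult_L2 op_L2 h phi_L2)
      (use op_square_le[OF h] in \<open>simp add: power2_eq_square mult_ac\<close>)
  also have "\<dots> = C\<^sup>2 * ip h h" by (simp add: C_def L2_inner_def power2_eq_square)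
  finally show ?thesis .
qed

lemma op_tendsto:
  assumes h: "\<And>n. L2 (h n)" and v: "v \<in> borel_measurable M"
    and b: "\<And>n x. x \<in> space M \<Longrightarrow> \<bar>h n x\<bar> \<le> D * phi x"
    and l: "\<And>x. x \<in> space M \<Longrightarrow> (\<lambda>n. h n x) \<longlonglongrightarrow> v x"
    and s: "s \<in> space M"
  shows "(\<lambda>n. op (h n) s) \<longlonglongrightarrow> op v s"
  unfolding op_def
proof (rule integral_dominated_convergence[where w = "\<lambda>t. (phi s * phi t) * (D * phi t)"])
  have "integrable M (\<lambda>t. (phi s * D) * (phi t * phi t))"
    by (intro integrable_mult_right integrable_mult_L2 phi_L2)
  then show "integrable M (\<lambda>t. (phi s * phi t) * (D * phi t))" by (simp add: mult_ac)
  show "AE t in M. norm (k s t * h n t) \<le> (phi s * phi t) * (D * phi t)" for n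
    using b kernel_bound[OF s] phi_nonneg s
    by (auto intro!: AE_I2 mult_mono mult_nonneg_nonneg simp: abs_mult)
  show "AE t in M. (\<lambda>n. k s t * h n t) \<longlonglongrightarrow> k s t * v t"
    using l by (auto intro!: AE_I2 tendsto_mult)
  have [measurable]: "k s \<in> borel_measurable M"
    using kernel_L2[OF s] by (simp add: square_integrable_def)
  show "(\<lambda>t. k s t * v t) \<in> borel_measurable M" using v by measurable
  show "(\<lambda>t. k s t * h n t) \<in> borel_measurable M" for n
    using square_integrable_measurable[OF h] by measurable
qed

section \<open>Existence of eigenvectors by power iteration\<close>

lemma op_iterate_L2: "L2 f \<Longrightarrow> L2 ((op ^^ n) f)"
  by (induction n) (auto intro: op_L2)

text \<open>The Rayleigh quotients \<open>q n\<close> of the power iteration increase to some \<open>R\<close>; a limit \<open>v\<close>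
  of the normalized iterates is an eigenvector of the squared operator for \<open>R\<close>, and then
  \<open>v\<close> or \<open>op v + sqrt R * v\<close> is an eigenvector of the operator itself.\<close>

lemma ex_eigenvector_not_orthogonal:
  assumes f: "L2 f" and pos: "0 < ip (op f) (op f)"
  shows "\<exists>l e. l \<noteq> 0 \<and> eig l e \<and> ip f e \<noteq> 0"
proof (rule ccontr)
  assume "\<not> ?thesis"
  then have orth: "ip f e = 0" if "l \<noteq> 0" "eig l e" for l e using that by blast
  define F where "F n = (op ^^ n) f" for n
  define m where "m n = ip (F n) (F n)" for n
  have F: "L2 (F n)" for n unfolding F_def by (rule op_iterate_L2[OF f])
  have FS: "F (Suc n) = op (F n)" for n by (simp add: F_def)
  \<comment> \<open>Moving one operator across the inner product expresses this through the squared
    norms alone. Cauchy-Schwarz then says that \<open>m\<close> is log-convex, which is the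
    monotonicity of the quotients \<open>q\<close>.\<close>
  have FF: "ip (F n) (F (Suc (Suc n))) = m (Suc n)" for n
    unfolding FS m_def by (rule op_sym[symmetric]) (auto intro: F op_L2)
  have m_CS: "(m (Suc n))\<^sup>2 \<le> m n * m (Suc (Suc n))" for n
    using L2_Cauchy_Schwarz[OF F F, of n "Suc (Suc n)"] by (simp add: FF m_def)
  have m_pos1: "0 < m (Suc n)" for n
  proof (induction n)
    case 0
    then show ?case using pos by (simp add: m_def F_def)
  next
    case (Suc n)
    then have "0 < (m (Suc n))\<^sup>2" by simp
    also have "\<dots> \<le> m n * m (Suc (Suc n))" by (rule m_CS)
    finally show ?case
      using L2_inner_self_nonneg[of M "F (Suc (Suc n))"] by (simp add: m_def zero_less_mult_iff)
  qed
  have m_pos: "0 < m n" for n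
  proof (cases n)
    case 0
    have "0 < (m (Suc 0))\<^sup>2" using m_pos1[of 0] by simp
    also have "\<dots> \<le> m 0 * m (Suc (Suc 0))" by (rule m_CS)
    finally show ?thesis
      using m_pos1[of 1] 0 by (simp add: zero_less_mult_iff)
  qed (simp add: m_pos1)
  define q where "q n = m (Suc n) / m n" for n
  have q_pos: "0 < q n" for n by (simp add: q_def m_pos)
  have "incseq q"
  proof (rule incseq_SucI)
    fix n show "q n \<le> q (Suc n)"
      using m_CS[of n] m_pos[of n] m_pos[of "Suc n"]
      by (simp add: q_def divide_simps power2_eq_square mult_ac)
  qed
  moreover have "q n \<le> C\<^sup>2" for n
    using op_norm_le[OF F[of n]] m_pos[of n] by (simp add: q_def m_def FS[symmetric] divide_simps)
  ultimately obtain R where R: "q \<longlonglongrightarrow> R" and Rge: "\<And>n. q n \<le> R"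
    using incseq_convergent by blast
  have R_pos: "0 < R" using q_pos[of 0] Rge[of 0] by linarith
  define c where "c n = 1 / sqrt (m n)" for n
  have c2: "c n * c n = 1 / m n" for n using m_pos[of n] by (simp add: c_def)
  define h where "h n = (\<lambda>x. c n * F n x)" for n
  have h: "L2 (h n)" for n unfolding h_def by (intro square_integrable_cmult F)
  have oph: "op (h n) = (\<lambda>x. c n * F (Suc n) x)" for n
    by (rule ext) (simp add: h_def op_cmult FS)
  have h1: "ip (h n) (h n) = 1" for n
    using c2[of n] m_pos[of n]
    by (simp add: h_def L2_inner_cmult_left L2_inner_cmult_right m_def[symmetric] mult.assoc[symmetric])
  obtain r where r: "strict_mono (r :: nat \<Rightarrow> nat)"
    and conv: "\<And>s. s \<in> space M \<Longrightarrow> convergent (\<lambda>n. \<integral>t. k s t * h (r n) t \<partial>M)"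
    using compact_op[of h] h h1 by auto
  define u where "u n = op (h (r n))" for n
  define v where "v s = (if s \<in> space M then lim (\<lambda>n. u n s) else 0)" for s
  have u: "L2 (u n)" for n unfolding u_def by (intro op_L2 h)
  have uv: "(\<lambda>n. u n s) \<longlonglongrightarrow> v s" if "s \<in> space M" for s
    using conv[OF that] that by (simp add: v_def u_def op_def convergent_LIMSEQ_iff)
  define D where "D = sqrt C"
  have D: "0 \<le> D" "D\<^sup>2 = C" by (simp_all add: D_def C_nonneg)
  have ub: "\<bar>u n s\<bar> \<le> D * phi s" if "s \<in> space M" for n s
    unfolding u_def by (rule op_abs_le[OF h that]) (simp_all add: h1 D)
  have v_meas: "v \<in> borel_measurable M"
    by (rule borel_measurable_LIMSEQ_real[of M u]) (auto intro: uv square_integrable_measurable u)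
  have vb: "\<bar>v s\<bar> \<le> D * phi s" if "s \<in> space M" for s
    by (rule LIMSEQ_le_const2[OF tendsto_rabs[OF uv[OF that]]]) (auto intro: ub that)
  have v: "L2 v"
  proof (rule square_integrable_bound[OF phi_L2 v_meas, of C])
    fix s assume "s \<in> space M"
    then have "(v s)\<^sup>2 \<le> (D * phi s)\<^sup>2"
      using vb phi_nonneg D(1) by (auto simp: power2_le_iff_abs_le)
    then show "(v s)\<^sup>2 \<le> C * (phi s)\<^sup>2" by (simp add: power_mult_distrib D)
  qed
  have Dphi: "L2 (\<lambda>x. D * phi x)" by (rule square_integrable_cmult[OF phi_L2])
  have "(\<lambda>n. ip (u n) (u n)) \<longlonglongrightarrow> ip v v"
    by (rule L2_inner_tendsto[OF Dphi u u v_meas v_meas uv uv ub ub])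
  moreover have "ip (u n) (u n) = q (r n)" for n
    using c2[of "r n"] m_pos[of "r n"]
    by (simp add: u_def oph L2_inner_cmult_left L2_inner_cmult_right m_def[symmetric] q_def
        mult.assoc[symmetric])
  ultimately have "(\<lambda>n. q (r n)) \<longlonglongrightarrow> ip v v" by simp
  \<comment> \<open>The shifts are needed because the norm of the defect \<open>w n\<close> below
    involves \<open>q\<close> at \<open>r n\<close>, \<open>r n + 1\<close> and
    \<open>r n + 2\<close>.\<close>
  moreover have qr: "(\<lambda>n. q (r n + i)) \<longlonglongrightarrow> R" for i
  proof -
    have "filterlim (\<lambda>n. r n + i) sequentially sequentially"
      by (rule filterlim_subseq) (use r in \<open>auto simp: strict_mono_def\<close>)
    then show ?thesis by (rule filterlim_compose[OF R])
  qed
  ultimately have vR: "ip v v = R" using LIMSEQ_unique[OF _ qr[of 0]] by simp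
  \<comment> \<open>By assumption \<open>f\<close> is orthogonal to all eigenvectors with nonzero
    eigenvalue. The iterates inherit this by symmetry, and the limit \<open>v\<close> by dominated
    convergence.\<close>
  have v_orth: "ip v e = 0" if l: "l \<noteq> 0" and e: "eig l e" for l e
  proof -
    have eL: "L2 e" using e by (simp add: eig_def)
    have Fo: "ip (F n) e = 0" for n
    proof (induction n)
      case 0
      then show ?case using orth[OF l e] by (simp add: F_def)
    next
      case (Suc n)
      then show ?case using eig_inner[OF e F[of n]] by (simp add: FS)
    qed
    have "ip (u n) e = 0" for n
      by (simp add: u_def oph L2_inner_cmult_left Fo)
    moreover have "(\<lambda>n. ip (u n) e) \<longlonglongrightarrow> ip v e"
      unfolding L2_inner_def
    proof (rule integral_dominated_convergence[where w = "\<lambda>x. D * phi x * \<bar>e x\<bar>"])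
      show "integrable M (\<lambda>x. D * phi x * \<bar>e x\<bar>)"
        by (rule integrable_mult_L2[OF Dphi]) (rule square_integrable_bound[OF eL, of _ 1], use eL in \<open>auto simp: square_integrable_def\<close>)
      show "(\<lambda>x. v x * e x) \<in> borel_measurable M"
        by (intro borel_measurable_times v_meas square_integrable_measurable[OF eL])
      show "(\<lambda>x. u n x * e x) \<in> borel_measurable M" for n
        by (intro borel_measurable_times square_integrable_measurable[OF u] square_integrable_measurable[OF eL])
    qed (use ub uv in \<open>auto intro!: AE_I2 mult_right_mono tendsto_intros simp: abs_mult\<close>)
    ultimately show ?thesis by (simp add: LIMSEQ_const_iff)
  qed
  have opv: "L2 (op v)" and oopv: "L2 (op (op v))" by (auto intro: op_L2 v)
  \<comment> \<open>The defect of \<open>u n\<close> as an eigenvector of the squared operator for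
    \<open>R\<close>. Its squared norm is a polynomial in values of \<open>q\<close>, with limit
    \<open>R * (R^2 - 2 * R^2 + R^2) = 0\<close>.\<close>
  define w where "w n = (\<lambda>x. op (op (u n)) x - R * u n x)" for n
  have w: "L2 (w n)" for n
    unfolding w_def by (intro square_integrable_diff square_integrable_cmult op_L2 u)
  define w' where "w' = (\<lambda>x. op (op v) x - R * v x)"
  have w': "L2 w'" unfolding w'_def by (intro square_integrable_diff square_integrable_cmult oopv v)
  have ou: "(\<lambda>n. op (u n) s) \<longlonglongrightarrow> op v s" if "s \<in> space M" for s
    by (rule op_tendsto[OF u v_meas ub uv that])
  have uC: "ip (u n) (u n) \<le> C\<^sup>2" for n
    using op_norm_le[OF h[of "r n"]] by (simp add: u_def h1)
  have oub: "\<bar>op (u n) s\<bar> \<le> (D * C) * phi s" if "s \<in> space M" for s n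
    by (rule op_abs_le[OF u that])
      (use mult_left_mono[OF uC C_nonneg] D C_nonneg in \<open>auto simp: power_mult_distrib\<close>)
  have oou: "(\<lambda>n. op (op (u n)) s) \<longlonglongrightarrow> op (op v) s" if "s \<in> space M" for s
    by (rule op_tendsto[OF op_L2[OF u] square_integrable_measurable[OF opv] oub ou that])
  have ouC: "ip (op (u n)) (op (u n)) \<le> C\<^sup>2 * C\<^sup>2" for n
    using op_norm_le[OF u[of n]] mult_left_mono[OF uC[of n], of "C\<^sup>2"] by simp
  have ooub: "\<bar>op (op (u n)) s\<bar> \<le> (D * (C * C)) * phi s" if "s \<in> space M" for s n
    by (rule op_abs_le[OF op_L2[OF u] that])
      (use mult_left_mono[OF ouC C_nonneg] D(1) C_nonneg in
        \<open>auto simp: power_mult_distrib D(2)\<close>)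
  have wb: "\<bar>w n s\<bar> \<le> (D * (C * C) + R * D) * phi s" if "s \<in> space M" for s n
  proof -
    have "\<bar>w n s\<bar> \<le> \<bar>op (op (u n)) s\<bar> + R * \<bar>u n s\<bar>"
      using abs_triangle_ineq4[of "op (op (u n)) s" "R * u n s"] R_pos by (simp add: w_def abs_mult)
    also have "\<dots> \<le> (D * (C * C)) * phi s + R * (D * phi s)"
      using R_pos by (intro add_mono mult_left_mono ub ooub that) auto
    finally show ?thesis by (simp add: algebra_simps)
  qed
  have ww: "(\<lambda>n. w n s) \<longlonglongrightarrow> w' s" if "s \<in> space M" for s
    unfolding w_def w'_def by (intro tendsto_intros oou uv that)
  have "(\<lambda>n. ip (w n) (w n)) \<longlonglongrightarrow> ip w' w'"
    by (rule L2_inner_tendsto[OF square_integrable_cmult[OF phi_L2] w w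
        square_integrable_measurable[OF w'] square_integrable_measurable[OF w'] ww ww wb wb])
  moreover have "ip (w n) (w n) = q (r n) * (q (r n + 1) * q (r n + 2) - 2 * R * q (r n + 1) + R\<^sup>2)" for n
  proof -
    define j where "j = r n"
    have oou: "op (op (u n)) = (\<lambda>x. c j * F (Suc (Suc (Suc j))) x)"
    proof -
      have "op (u n) = (\<lambda>x. c j * F (Suc (Suc j)) x)"
        by (rule ext) (simp add: u_def oph op_cmult FS j_def)
      then show ?thesis by (intro ext) (simp only: op_cmult FS)
    qed
    have eq: "ip (w n) (w n) = ip (op (op (u n))) (op (op (u n))) - 2 * (R * ip (op (op (u n))) (u n))
      + R * (R * ip (u n) (u n))"
      unfolding w_def
      by (subst L2_inner_self_diff) (auto intro: op_L2 u square_integrable_cmult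
          simp: L2_inner_cmult_left L2_inner_cmult_right)
    also have "ip (op (op (u n))) (op (op (u n))) = m (Suc (Suc (Suc j))) / m j"
      using c2[of j] unfolding oou by (simp add: L2_inner_cmult_left L2_inner_cmult_right m_def[symmetric] mult.assoc[symmetric])
    also have "ip (op (op (u n))) (u n) = m (Suc (Suc j)) / m j"
      using c2[of j] unfolding oou unfolding u_def oph j_def[symmetric]
      by (simp add: L2_inner_cmult_left L2_inner_cmult_right FF mult.assoc[symmetric]
          L2_inner_commute[of M "F (Suc (Suc (Suc j)))" "F (Suc j)"])
    also have "ip (u n) (u n) = m (Suc j) / m j"
      using c2[of j] unfolding u_def oph j_def[symmetric]
      by (simp add: L2_inner_cmult_left L2_inner_cmult_right m_def[symmetric] mult.assoc[symmetric])
    finally have ww: "ip (w n) (w n) = m (Suc (Suc (Suc j))) / m j - 2 * (R * (m (Suc (Suc j)) / m j))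
      + R * (R * (m (Suc j) / m j))" .
    have nz: "m i \<noteq> 0" for i using m_pos[of i] by simp
    have e1: "q j * (q (j + 1) * q (j + 2)) = m (Suc (Suc (Suc j))) / m j"
      and e2: "q j * q (j + 1) = m (Suc (Suc j)) / m j" and e3: "q j = m (Suc j) / m j"
      by (simp_all add: q_def nz)
    have e4: "q j * (q (j + 1) * q (j + 2) - 2 * R * q (j + 1) + R\<^sup>2)
      = q j * (q (j + 1) * q (j + 2)) - 2 * (R * (q j * q (j + 1))) + R * (R * q j)"
      by (simp add: algebra_simps power2_eq_square)
    show ?thesis
      unfolding ww j_def[symmetric] e4
      unfolding e1[symmetric] e2[symmetric] e3[symmetric] ..
  qed
  moreover have "(\<lambda>n. q (r n) * (q (r n + 1) * q (r n + 2) - 2 * R * q (r n + 1) + R\<^sup>2))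
      \<longlonglongrightarrow> R * (R * R - 2 * R * R + R\<^sup>2)"
    using qr[of 0] by (intro tendsto_intros qr) simp
  ultimately have "ip w' w' = 0"
    using LIMSEQ_unique by (fastforce simp: power2_eq_square)
  then have w'0: "AE x in M. op (op v) x = R * v x"
    using L2_inner_self_eq_0_iff[OF w'] by (simp add: w'_def)
  define p where "p = sqrt R"
  have p: "0 < p" "p * p = R" using R_pos by (simp_all add: p_def)
  \<comment> \<open>The equation for \<open>v\<close> factors as
    \<open>(op - p) (op + p) v = 0\<close>. Hence \<open>z = (op + p) v\<close> is an eigenvector
    for \<open>p\<close>, unless it vanishes and \<open>v\<close> itself is one for
    \<open>- p\<close>.\<close>
  define z where "z = (\<lambda>x. op v x + p * v x)"
  have pv: "L2 (\<lambda>x. p * v x)" by (rule square_integrable_cmult[OF v])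
  have z: "L2 z" unfolding z_def by (intro square_integrable_add opv pv)
  show False
  proof (cases "ip z z = 0")
    case True
    then have "AE x in M. op v x = - p * v x"
      using L2_inner_self_eq_0_iff[OF z] by (auto simp: z_def elim!: eventually_mono)
    then have "eig (- p) v" using v vR R_pos by (simp add: eig_def)
    from v_orth[OF _ this] p vR R_pos show False by simp
  next
    case False
    then have "0 < ip z z" using L2_inner_self_nonneg[of M z] by simp
    moreover have "AE x in M. op z x = p * z x"
      using w'0 AE_space
    proof eventually_elim
      case (elim x)
      have "op z x = op (op v) x + p * op v x"
        unfolding z_def using op_add[OF opv pv elim(2)] by (simp add: op_cmult)
      also have "\<dots> = p * z x"
        using elim(1) p(2) by (simp add: z_def algebra_simps)
      finally show ?case .
    qed
    ultimately have ez: "eig p z" using z by (simp add: eig_def)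
    \<comment> \<open>Since \<open>z\<close> is an eigenvector for \<open>p\<close>, symmetry gives
      \<open><op v, z> = p * <v, z>\<close>, and \<open>v\<close> is orthogonal to \<open>z\<close>;
      so \<open>z\<close> would have norm \<open>0\<close>.\<close>
    have "ip z z = ip (op v) z + p * ip v z"
      using L2_inner_add_left[OF opv pv z] by (simp add: z_def[symmetric] L2_inner_cmult_left)
    also have "\<dots> = 0"
      using eig_inner[OF ez v] v_orth[OF _ ez] p by simp
    finally show False using False by simp
  qed
qed

section \<open>Finiteness of the spectrum away from zero\<close>

text \<open>Normalized eigenvectors of distinct eigenvalues are orthonormal, and the coefficients of
  the row \<open>k s\<close> against them are the values \<open>op (e l) s\<close>. Integrating
  Bessel's inequality over \<open>s\<close> bounds the sum of the \<open>l^2\<close> by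
  \<open>C^2\<close>, so at most \<open>C^2 / \<epsilon>^2\<close> distinct eigenvalues can have
  modulus at least \<open>\<epsilon>\<close>.\<close>

lemma finite_large_eigenvalues:
  assumes eps: "0 < \<epsilon>"
  shows "finite {l. \<epsilon> \<le> \<bar>l\<bar> \<and> (\<exists>e. eig l e)}" (is "finite ?S")
proof (rule ccontr)
  assume "infinite ?S"
  obtain n :: nat where n: "C\<^sup>2 / \<epsilon>\<^sup>2 < real n" using reals_Archimedean2 by blast
  obtain I where I: "I \<subseteq> ?S" "finite I" "card I = n"
    using infinite_arbitrarily_large[OF \<open>infinite ?S\<close>, of n] by blast
  have "\<exists>e. eig l e \<and> ip e e = 1" if l: "l \<in> I" for l
  proof -
    obtain e where e: "eig l e" using subsetD[OF I(1) l] by auto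
    define c where "c = 1 / sqrt (ip e e)"
    have c: "c * c * ip e e = 1" "L2 e" "AE s in M. op e s = l * e s"
      using e by (simp_all add: eig_def c_def)
    have "eig l (\<lambda>x. c * e x)"
      unfolding eig_def
    proof (intro conjI)
      show "AE s in M. op (\<lambda>x. c * e x) s = l * (c * e s)"
        using c(3) by eventually_elim (simp add: op_cmult)
    qed (use c in \<open>auto intro: square_integrable_cmult simp: L2_inner_cmult_left L2_inner_cmult_right mult.assoc\<close>)
    moreover have "ip (\<lambda>x. c * e x) (\<lambda>x. c * e x) = 1"
      using c by (simp add: L2_inner_cmult_left L2_inner_cmult_right mult.assoc)
    ultimately show ?thesis by blast
  qed
  then obtain e where e: "\<And>l. l \<in> I \<Longrightarrow> eig l (e l)" "\<And>l. l \<in> I \<Longrightarrow> ip (e l) (e l) = 1" by metis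
  have eL: "L2 (e l)" if "l \<in> I" for l using e(1)[OF that] by (simp add: eig_def)
  have le: "(\<Sum>l\<in>I. (op (e l) s)\<^sup>2) \<le> C * (phi s)\<^sup>2" if s: "s \<in> space M" for s
  proof -
    have "(\<Sum>l\<in>I. (ip (k s) (e l))\<^sup>2) \<le> ip (k s) (k s)"
      by (rule L2_Bessel_inequality[OF kernel_L2[OF s] eL I(2)])
        (use e eig_orthogonal[OF e(1) e(1)] in auto)
    with kernel_norm_le[OF s] show ?thesis by (simp add: op_eq_inner mult.commute)
  qed
  have nrm: "(\<integral>s. (op (e l) s)\<^sup>2 \<partial>M) = l\<^sup>2" if l: "l \<in> I" for l
  proof -
    have "ip (op (e l)) (op (e l)) = ip (op (op (e l))) (e l)"
      by (rule op_sym[symmetric]) (auto intro: op_L2 eL l)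
    also have "\<dots> = l * (l * ip (e l) (e l))"
      using eig_inner[OF e(1)[OF l] op_L2[OF eL[OF l]]] eig_inner[OF e(1)[OF l] eL[OF l]] by simp
    finally show ?thesis using e(2)[OF l] by (simp add: L2_inner_def power2_eq_square)
  qed
  have "real n * \<epsilon>\<^sup>2 = (\<Sum>l\<in>I. \<epsilon>\<^sup>2)" using I by simp
  also have "\<dots> \<le> (\<Sum>l\<in>I. l\<^sup>2)"
  proof (rule sum_mono)
    fix l assume "l \<in> I"
    then have "\<epsilon> \<le> \<bar>l\<bar>" using I by auto
    then have "\<epsilon>\<^sup>2 \<le> \<bar>l\<bar>\<^sup>2" using eps by (intro power_mono) auto
    then show "\<epsilon>\<^sup>2 \<le> l\<^sup>2" by simp
  qed
  also have "\<dots> = (\<integral>s. (\<Sum>l\<in>I. (op (e l) s)\<^sup>2) \<partial>M)"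
    by (subst Bochner_Integration.integral_sum)
      (use op_L2[OF eL] in \<open>auto simp: nrm square_integrable_def\<close>)
  also have "\<dots> \<le> (\<integral>s. C * (phi s)\<^sup>2 \<partial>M)"
    by (intro integral_mono integrable_mult_right integrable_sum)
      (use op_L2[OF eL] phi_L2 le in \<open>auto simp: square_integrable_def\<close>)
  also have "\<dots> = C\<^sup>2" by (simp add: C_def L2_inner_def power2_eq_square)
  finally have "real n \<le> C\<^sup>2 / \<epsilon>\<^sup>2" using eps by (simp add: field_simps)
  with n show False by simp
qed

section \<open>Infinitude of the spectrum\<close>

text \<open>The polynomial in the operator with the roots \<open>ls\<close>, kept in factored form
  and applied to \<open>h\<close>.\<close>

fun deflate :: "real list \<Rightarrow> ('a \<Rightarrow> real) \<Rightarrow> 'a \<Rightarrow> real" where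
  "deflate [] h = h"
| "deflate (l # ls) h = (\<lambda>x. op (deflate ls h) x - l * deflate ls h x)"

lemma deflate_L2: "L2 h \<Longrightarrow> L2 (deflate ls h)"
  by (induction ls) (auto intro!: square_integrable_diff square_integrable_cmult op_L2)

text \<open>A factor \<open>op - a\<close> multiplies the inner product with \<open>e\<close> by
  \<open>l - a\<close>. The factor with \<open>a = l\<close> annihilates it, and later factors keep
  it zero.\<close>

lemma deflate_orthogonal:
  assumes h: "L2 h" and e: "eig l e" and l: "l \<in> set ls"
  shows "ip (deflate ls h) e = 0"
  using l
proof (induction ls)
  case (Cons a ls)
  let ?g = "deflate ls h"
  have g: "L2 ?g" by (rule deflate_L2[OF h])
  have "L2 e" using e by (simp add: eig_def)
  then have "ip (deflate (a # ls) h) e = ip (op ?g) e - ip (\<lambda>x. a * ?g x) e"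
    by (simp add: L2_inner_diff_left op_L2 square_integrable_cmult g)
  also have "\<dots> = (l - a) * ip ?g e"
    by (simp add: eig_inner[OF e g] L2_inner_cmult_left algebra_simps)
  finally show ?case using Cons by auto
qed simp

lemma deflate_eq:
  assumes h: "L2 h"
  shows "\<exists>g. L2 g \<and> (\<forall>x\<in>space M. deflate ls h x = op g x + (\<Prod>l\<leftarrow>ls. - l) * h x)"
proof (induction ls)
  case Nil
  show ?case by (intro exI[of _ "\<lambda>x. 0"]) (simp add: square_integrable_zero op_def)
next
  case (Cons a ls)
  then obtain g where g: "L2 g" "\<And>x. x \<in> space M \<Longrightarrow> deflate ls h x = op g x + (\<Prod>l\<leftarrow>ls. - l) * h x"
    by blast
  let ?d = "deflate ls h"
  have d: "L2 ?d" by (rule deflate_L2[OF h])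
  have ag: "L2 (\<lambda>x. a * g x)" by (rule square_integrable_cmult[OF g(1)])
  \<comment> \<open>With \<open>d = op g + c * h\<close> for the shorter list,
    \<open>op d - a * d = op (d - a * g) - a * c * h\<close>; this is the source of the witness and
    of the new constant term.\<close>
  show ?case
  proof (intro exI[of _ "\<lambda>x. ?d x - a * g x"] conjI ballI)
    show "L2 (\<lambda>x. ?d x - a * g x)" by (intro square_integrable_diff d ag)
    fix x assume x: "x \<in> space M"
    show "deflate (a # ls) h x = op (\<lambda>x. ?d x - a * g x) x + (\<Prod>l\<leftarrow>a # ls. - l) * h x"
      by (simp add: op_diff[OF d ag x] op_cmult g(2)[OF x] algebra_simps)
  qed
qed

lemma infinite_eigenvalues:
  assumes inj: "\<And>f. L2 f \<Longrightarrow> (AE x in M. op f x = 0) \<Longrightarrow> AE x in M. f x = 0"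
    and h: "L2 h" and not_range: "\<And>g. L2 g \<Longrightarrow> \<not> (AE x in M. h x = op g x)"
  shows "infinite {l. l \<noteq> 0 \<and> (\<exists>e. eig l e)}" (is "infinite ?S")
proof
  assume "finite ?S"
  then obtain ls where ls: "set ls = ?S" using finite_list by blast
  define c where "c = (\<Prod>l\<leftarrow>ls. - l)"
  have "0 \<notin> set ls" unfolding ls by simp
  then have c: "c \<noteq> 0" unfolding c_def prod_list_zero_iff by auto
  let ?f = "deflate ls h"
  have f: "L2 ?f" by (rule deflate_L2[OF h])
  have "ip ?f e = 0" if "l \<noteq> 0" "eig l e" for l e
    by (rule deflate_orthogonal[OF h that(2)]) (use ls that in auto)
  \<comment> \<open>A nonzero image of \<open>?f\<close> would produce an eigenvector not orthogonal
    to \<open>?f\<close>, although every eigenvalue of such a vector is among the roots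
    \<open>ls\<close>.\<close>
  then have "\<not> 0 < ip (op ?f) (op ?f)"
    using ex_eigenvector_not_orthogonal[OF f] by blast
  then have "ip (op ?f) (op ?f) = 0"
    using L2_inner_self_nonneg[of M "op ?f"] by simp
  then have "AE x in M. op ?f x = 0"
    using L2_inner_self_eq_0_iff[OF op_L2[OF f]] by simp
  then have f0: "AE x in M. ?f x = 0" by (rule inj[OF f])
  obtain g where g: "L2 g" "\<And>x. x \<in> space M \<Longrightarrow> ?f x = op g x + c * h x"
    using deflate_eq[OF h, of ls] unfolding c_def by blast
  have "AE x in M. h x = op (\<lambda>x. (- 1 / c) * g x) x"
    using f0 AE_space
  proof eventually_elim
    case (elim x)
    then have "op g x + c * h x = 0" using g(2) by simp
    then show ?case unfolding op_cmult using c by (simp add: field_simps add_eq_0_iff)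
  qed
  with not_range[OF square_integrable_cmult[OF g(1)]] show False by blast
qed

end

section \<open>Laplace transforms on the half-line\<close>

lemma borel_measurable_pos_measureI: "f \<in> borel_measurable borel \<Longrightarrow> f \<in> borel_measurable pos_measure"
  by (auto intro!: measurable_restrict_space1 measurable_completion)

lemma sigma_finite_lebesgue: "sigma_finite_measure (lebesgue :: real measure)"
proof
  obtain A where A: "countable A" "A \<subseteq> sets lborel" "\<Union> A = (UNIV :: real set)" "\<forall>a\<in>A. emeasure lborel a \<noteq> \<infinity>"
    using lborel.sigma_finite_countable by auto
  show "\<exists>A. countable A \<and> A \<subseteq> sets (lebesgue :: real measure) \<and> \<Union> A = space lebesgue
      \<and> (\<forall>a\<in>A. emeasure lebesgue a \<noteq> \<infinity>)"
    by (rule exI[of _ A]) (use A in \<open>auto simp: emeasure_completion main_part_sets\<close>)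
qed

lemma sigma_finite_pos_measure: "sigma_finite_measure pos_measure"
  by (intro sigma_finite_measure_restrict_space sigma_finite_lebesgue) auto

interpretation pos: sigma_finite_measure pos_measure
  by (rule sigma_finite_pos_measure)

interpretation pos_pair: pair_sigma_finite pos_measure pos_measure ..

lemma space_pos_measure [simp]: "space pos_measure = {0<..}"
  by simp

lemma integrable_pos_iff:
  fixes f :: "real \<Rightarrow> 'a::{banach, second_countable_topology}"
  assumes "f \<in> borel_measurable borel"
  shows "integrable pos_measure f \<longleftrightarrow> integrable lborel (\<lambda>x. indicator {0<..} x *\<^sub>R f x)"
  using assms by (subst integrable_restrict_space) (auto intro!: integrable_completion)

lemma integral_pos_eq:
  fixes f :: "real \<Rightarrow> 'a::{banach, second_countable_topology}"
  assumes "f \<in> borel_measurable borel"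
  shows "integral\<^sup>L pos_measure f = integral\<^sup>L lborel (\<lambda>x. indicator {0<..} x *\<^sub>R f x)"
  using assms by (subst integral_restrict_space) (auto intro!: integral_completion)

lemma has_bochner_integral_power_exp:
  assumes r: "0 < r"
  shows "has_bochner_integral pos_measure (\<lambda>s. s ^ n * exp (- r * s)) (fact n / r ^ Suc n)"
proof -
  \<comment> \<open>The Erlang density is \<open>r^(n+1) * s^n * exp (- r * s) / n!\<close> on the
    half-line; its moment of order \<open>0\<close> is the required integral up to
    normalization.\<close>
  have "has_bochner_integral lborel (erlang_density n r) 1"
    using nn_integral_erlang_ith_moment[OF r, of n 0] r
    by (intro has_bochner_integral_nn_integral) auto
  from has_bochner_integral_mult_right[OF this, of "fact n / r ^ Suc n"]
  have "has_bochner_integral lborel (\<lambda>s. fact n / r ^ Suc n * erlang_density n r s) (fact n / r ^ Suc n)"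
    by simp
  \<comment> \<open>The two sides can differ at \<open>0\<close>: for \<open>n = 0\<close> the
    density does not vanish there, whereas the open half-line omits the point.\<close>
  moreover have "AE s in lborel. fact n / r ^ Suc n * erlang_density n r s = indicator {0<..} s *\<^sub>R (s ^ n * exp (- r * s))"
    using AE_lborel_singleton[of 0]
    by eventually_elim (use r in \<open>auto simp: erlang_density_def indicator_def\<close>)
  ultimately have "has_bochner_integral lborel (\<lambda>s. indicator {0<..} s *\<^sub>R (s ^ n * exp (- r * s))) (fact n / r ^ Suc n)"
    by (subst has_bochner_integral_cong_AE[symmetric]) auto
  then show ?thesis
    by (simp add: has_bochner_integral_iff integrable_pos_iff integral_pos_eq)
qed

lemma integrable_power_exp: "0 < r \<Longrightarrow> integrable pos_measure (\<lambda>s. s ^ n * exp (- r * s))"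
  using has_bochner_integral_power_exp by (auto simp: has_bochner_integral_iff)

lemma integral_power_exp: "0 < r \<Longrightarrow> (\<integral>s. s ^ n * exp (- r * s) \<partial>pos_measure) = fact n / r ^ Suc n"
  using has_bochner_integral_power_exp by (auto simp: has_bochner_integral_iff)

text \<open>Termwise integration, as the Laplace transform of \<open>s^(k+1) / (k+1)!\<close> at
  \<open>r\<close> is \<open>1 / r^(k+2)\<close>; \<open>U\<close> is a Borel transform. Starting at
  exponent \<open>2\<close> matches the factor \<open>1 / z^2\<close> of the three-term equation.
  The lemma serves both the Bessel kernel and the inversion of Laplace transforms, where the bound
  on \<open>U\<close> controls growth.\<close>

lemma laplace_borel_series:
  fixes c :: "nat \<Rightarrow> complex"
  assumes r: "0 < r" and c: "summable (\<lambda>k. norm (c k) / r ^ k)"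
  defines "U \<equiv> \<lambda>s. \<Sum>k. c k * of_real (s ^ Suc k / fact (Suc k))"
  shows "integrable pos_measure (\<lambda>s. U s * of_real (exp (- r * s)))" (is ?A)
    and "(\<integral>s. U s * of_real (exp (- r * s)) \<partial>pos_measure) = (\<Sum>k. c k / of_real r ^ (k + 2))" (is ?B)
    and "0 \<le> s \<Longrightarrow> norm (U s) \<le> (\<Sum>k. norm (c k) / r ^ k) * (s * exp (r * s))" (is "_ \<Longrightarrow> ?C")
    and "0 \<le> s \<Longrightarrow> summable (\<lambda>k. norm (c k * of_real (s ^ Suc k / fact (Suc k))))" (is "_ \<Longrightarrow> ?D")
proof -
  have bnd: "norm (c k * of_real (s ^ Suc k / fact (Suc k))) \<le> norm (c k) / r ^ k * (s * exp (r * s))"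
    if s: "0 \<le> s" for k s
  proof -
    have "(r * s) ^ k / fact k \<le> exp (r * s)"
    proof -
      have "(\<Sum>i\<in>{k}. (r * s) ^ i / fact i) \<le> (\<Sum>i. (r * s) ^ i / fact i)"
        using r s summable_exp[of "r * s"]
        by (intro sum_le_suminf) (auto simp: divide_inverse mult.commute)
      then show ?thesis by (simp add: exp_def divide_inverse mult.commute)
    qed
    moreover have "s ^ Suc k / fact (Suc k) \<le> s * (s ^ k / fact k)"
    proof -
      have "s * s ^ k / fact (Suc k) \<le> s * s ^ k / fact k"
        using s by (intro divide_left_mono fact_mono) auto
      then show ?thesis by simp
    qed
    moreover have "s ^ k / fact k = (r * s) ^ k / fact k / r ^ k" using r by (simp add: power_mult_distrib)
    ultimately have "s ^ Suc k / fact (Suc k) \<le> s * (exp (r * s) / r ^ k)"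
      using r s by (smt (verit, best) divide_right_mono mult_left_mono zero_le_power)
    then have "norm (c k) * (s ^ Suc k / fact (Suc k)) \<le> norm (c k) * (s * (exp (r * s) / r ^ k))"
      by (rule mult_left_mono) simp
    then show ?thesis using s unfolding norm_mult norm_of_real by (simp add: mult_ac del: fact_Suc)
  qed
  have D: "summable (\<lambda>k. norm (c k * of_real (s ^ Suc k / fact (Suc k))))" if s: "0 \<le> s" for s
    by (rule summable_comparison_test'[OF summable_mult2[OF c, of "s * exp (r * s)"]])
      (use bnd[OF s] in simp)
  show ?C if s: "0 \<le> s"
  proof -
    have "norm (U s) \<le> (\<Sum>k. norm (c k * of_real (s ^ Suc k / fact (Suc k))))"
      unfolding U_def by (rule summable_norm[OF D[OF s]])
    also have "\<dots> \<le> (\<Sum>k. norm (c k) / r ^ k * (s * exp (r * s)))"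
      by (rule suminf_le[OF bnd[OF s] D[OF s] summable_mult2[OF c]])
    also have "\<dots> = (\<Sum>k. norm (c k) / r ^ k) * (s * exp (r * s))"
      by (rule suminf_mult2[OF c, symmetric])
    finally show ?thesis .
  qed
  show ?D if "0 \<le> s" by (rule D[OF that])
  define f where "f k s = c k * of_real (s ^ Suc k / fact (Suc k)) * of_real (exp (- r * s))" for k s
  have f_eq: "f k s = (c k / of_real (fact (Suc k))) * of_real (s ^ Suc k * exp (- r * s))" for k s
    by (simp add: f_def)
  have f_int: "integrable pos_measure (f k)" for k
    unfolding f_eq by (intro integrable_mult_right integrable_of_real integrable_power_exp r)
  have f_val: "integral\<^sup>L pos_measure (f k) = c k / of_real r ^ (k + 2)" for k
  proof -
    have "integral\<^sup>L pos_measure (f k) = c k / of_real (fact (Suc k)) * of_real (\<integral>s. s ^ Suc k * exp (- r * s) \<partial>pos_measure)"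
      unfolding f_eq integral_mult_right_zero integral_complex_of_real ..
    also have "\<dots> = c k / of_real (fact (Suc k)) * of_real (fact (Suc k) / r ^ Suc (Suc k))"
      unfolding integral_power_exp[OF r] ..
    finally show ?thesis by (simp del: fact_Suc of_real_fact)
  qed
  have nf: "norm (f k s) = norm (c k) / fact (Suc k) * (s ^ Suc k * exp (- r * s))" if "s \<in> space pos_measure" for k s
    using that unfolding f_eq by (simp add: norm_mult norm_divide norm_power del: fact_Suc)
  have nf_int: "(\<integral>s. norm (f k s) \<partial>pos_measure) = norm (c k) / r ^ k * (1 / r\<^sup>2)" for k
  proof -
    have "(\<integral>s. norm (f k s) \<partial>pos_measure) = (\<integral>s. norm (c k) / fact (Suc k) * (s ^ Suc k * exp (- r * s)) \<partial>pos_measure)"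
      by (intro Bochner_Integration.integral_cong refl nf)
    also have "\<dots> = norm (c k) / fact (Suc k) * (fact (Suc k) / r ^ Suc (Suc k))"
      by (subst integral_mult_right_zero, subst integral_power_exp[OF r]) (rule refl)
    also have "\<dots> = norm (c k) / r ^ k * (1 / r\<^sup>2)"
      using r by (simp add: field_simps power2_eq_square del: fact_Suc)
    finally show ?thesis .
  qed
  have Uf: "U s * of_real (exp (- r * s)) = (\<Sum>k. f k s)" if "s \<in> space pos_measure" for s
    unfolding U_def f_def
    by (rule suminf_mult2[OF summable_norm_cancel[OF D]]) (use that in simp)
  have s1: "AE s in pos_measure. summable (\<lambda>k. norm (f k s))"
  proof (rule AE_I2)
    fix s assume "s \<in> space pos_measure"
    then have "summable (\<lambda>k. norm (c k * of_real (s ^ Suc k / fact (Suc k))) * exp (- r * s))"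
      by (intro summable_mult2 D) simp
    then show "summable (\<lambda>k. norm (f k s))" unfolding f_def norm_mult[of _ "of_real (exp _)"] by simp
  qed
  have s2: "summable (\<lambda>k. \<integral>s. norm (f k s) \<partial>pos_measure)"
    unfolding nf_int by (rule summable_mult2[OF c])
  show ?A
    using integrable_suminf[OF f_int s1 s2]
      Bochner_Integration.integrable_cong[where M = pos_measure and N = pos_measure, OF refl Uf] by simp
  show ?B
    using integral_suminf[OF f_int s1 s2]
      Bochner_Integration.integral_cong[where M = pos_measure and N = pos_measure, OF refl Uf]
    by (simp add: f_val)
qed

section \<open>The Bessel transform and its Laplace transform\<close>

definition bessel_transform :: "(real \<Rightarrow> complex) \<Rightarrow> real \<Rightarrow> complex" where
  "bessel_transform g s = (\<integral>t. of_real (s * bessel_series (s * t)) * g t \<partial>pos_measure)"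

text \<open>In powers of \<open>s\<close>, the kernel is the Borel series with the coefficients
  \<open>(- t)^k / k!\<close> of an exponential, so its Laplace transform sums to
  \<open>exp (- t / r) / r^2\<close>.\<close>

lemma laplace_bessel_kernel:
  assumes r: "0 < r"
  shows "integrable pos_measure (\<lambda>s. of_real (s * bessel_series (s * t)) * of_real (exp (- r * s)) :: complex)"
    and "(\<integral>s. of_real (s * bessel_series (s * t)) * of_real (exp (- r * s)) \<partial>pos_measure)
      = (of_real (exp (- t / r) / r\<^sup>2) :: complex)"
proof -
  define c :: "nat \<Rightarrow> complex" where "c k = of_real ((- t) ^ k / fact k)" for k
  have nc: "norm (c k) / r ^ k = inverse (fact k) * (\<bar>t\<bar> / r) ^ k" for k
    unfolding c_def norm_of_real by (simp add: power_abs power_divide field_simps)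
  have c: "summable (\<lambda>k. norm (c k) / r ^ k)" unfolding nc by (rule summable_exp)
  have U: "(\<Sum>k. c k * of_real (s ^ Suc k / fact (Suc k))) = of_real (s * bessel_series (s * t))" for s
  proof -
    have "s * ((-1) ^ k / (fact k * fact (Suc k)) * (s * t) ^ k) = (- t) ^ k / fact k * (s ^ Suc k / fact (Suc k))" for k
      by (simp add: power_mult_distrib power_minus[of t] del: fact_Suc)
    then have "s * bessel_series (s * t) = (\<Sum>k. (- t) ^ k / fact k * (s ^ Suc k / fact (Suc k)))"
      unfolding bessel_series_def suminf_mult[OF summable_bessel_series, symmetric] by (simp only:)
    moreover have "summable (\<lambda>k. (- t) ^ k / fact k * (s ^ Suc k / fact (Suc k)))"
      using summable_mult[OF summable_bessel_series[of "s * t"], of s]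
      by (simp add: power_mult_distrib power_minus[of t] mult_ac del: fact_Suc)
    ultimately show ?thesis
      unfolding c_def of_real_mult[symmetric] by (simp only: suminf_of_real)
  qed
  have V: "(\<Sum>k. c k / of_real r ^ (k + 2)) = of_real (exp (- t / r) / r\<^sup>2)"
  proof -
    have "c k / of_real r ^ (k + 2) = of_real (inverse (fact k) * (- t / r) ^ k * (1 / r\<^sup>2))" for k
      unfolding c_def of_real_power[symmetric] of_real_divide[symmetric]
      by (simp only: power_mult_distrib divide_inverse power_add inverse_mult_distrib mult_ac mult_1_left mult_1_right power_inverse)
    moreover have "(\<Sum>k. inverse (fact k) * (- t / r) ^ k * (1 / r\<^sup>2)) = exp (- t / r) / r\<^sup>2"
      by (subst suminf_mult2[OF summable_exp, symmetric]) (simp add: exp_def divide_inverse mult.commute)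
    ultimately show ?thesis
      using suminf_of_real[OF summable_mult2[OF summable_exp[of "- t / r"], of "1 / r\<^sup>2"], where 'a = complex] by simp
  qed
  show "integrable pos_measure (\<lambda>s. of_real (s * bessel_series (s * t)) * of_real (exp (- r * s)) :: complex)"
    using laplace_borel_series(1)[OF r c] unfolding U .
  show "(\<integral>s. of_real (s * bessel_series (s * t)) * of_real (exp (- r * s)) \<partial>pos_measure)
      = (of_real (exp (- t / r) / r\<^sup>2) :: complex)"
    using laplace_borel_series(2)[OF r c] unfolding U V .
qed

lemma borel_measurable_bessel_series [measurable]: "bessel_series \<in> borel_measurable borel"
  by (intro borel_measurable_continuous_onI continuous_at_imp_continuous_on) (simp add: isCont_bessel_series)

lemma measurable_ident_pos [measurable]: "(\<lambda>x. x) \<in> borel_measurable pos_measure"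
  by (rule borel_measurable_pos_measureI) simp

lemma measurable_fst_pos [measurable]: "fst \<in> borel_measurable (pos_measure \<Otimes>\<^sub>M M)"
  using measurable_compose[OF measurable_fst measurable_ident_pos] .

lemma measurable_snd_pos [measurable]: "snd \<in> borel_measurable (M \<Otimes>\<^sub>M pos_measure)"
  using measurable_compose[OF measurable_snd measurable_ident_pos] .

text \<open>Fubini, with majorant \<open>s * exp (- r * s) * |g t|\<close> since
  \<open>bessel_series\<close> is bounded by \<open>1\<close>. At \<open>z = - r\<close> the right
  side is \<open>G (1 / z) / z^2\<close>.\<close>

lemma laplace_bessel_transform:
  assumes g: "integrable pos_measure g" and r: "0 < r"
  shows "integrable pos_measure (\<lambda>s. bessel_transform g s * of_real (exp (- r * s)))" (is ?A)
    and "(\<integral>s. bessel_transform g s * of_real (exp (- r * s)) \<partial>pos_measure)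
      = (\<integral>t. g t * of_real (exp (- t / r)) \<partial>pos_measure) / of_real (r\<^sup>2)" (is ?B)
proof -
  define f where "f = (\<lambda>(s, t). of_real (s * bessel_series (s * t)) * g t * of_real (exp (- r * s)))"
  have [measurable]: "g \<in> borel_measurable pos_measure" using g by simp
  have gs: "(\<lambda>x. g (snd x)) \<in> borel_measurable (pos_measure \<Otimes>\<^sub>M pos_measure)"
    by (rule measurable_compose[OF measurable_snd]) simp
  have int: "integrable (pos_measure \<Otimes>\<^sub>M pos_measure) f"
  proof (rule Bochner_Integration.integrable_bound)
    show "integrable (pos_measure \<Otimes>\<^sub>M pos_measure) (\<lambda>(s, t). (s ^ 1 * exp (- r * s)) * norm (g t))"
      by (intro pos_pair.integrable_mult_pair integrable_power_exp r integrable_norm g)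
    show "f \<in> borel_measurable (pos_measure \<Otimes>\<^sub>M pos_measure)"
      unfolding f_def split_beta' using gs by measurable
    show "AE x in pos_measure \<Otimes>\<^sub>M pos_measure. norm (f x)
      \<le> norm (case x of (s, t) \<Rightarrow> (s ^ 1 * exp (- r * s)) * norm (g t))"
    proof (rule AE_I2)
      fix x assume "x \<in> space (pos_measure \<Otimes>\<^sub>M pos_measure)"
      then obtain s t where x: "x = (s, t)" and st: "0 < s" "0 < t"
        by (auto simp: space_pair_measure)
      then have "s * exp (- (r * s)) * norm (g t) * \<bar>bessel_series (s * t)\<bar> \<le> s * exp (- (r * s)) * norm (g t) * 1"
        by (intro mult_left_mono abs_bessel_series_le) auto
      then show "norm (f x) \<le> norm (case x of (s, t) \<Rightarrow> (s ^ 1 * exp (- r * s)) * norm (g t))"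
        using st by (simp add: x f_def norm_mult mult_ac)
    qed
  qed
  have fs: "(\<integral>t. f (s, t) \<partial>pos_measure) = bessel_transform g s * of_real (exp (- r * s))" for s
    unfolding f_def bessel_transform_def by simp
  show ?A using pos_pair.integrable_fst'[OF int] unfolding fs .
  have ft: "(\<integral>s. f (s, t) \<partial>pos_measure) = g t * of_real (exp (- t / r)) / of_real (r\<^sup>2)" for t
  proof -
    have "(\<integral>s. f (s, t) \<partial>pos_measure)
      = (\<integral>s. g t * (of_real (s * bessel_series (s * t)) * of_real (exp (- r * s))) \<partial>pos_measure)"
      by (simp add: f_def mult_ac)
    also have "\<dots> = g t * of_real (exp (- t / r) / r\<^sup>2)"
      unfolding integral_mult_right_zero laplace_bessel_kernel(2)[OF r] ..
    finally show ?thesis by simp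
  qed
  have "(\<integral>s. (\<integral>t. f (s, t) \<partial>pos_measure) \<partial>pos_measure) = (\<integral>t. (\<integral>s. f (s, t) \<partial>pos_measure) \<partial>pos_measure)"
    using pos_pair.Fubini_integral[of "\<lambda>x y. f (x, y)"] int by simp
  then show ?B unfolding fs ft by simp
qed

text \<open>The constant depends on \<open>g\<close> only through its integral norm. This uniformity
  yields compactness of the operator, continuity of its range, and, with \<open>s' = 0\<close>,
  linear growth of the transform.\<close>

lemma norm_bessel_transform_diff_le:
  assumes g: "integrable pos_measure g" and s: "0 \<le> s" "0 \<le> s'"
  shows "norm (bessel_transform g s - bessel_transform g s') \<le> \<bar>s - s'\<bar> * (\<integral>t. norm (g t) \<partial>pos_measure)"
proof -
  have [measurable]: "g \<in> borel_measurable pos_measure" using g by simp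
  have i: "integrable pos_measure (\<lambda>t. of_real (s * bessel_series (s * t)) * g t)" if "0 \<le> s" for s
  proof (rule Bochner_Integration.integrable_bound)
    show "integrable pos_measure (\<lambda>t. s * norm (g t))"
      by (intro integrable_mult_right integrable_norm g)
    show "(\<lambda>t. of_real (s * bessel_series (s * t)) * g t) \<in> borel_measurable pos_measure" by measurable
    show "AE t in pos_measure. norm (of_real (s * bessel_series (s * t)) * g t) \<le> norm (s * norm (g t))"
    proof (rule AE_I2)
      fix t assume "t \<in> space pos_measure"
      then have "s * norm (g t) * \<bar>bessel_series (s * t)\<bar> \<le> s * norm (g t) * 1"
        using that by (intro mult_left_mono abs_bessel_series_le) auto
      then show "norm (of_real (s * bessel_series (s * t)) * g t) \<le> norm (s * norm (g t))"
        using that by (simp add: norm_mult mult_ac)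
    qed
  qed
  have "bessel_transform g s - bessel_transform g s'
    = (\<integral>t. of_real (s * bessel_series (s * t)) * g t - of_real (s' * bessel_series (s' * t)) * g t \<partial>pos_measure)"
    unfolding bessel_transform_def by (rule Bochner_Integration.integral_diff[symmetric]) (intro i s)+
  also have "norm \<dots> \<le> (\<integral>t. \<bar>s - s'\<bar> * norm (g t) \<partial>pos_measure)"
  proof (rule order_trans[OF integral_norm_bound integral_mono])
    show "integrable pos_measure (\<lambda>t. norm (of_real (s * bessel_series (s * t)) * g t - of_real (s' * bessel_series (s' * t)) * g t))"
      by (intro integrable_norm Bochner_Integration.integrable_diff i s)
    show "integrable pos_measure (\<lambda>t. \<bar>s - s'\<bar> * norm (g t))"
      by (intro integrable_mult_right integrable_norm g)
    fix t assume "t \<in> space pos_measure"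
    then have t: "0 < t" by simp
    \<comment> \<open>The Lipschitz bound is used at \<open>s * t\<close> and \<open>s' * t\<close>,
      so that both sides carry a factor \<open>t\<close> which then cancels.\<close>
    have "\<bar>s * t * bessel_series (s * t) - s' * t * bessel_series (s' * t)\<bar> \<le> \<bar>s * t - s' * t\<bar>"
      using s t by (intro mult_bessel_series_lipschitz) auto
    then have "\<bar>t * (s * bessel_series (s * t) - s' * bessel_series (s' * t))\<bar> \<le> \<bar>t * (s - s')\<bar>"
      by (simp add: algebra_simps)
    then have "\<bar>s * bessel_series (s * t) - s' * bessel_series (s' * t)\<bar> \<le> \<bar>s - s'\<bar>"
      using t by (simp add: abs_mult)
    then have "\<bar>s * bessel_series (s * t) - s' * bessel_series (s' * t)\<bar> * norm (g t) \<le> \<bar>s - s'\<bar> * norm (g t)"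
      by (rule mult_right_mono) simp
    moreover have "norm (of_real (s * bessel_series (s * t)) * g t - of_real (s' * bessel_series (s' * t)) * g t)
      = \<bar>s * bessel_series (s * t) - s' * bessel_series (s' * t)\<bar> * norm (g t)"
      by (simp only: left_diff_distrib[symmetric] of_real_diff[symmetric] norm_mult norm_of_real)
    ultimately show "norm (of_real (s * bessel_series (s * t)) * g t - of_real (s' * bessel_series (s' * t)) * g t)
      \<le> \<bar>s - s'\<bar> * norm (g t)" by simp
  qed
  finally show ?thesis by simp
qed

lemma norm_bessel_transform_le:
  assumes "integrable pos_measure g" "0 \<le> s"
  shows "norm (bessel_transform g s) \<le> s * (\<integral>t. norm (g t) \<partial>pos_measure)"
  using norm_bessel_transform_diff_le[OF assms(1) assms(2), of 0] assms(2)
  by (simp add: bessel_transform_def)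

section \<open>Holomorphy and uniqueness of Laplace transforms\<close>

lemma norm_exp_minus_1_le: "norm (exp u - 1 :: complex) \<le> norm u * exp (norm u)"
proof -
  have "norm (exp u - exp 0) \<le> exp (norm u) * norm (u - 0)"
  proof (rule field_differentiable_bound[where S = "cball 0 (norm u)" and f' = exp])
    show "norm (exp z) \<le> exp (norm u)" if "z \<in> cball 0 (norm u)" for z :: complex
      using norm_exp[of z] that by (simp add: order_trans)
  qed (auto intro!: derivative_eq_intros)
  then show ?thesis by (simp add: mult.commute)
qed

definition laplace :: "(real \<Rightarrow> complex) \<Rightarrow> complex \<Rightarrow> complex" where
  "laplace g z = (\<integral>t. g t * exp (of_real t * z) \<partial>pos_measure)"

lemma laplace_of_real: "laplace g (of_real x) = (\<integral>t. g t * of_real (exp (t * x)) \<partial>pos_measure)"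
  by (simp add: laplace_def exp_of_real[symmetric])

lemma holomorphic_laplace:
  assumes g: "\<And>z. Re z < c \<Longrightarrow> integrable pos_measure (\<lambda>t. g t * exp (of_real t * z))"
  shows "laplace g holomorphic_on {z. Re z < c}"
  unfolding holomorphic_on_def field_differentiable_def
proof (intro ballI exI)
  fix z assume "z \<in> {z. Re z < c}"
  then have z: "Re z < c" by simp
  \<comment> \<open>A quarter of the distance to the boundary leaves room for the majorant at
    \<open>z + 2 * d\<close>: one \<open>d\<close> absorbs the factor \<open>t\<close> through
    \<open>t <= exp (t * d) / d\<close>, the other absorbs \<open>exp (t * norm h)\<close>.\<close>
  define d where "d = (c - Re z) / 4"
  have d: "0 < d" "Re z + 2 * d < c" using z by (auto simp: d_def field_simps)
  have cd: "Re y < c" if "y \<in> ball z d" for y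
    using complex_Re_le_cmod[of "y - z"] that d by (simp add: dist_norm norm_minus_commute)
  define D where "D = (\<integral>t. g t * exp (of_real t * z) * of_real t \<partial>pos_measure)"
  have m: "(\<lambda>t. g t * exp (of_real t * y)) \<in> borel_measurable pos_measure" if "Re y < c" for y
    using g[OF that] by simp
  have "(laplace g has_field_derivative D) (at z within ball z d)"
    unfolding has_field_derivative_iff tendsto_at_iff_sequentially
  proof (intro allI impI)
    fix X assume X: "\<forall>i. X i \<in> ball z d - {z}" and lim: "X \<longlonglongrightarrow> z"
    have "(\<lambda>i. \<integral>t. (g t * exp (of_real t * X i) - g t * exp (of_real t * z)) / (X i - z) \<partial>pos_measure)
        \<longlonglongrightarrow> D"
      unfolding D_def
    proof (rule integral_dominated_convergence
        [where w = "\<lambda>t. norm (g t * exp (of_real t * (z + of_real (2 * d)))) * (1 / d)"])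
      show "(\<lambda>t. g t * exp (of_real t * z) * of_real t) \<in> borel_measurable pos_measure"
        using m[OF z] by measurable
      show "(\<lambda>t. (g t * exp (of_real t * X i) - g t * exp (of_real t * z)) / (X i - z))
          \<in> borel_measurable pos_measure" for i
        using m[OF z] m[OF cd, of "X i"] X by (intro borel_measurable_divide borel_measurable_diff) auto
      show "integrable pos_measure (\<lambda>t. norm (g t * exp (of_real t * (z + of_real (2 * d)))) * (1 / d))"
        by (intro integrable_mult_left integrable_norm g) (use d in simp)
      show "AE t in pos_measure. (\<lambda>i. (g t * exp (of_real t * X i) - g t * exp (of_real t * z)) / (X i - z))
          \<longlonglongrightarrow> g t * exp (of_real t * z) * of_real t"
      proof (rule AE_I2)
        fix t
        have "((\<lambda>y. g t * exp (of_real t * y)) has_field_derivative g t * exp (of_real t * z) * of_real t) (at z)"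
          by (auto intro!: derivative_eq_intros)
        then have "((\<lambda>y. (g t * exp (of_real t * y) - g t * exp (of_real t * z)) / (y - z))
            \<longlongrightarrow> g t * exp (of_real t * z) * of_real t) (at z)"
          by (simp add: has_field_derivative_iff)
        moreover have "filterlim X (at z) sequentially"
          using lim X by (auto simp: filterlim_at)
        ultimately show "(\<lambda>i. (g t * exp (of_real t * X i) - g t * exp (of_real t * z)) / (X i - z))
            \<longlonglongrightarrow> g t * exp (of_real t * z) * of_real t"
          by (rule filterlim_compose)
      qed
      show "AE t in pos_measure. norm ((g t * exp (of_real t * X i) - g t * exp (of_real t * z)) / (X i - z))
          \<le> norm (g t * exp (of_real t * (z + of_real (2 * d)))) * (1 / d)" for i
      proof (rule AE_I2)
        fix t assume "t \<in> space pos_measure"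
        then have t: "0 < t" by simp
        define h where "h = X i - z"
        have h: "h \<noteq> 0" "norm h \<le> d" using X[rule_format, of i] by (auto simp: h_def dist_norm norm_minus_commute)
        have "norm (exp (of_real t * h) - 1) \<le> norm (of_real t * h) * exp (norm (of_real t * h))"
          by (rule norm_exp_minus_1_le)
        also have "\<dots> = norm h * (t * exp (t * norm h))" using t by (simp add: norm_mult)
        also have "\<dots> \<le> norm h * (exp (t * d) / d * exp (t * d))"
        proof (intro mult_left_mono mult_mono)
          have "t * d \<le> exp (t * d)" using exp_ge_add_one_self[of "t * d"] by linarith
          then show "t \<le> exp (t * d) / d" using d by (simp add: field_simps)
        qed (use t h d in auto)
        finally have "norm (exp (of_real t * h) - 1) / norm h \<le> exp (t * (2 * d)) * (1 / d)"
          using h by (simp add: field_simps flip: exp_add)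
        then have "norm (g t * exp (of_real t * z)) * (norm (exp (of_real t * h) - 1) / norm h)
            \<le> norm (g t * exp (of_real t * z)) * (exp (t * (2 * d)) * (1 / d))"
          by (rule mult_left_mono) simp
        moreover have "(g t * exp (of_real t * X i) - g t * exp (of_real t * z)) / (X i - z)
            = g t * exp (of_real t * z) * ((exp (of_real t * h) - 1) / h)"
          by (simp add: h_def algebra_simps flip: exp_add)
        ultimately show "norm ((g t * exp (of_real t * X i) - g t * exp (of_real t * z)) / (X i - z))
          \<le> norm (g t * exp (of_real t * (z + of_real (2 * d)))) * (1 / d)"
          by (simp add: norm_mult norm_divide distrib_left exp_add)
      qed
    qed
    moreover have "(laplace g (X i) - laplace g z) / (X i - z)
        = (\<integral>t. (g t * exp (of_real t * X i) - g t * exp (of_real t * z)) / (X i - z) \<partial>pos_measure)" for i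
      using g[OF cd, of "X i"] g[OF z] X by (simp add: laplace_def)
    ultimately show "((\<lambda>y. (laplace g y - laplace g z) / (y - z)) \<circ> X) \<longlonglongrightarrow> D"
      unfolding o_def by (simp only:)
  qed
  then have "(laplace g has_field_derivative D) (at z)"
    using d by (simp add: at_within_open[of z "ball z d"])
  then show "(laplace g has_field_derivative D) (at z within {z. Re z < c})"
    by (rule has_field_derivative_at_within)
qed

text \<open>The positive and the negative part of \<open>h\<close> have the same Fourier transform,
  hence the same mass. After normalization they are probability densities with equal characteristic
  functions, and Levy's uniqueness theorem identifies them.\<close>

lemma integral_vanishing_char_imp_AE_0:
  fixes h :: "real \<Rightarrow> real"
  assumes h: "integrable pos_measure h"
    and char: "\<And>y. (\<integral>t. of_real (h t) * iexp (y * t) \<partial>pos_measure) = 0"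
  shows "AE t in pos_measure. h t = 0"
proof -
  define H where "H = (\<lambda>t. indicator {0<..} t *\<^sub>R h t)"
  have H: "integrable lebesgue H"
    using h unfolding H_def by (subst (asm) integrable_restrict_space) auto
  \<comment> \<open>Since \<open>h\<close> is only Lebesgue measurable and characteristic functions
    belong to Borel measures, \<open>h\<close> is replaced by an almost everywhere equal Borel
    function.\<close>
  obtain K where K: "K \<in> borel_measurable lborel" and HK: "AE t in lborel. H t = K t"
    using completion_ex_borel_measurable_real[OF borel_measurable_integrable[OF H]] by blast
  have [measurable]: "K \<in> borel_measurable borel" using K by simp
  have HK': "AE t in lebesgue. H t = K t" by (rule AE_completion[OF HK])
  have "integrable lebesgue K"
    using H HK' K by (subst integrable_cong_AE[of _ _ H]) (auto intro: measurable_completion)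
  then have Kint: "integrable lborel K" by (simp add: integrable_completion)
  have ie: "(\<lambda>t. iexp (y * t)) \<in> borel_measurable lborel" for y
    by (auto intro!: borel_measurable_continuous_onI continuous_intros)
  have "complex_of_real \<in> borel_measurable borel"
    by (auto intro!: borel_measurable_continuous_onI continuous_intros)
  from measurable_compose[OF K this] have Kie: "(\<lambda>t. complex_of_real (K t) * iexp (y * t)) \<in> borel_measurable lborel" for y
    by (intro borel_measurable_times ie)
  have Kchar: "(\<integral>t. of_real (K t) * iexp (y * t) \<partial>lborel) = 0" for y
  proof -
    have "(\<integral>t. of_real (K t) * iexp (y * t) \<partial>lborel) = (\<integral>t. of_real (K t) * iexp (y * t) \<partial>lebesgue)"
      by (rule integral_completion[symmetric, OF Kie])
    also have "\<dots> = (\<integral>t. of_real (H t) * iexp (y * t) \<partial>lebesgue)"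
    proof (rule integral_cong_AE)
      show "(\<lambda>t. of_real (K t) * iexp (y * t)) \<in> borel_measurable lebesgue"
        by (rule measurable_completion[OF Kie])
      have "(\<lambda>t. iexp (y * t)) \<in> borel_measurable lebesgue"
        by (rule measurable_completion[OF ie])
      then show "(\<lambda>t. of_real (H t) * iexp (y * t)) \<in> borel_measurable lebesgue"
        using borel_measurable_integrable[OF H] by measurable
    qed (use HK' in auto)
    also have "\<dots> = (\<integral>t. of_real (h t) * iexp (y * t) \<partial>pos_measure)"
      by (subst integral_restrict_space) (auto intro!: Bochner_Integration.integral_cong simp: H_def indicator_def)
    finally show ?thesis using char by simp
  qed
  define p n where "p t = max 0 (K t)" and "n t = max 0 (- K t)" for t
  have [measurable]: "p \<in> borel_measurable borel" "n \<in> borel_measurable borel"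
    unfolding p_def n_def by measurable
  have pint: "integrable lborel p" and nint: "integrable lborel n"
    unfolding p_def n_def by (auto intro!: integrable_max Kint)
  have iexp_int: "integrable lborel (\<lambda>t. of_real (f t) * iexp (y * t))"
    if f: "integrable lborel f" for f :: "real \<Rightarrow> real" and y
    by (rule Bochner_Integration.integrable_bound[OF f])
      (use borel_measurable_integrable[OF f] in \<open>auto simp: norm_mult\<close>)
  have Kpn: "K t = p t - n t" for t by (simp add: p_def n_def max_def)
  have pn: "(\<integral>t. of_real (p t) * iexp (y * t) \<partial>lborel) = (\<integral>t. of_real (n t) * iexp (y * t) \<partial>lborel)" for y
    using Kchar[of y] iexp_int[OF pint] iexp_int[OF nint] by (simp add: Kpn left_diff_distrib)
  \<comment> \<open>The common mass of both parts, read off from \<open>pn\<close> at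
    \<open>y = 0\<close>. If it is \<open>0\<close>, both parts vanish and no normalization is
    possible, so that case is separate.\<close>
  define m where "m = integral\<^sup>L lborel p"
  have m_n: "integral\<^sup>L lborel n = m" using pn[of 0] by (simp add: m_def)
  have p0: "0 \<le> p t" and n0: "0 \<le> n t" for t by (simp_all add: p_def n_def)
  have "AE t in lborel. K t = 0"
  proof (cases "m = 0")
    case True
    then have "AE t in lborel. p t = 0" "AE t in lborel. n t = 0"
      using integral_nonneg_eq_0_iff_AE[OF pint] integral_nonneg_eq_0_iff_AE[OF nint] p0 n0 m_n
      by (auto simp: m_def)
    then show ?thesis by eventually_elim (simp add: Kpn)
  next
    case False
    moreover have "0 \<le> m" unfolding m_def by (intro integral_nonneg_AE) (simp add: p0)
    ultimately have m: "0 < m" by simp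
    have distr: "real_distribution (density lborel (\<lambda>t. ennreal (f t / m)))"
      if f: "integrable lborel f" "\<And>t. 0 \<le> f t" "integral\<^sup>L lborel f = m" for f
    proof -
      have [measurable]: "f \<in> borel_measurable borel" using f(1) by simp
      have "(\<integral>\<^sup>+t. ennreal (f t / m) \<partial>lborel) = ennreal (\<integral>t. f t / m \<partial>lborel)"
        by (rule nn_integral_eq_integral) (use f m in auto)
      also have "\<dots> = 1" using f m by simp
      finally have "prob_space (density lborel (\<lambda>t. ennreal (f t / m)))"
        by (intro prob_spaceI) (simp add: emeasure_density)
      then show ?thesis
        by (simp add: real_distribution_def real_distribution_axioms_def)
    qed
    have chr: "char (density lborel (\<lambda>t. ennreal (f t / m))) y
        = (\<integral>t. of_real (f t) * iexp (y * t) \<partial>lborel) / of_real m"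
      if f: "integrable lborel f" "\<And>t. 0 \<le> f t" for f y
    proof -
      have [measurable]: "f \<in> borel_measurable borel" using f(1) by simp
      have "char (density lborel (\<lambda>t. ennreal (f t / m))) y = (\<integral>t. (f t / m) *\<^sub>R iexp (y * t) \<partial>lborel)"
        unfolding char_def by (rule integral_density) (use f m in auto)
      also have "\<dots> = (\<integral>t. (of_real (f t) * iexp (y * t)) / of_real m \<partial>lborel)"
        by (simp add: scaleR_conv_of_real)
      finally show ?thesis by simp
    qed
    have "density lborel (\<lambda>t. ennreal (p t / m)) = density lborel (\<lambda>t. ennreal (n t / m))"
    proof (rule Levy_uniqueness)
      show "char (density lborel (\<lambda>t. ennreal (p t / m))) = char (density lborel (\<lambda>t. ennreal (n t / m)))"
        by (rule ext) (simp only: chr[OF pint p0] chr[OF nint n0] pn)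
    qed (auto intro!: distr pint nint p0 n0 m_n simp: m_def[symmetric])
    then have "AE t in lborel. ennreal (p t / m) = ennreal (n t / m)"
      by (subst (asm) sigma_finite_measure.density_unique_iff[OF sigma_finite_lborel]) auto
    then show ?thesis
      by eventually_elim (use m p0 n0 in \<open>simp add: Kpn\<close>)
  qed
  with HK have "AE t in lborel. H t = 0" by eventually_elim simp
  then have "AE t in lebesgue. H t = 0" by (rule AE_completion)
  then show ?thesis
    by (subst AE_restrict_space_iff) (auto simp: H_def elim!: eventually_mono)
qed

text \<open>The transform is holomorphic on \<open>Re z < - c\<close> and vanishes on a real ray,
  hence on the whole half-plane. On a vertical line it is the Fourier transform of an integrable
  function, so the Fourier uniqueness applies to real and imaginary parts.\<close>

lemma laplace_unique:
  fixes h :: "real \<Rightarrow> complex"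
  assumes int: "\<And>x. c < x \<Longrightarrow> integrable pos_measure (\<lambda>t. h t * of_real (exp (- x * t)))"
    and zero: "\<And>x. c < x \<Longrightarrow> (\<integral>t. h t * of_real (exp (- x * t)) \<partial>pos_measure) = 0"
  shows "AE t in pos_measure. h t = 0"
proof -
  have int': "integrable pos_measure (\<lambda>t. h t * exp (of_real t * z))" if z: "Re z < - c" for z
  proof (rule Bochner_Integration.integrable_bound)
    have i: "integrable pos_measure (\<lambda>t. h t * of_real (exp (- (- Re z) * t)))"
      using z by (intro int) simp
    then show "integrable pos_measure (\<lambda>t. norm (h t * of_real (exp (- (- Re z) * t))))"
      by (rule integrable_norm)
    have "(\<lambda>t. h t * of_real (exp (- (- Re z) * t)) * exp (of_real t * (\<i> * of_real (Im z)))) \<in> borel_measurable pos_measure"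
      by (intro borel_measurable_times borel_measurable_integrable[OF i] borel_measurable_pos_measureI) measurable
    moreover have "h t * of_real (exp (- (- Re z) * t)) * exp (of_real t * (\<i> * of_real (Im z))) = h t * exp (of_real t * z)" for t
    proof -
      have "of_real t * z = of_real (Re z * t) + of_real t * (\<i> * of_real (Im z))"
        by (simp add: complex_eq_iff)
      then show ?thesis by (simp add: exp_add exp_of_real[symmetric] mult.assoc)
    qed
    ultimately show "(\<lambda>t. h t * exp (of_real t * z)) \<in> borel_measurable pos_measure" by (simp only:)
  qed (auto simp: norm_mult mult.commute)
  have hol: "laplace h holomorphic_on {z. Re z < - c}"
    by (rule holomorphic_laplace[OF int'])
  have L0: "laplace h z = 0" if z: "Re z < - c" for z
  proof (rule analytic_continuation[OF hol])
    show "open {z. Re z < - c}" by (rule open_halfspace_Re_lt)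
    show "connected {z. Re z < - c}" by (intro convex_connected convex_halfspace_Re_lt)
    show "of_real ` {..< - c} \<subseteq> {z. Re z < - c}" by auto
    show "of_real (- c - 1) \<in> {z. Re z < - c}" by simp
    show "(of_real (- c - 1) :: complex) islimpt of_real ` {..< - c}"
    proof -
      have "(- c - 1) islimpt {..< - c}" by (rule interior_limit_point) (simp add: interior_open)
      then show ?thesis
        unfolding islimpt_approachable by (metis (no_types, lifting) dist_of_real image_eqI of_real_eq_iff)
    qed
    show "laplace h w = 0" if "w \<in> of_real ` {..< - c}" for w
      using that zero by (auto simp: laplace_of_real zero[of "- x" for x, simplified] mult.commute)
  qed (use z in simp)
  \<comment> \<open>The abscissa of a vertical line inside the half-plane; the damping by
    \<open>exp (x0 * t)\<close> makes \<open>k\<close> integrable, which \<open>h\<close> need not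
    be.\<close>
  define x0 where "x0 = - (c + 1)"
  define k where "k t = h t * of_real (exp (x0 * t))" for t
  have k: "integrable pos_measure k"
    using int[of "c + 1"] unfolding k_def x0_def by simp
  have kL: "k t * iexp (y * t) = h t * exp (of_real t * Complex x0 y)" for t y
  proof -
    have "of_real t * Complex x0 y = of_real (x0 * t) + \<i> * of_real (y * t)"
      by (simp add: complex_eq_iff)
    then show ?thesis by (simp add: k_def exp_add exp_of_real[symmetric] mult.assoc)
  qed
  have kz: "(\<integral>t. k t * iexp (y * t) \<partial>pos_measure) = 0" for y
    using L0[of "Complex x0 y"] unfolding kL laplace_def by (simp add: x0_def)
  have re0: "AE t in pos_measure. Re (f t) = 0"
    if f: "integrable pos_measure f" and fz: "\<And>y. (\<integral>t. f t * iexp (y * t) \<partial>pos_measure) = 0" for f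
  proof (rule integral_vanishing_char_imp_AE_0)
    show "integrable pos_measure (\<lambda>t. Re (f t))" by (rule integrable_Re[OF f])
    fix y
    have fi: "integrable pos_measure (\<lambda>t. f t * iexp (y * t))" for y
    proof (rule Bochner_Integration.integrable_bound[OF f])
      have "(\<lambda>t. iexp (y * t)) \<in> borel_measurable borel"
        by (auto intro!: borel_measurable_continuous_onI continuous_intros)
      then show "(\<lambda>t. f t * iexp (y * t)) \<in> borel_measurable pos_measure"
        by (intro borel_measurable_times borel_measurable_integrable[OF f] borel_measurable_pos_measureI)
    qed (simp add: norm_mult)
    \<comment> \<open>The Fourier integral of \<open>Re f\<close> at \<open>y\<close> is the mean of
      that of \<open>f\<close> at \<open>y\<close> and the conjugate of that at \<open>- y\<close>,
      and both are zero.\<close>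
    have eq: "of_real (Re (f t)) * iexp (y * t) = (f t * iexp (y * t) + cnj (f t * iexp (- y * t))) / 2" for t
    proof -
      have "complex_of_real (Re (f t)) = (f t + cnj (f t)) / 2" by (simp add: complex_add_cnj)
      moreover have "cnj (iexp (- y * t)) = iexp (y * t)" by (simp add: exp_cnj)
      ultimately show ?thesis unfolding complex_cnj_mult by (simp only: distrib_right times_divide_eq_left)
    qed
    have "(\<integral>t. of_real (Re (f t)) * iexp (y * t) \<partial>pos_measure)
        = (\<integral>t. (f t * iexp (y * t) + cnj (f t * iexp (- y * t))) / 2 \<partial>pos_measure)"
      by (simp only: eq)
    also have "\<dots> = ((\<integral>t. f t * iexp (y * t) \<partial>pos_measure) + (\<integral>t. cnj (f t * iexp (- y * t)) \<partial>pos_measure)) / 2"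
      unfolding integral_divide_zero
      by (subst Bochner_Integration.integral_add[OF fi integrable_cnj[OF fi]]) (rule refl)
    also have "(\<integral>t. cnj (f t * iexp (- y * t)) \<partial>pos_measure) = cnj (\<integral>t. f t * iexp (- y * t) \<partial>pos_measure)"
      by (rule Bochner_Integration.integral_cnj)
    also have "((\<integral>t. f t * iexp (y * t) \<partial>pos_measure) + cnj (\<integral>t. f t * iexp (- y * t) \<partial>pos_measure)) / 2 = 0"
      unfolding fz by simp
    finally show "(\<integral>t. of_real (Re (f t)) * iexp (y * t) \<partial>pos_measure) = 0" .
  qed
  have ki: "integrable pos_measure (\<lambda>t. - \<i> * k t)" by (rule integrable_mult_right[OF k])
  have "AE t in pos_measure. Re (k t) = 0" by (rule re0[OF k kz])
  moreover have "AE t in pos_measure. Re (- \<i> * k t) = 0"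
    by (rule re0[OF ki]) (use kz in \<open>simp add: mult.assoc\<close>)
  ultimately show ?thesis
    by eventually_elim (auto simp: k_def complex_eq_iff)
qed

section \<open>From eigenfunctions to solutions of the three-term equation\<close>

abbreviation weighted :: "(real \<Rightarrow> complex) \<Rightarrow> real \<Rightarrow> complex" where
  "weighted A t \<equiv> of_real (sqrt t / psi t) * A t"

lemma psi_square:
  assumes "0 \<le> s"
  shows "(psi s)\<^sup>2 = 2 * exp s - 1" "exp s \<le> (psi s)\<^sup>2" "0 < psi s"
proof -
  have "1 \<le> exp s" using assms by simp
  then have p: "0 < 2 * exp s - 1" by linarith
  then show "(psi s)\<^sup>2 = 2 * exp s - 1" by (simp add: psi_def)
  with \<open>1 \<le> exp s\<close> show "exp s \<le> (psi s)\<^sup>2" by simp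
  show "0 < psi s" using p by (simp add: psi_def)
qed

lemma borel_measurable_psi [measurable]: "psi \<in> borel_measurable borel"
  unfolding psi_def by measurable

lemma div_psi_square_le:
  assumes "0 \<le> t" "0 \<le> c"
  shows "c / (psi t)\<^sup>2 \<le> c * exp (- t)"
proof -
  have "c / (psi t)\<^sup>2 \<le> c / exp t"
    using psi_square(2,3)[OF assms(1)] assms(2)
    by (intro divide_left_mono mult_pos_pos zero_less_power) auto
  then show ?thesis by (simp add: exp_minus divide_inverse)
qed

lemma integrable_div_psi_square: "integrable pos_measure (\<lambda>t. t ^ n / (psi t)\<^sup>2)"
proof (rule Bochner_Integration.integrable_bound)
  show "integrable pos_measure (\<lambda>t. t ^ n * exp (- 1 * t))" by (rule integrable_power_exp) simp
  show "(\<lambda>t. t ^ n / (psi t)\<^sup>2) \<in> borel_measurable pos_measure"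
    by (rule borel_measurable_pos_measureI) measurable
  show "AE t in pos_measure. norm (t ^ n / (psi t)\<^sup>2) \<le> norm (t ^ n * exp (- 1 * t))"
    using div_psi_square_le by (auto intro!: AE_I2)
qed

lemma square_weight: "0 < t \<Longrightarrow> (sqrt t / psi t)\<^sup>2 = t / (psi t)\<^sup>2"
  by (simp add: power_divide)

lemma integrable_weighted:
  assumes "L2_pos A"
  shows "integrable pos_measure (weighted A)"
proof (rule Bochner_Integration.integrable_bound)
  show "integrable pos_measure (\<lambda>t. t ^ 1 / (psi t)\<^sup>2 + (cmod (A t))\<^sup>2)"
    using assms by (intro Bochner_Integration.integrable_add integrable_div_psi_square) (simp add: L2_pos_def)
  have "(\<lambda>t. complex_of_real (sqrt t / psi t)) \<in> borel_measurable pos_measure"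
    by (rule borel_measurable_pos_measureI) measurable
  then show "weighted A \<in> borel_measurable pos_measure"
    using assms by (intro borel_measurable_times) (auto simp: L2_pos_def)
  show "AE t in pos_measure. norm (weighted A t) \<le> norm (t ^ 1 / (psi t)\<^sup>2 + (cmod (A t))\<^sup>2)"
  proof (rule AE_I2)
    fix t assume "t \<in> space pos_measure"
    then have t: "0 < t" by simp
    define a b where "a = sqrt t / psi t" and "b = cmod (A t)"
    have a: "0 \<le> a" "a\<^sup>2 = t / (psi t)\<^sup>2" and b: "0 \<le> b"
      using t psi_square(3)[of t] by (simp_all add: a_def b_def square_weight)
    have "2 * (a * b) \<le> a\<^sup>2 + b\<^sup>2" using zero_le_power2[of "a - b"] by (simp add: power2_diff)
    then have "a * b \<le> a\<^sup>2 + b\<^sup>2" using mult_nonneg_nonneg[OF a(1) b] by linarith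
    moreover have "norm (weighted A t) = a * b"
      using a(1) unfolding a_def b_def by (simp only: norm_mult norm_of_real abs_of_nonneg)
    moreover have "t ^ 1 / (psi t)\<^sup>2 + (cmod (A t))\<^sup>2 = a\<^sup>2 + b\<^sup>2" by (simp add: a b_def)
    ultimately show "norm (weighted A t) \<le> norm (t ^ 1 / (psi t)\<^sup>2 + (cmod (A t))\<^sup>2)" by simp
  qed
qed

lemma op_K_eq_bessel_transform:
  assumes s: "0 < s"
  shows "op_K A s = bessel_transform (weighted A) s / of_real (sqrt s * psi s)"
proof -
  have "op_K A s = (\<integral>t. of_real (s * bessel_series (s * t)) * weighted A t / of_real (sqrt s * psi s) \<partial>pos_measure)"
    unfolding op_K_def
  proof (rule Bochner_Integration.integral_cong[OF refl])
    fix t assume "t \<in> space pos_measure"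
    then have t: "0 < t" by simp
    have "s * bessel_series (s * t) * (sqrt t / psi t) / (sqrt s * psi s)
        = s / sqrt s * sqrt t * bessel_series (s * t) / (psi s * psi t)"
      by (simp add: mult_ac)
    also have "\<dots> = kernel_K s t"
      using bessel_J_1_eq[of "s * t"] s t unfolding kernel_K_def real_div_sqrt[OF less_imp_le[OF s]]
      by (simp only: real_sqrt_mult mult_nonneg_nonneg less_imp_le)
    finally have "kernel_K s t = s * bessel_series (s * t) * (sqrt t / psi t) / (sqrt s * psi s)" ..
    then show "of_real (kernel_K s t) * A t
        = of_real (s * bessel_series (s * t)) * weighted A t / of_real (sqrt s * psi s)"
      by simp
  qed
  then show ?thesis by (simp only: bessel_transform_def integral_divide_zero)
qed

lemma weighted_eq_0_iff: "0 < t \<Longrightarrow> weighted A t = 0 \<longleftrightarrow> A t = 0"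
  using psi_square(3)[of t] by simp

lemma weighted_eigen_equation:
  assumes "AE s in pos_measure. op_K A s = lam * A s"
  shows "AE s in pos_measure. bessel_transform (weighted A) s = lam * of_real (2 * exp s - 1) * weighted A s"
  using assms AE_space
proof eventually_elim
  case (elim s)
  then have s: "0 < s" by simp
  then have p: "0 < sqrt s" "0 < psi s" "(psi s)\<^sup>2 = 2 * exp s - 1" using psi_square[of s] by auto
  have "bessel_transform (weighted A) s = of_real (sqrt s * psi s) * (lam * A s)"
    using elim op_K_eq_bessel_transform[OF s, of A] p(1,2) by (simp add: field_simps)
  also have "sqrt s * psi s = (psi s)\<^sup>2 * (sqrt s / psi s)"
    using p(1,2) by (simp add: power2_eq_square)
  finally show ?case unfolding p(3) of_real_mult by (simp only: mult_ac)
qed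

lemma integrable_mult_exp_neg:
  assumes "integrable pos_measure g" "0 \<le> x"
  shows "integrable pos_measure (\<lambda>t. g t * of_real (exp (- x * t)) :: complex)"
proof (rule Bochner_Integration.integrable_bound[OF assms(1)])
  show "(\<lambda>t. g t * of_real (exp (- x * t))) \<in> borel_measurable pos_measure"
    by (intro borel_measurable_times borel_measurable_integrable[OF assms(1)] borel_measurable_pos_measureI) measurable
  show "AE t in pos_measure. norm (g t * of_real (exp (- x * t))) \<le> norm (g t)"
    using assms(2) by (intro AE_I2) (simp add: norm_mult mult_left_le)
qed

text \<open>The Laplace transform of the Bessel transform at \<open>1 / x\<close> determines that of
  \<open>g\<close> at \<open>x\<close>, so uniqueness of Laplace transforms applies. This rules out
  the eigenvalue \<open>0\<close>.\<close>

lemma bessel_transform_inj: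
  assumes g: "integrable pos_measure g" and z: "AE s in pos_measure. bessel_transform g s = 0"
  shows "AE t in pos_measure. g t = 0"
proof (rule laplace_unique[where c = 0])
  fix x :: real assume x: "0 < x"
  show "integrable pos_measure (\<lambda>t. g t * of_real (exp (- x * t)))"
    using x by (intro integrable_mult_exp_neg g) simp
  have "(\<integral>s. bessel_transform g s * of_real (exp (- (1 / x) * s)) \<partial>pos_measure) = 0"
    by (rule integral_eq_zero_AE) (use z in auto)
  moreover have "(\<integral>s. bessel_transform g s * of_real (exp (- (1 / x) * s)) \<partial>pos_measure)
    = (\<integral>t. g t * of_real (exp (- t / (1 / x))) \<partial>pos_measure) / of_real ((1 / x)\<^sup>2)"
    by (rule laplace_bessel_transform(2)[OF g]) (use x in simp)
  ultimately have "(\<integral>t. g t * of_real (exp (- t / (1 / x))) \<partial>pos_measure) = 0" using x by simp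
  then show "(\<integral>t. g t * of_real (exp (- x * t)) \<partial>pos_measure) = 0" by (simp add: mult.commute)
qed

text \<open>The three-term equation is used as a recursion that leads back to the half-plane
  \<open>Re z < 1\<close>. On the translation branch \<open>Re\<close> drops by \<open>1\<close>; on the inversion branch
  either the half-plane is reached or \<open>1 / (Im z)\<^sup>2\<close> drops by at least \<open>1\<close>.\<close>

lemma inversion_Im_growth:
  assumes z: "Im z \<noteq> 0" and re: "1 \<le> Re (1 / z)"
  shows "1 / (Im (1 / z))\<^sup>2 \<le> 1 / (Im z)\<^sup>2 - 1"
proof -
  define x y N where "x = Re z" and "y = Im z" and "N = x\<^sup>2 + y\<^sup>2"
  have y: "0 < y\<^sup>2" using z by (simp add: y_def)
  then have N: "0 < N" by (simp add: N_def add_nonneg_pos)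
  have re_eq: "Re (1 / z) = x / N" and im_eq: "Im (1 / z) = - y / N"
    by (simp_all add: Re_divide Im_divide x_def y_def N_def)
  \<comment> \<open>The hypothesis says that \<open>z\<close> lies in the disc of radius
    \<open>1/2\<close> about \<open>1/2\<close>. Everything now aims at
    \<open>N^2 <= 1 - y^2\<close>, because \<open>1 / (Im (1 / z))^2 = N^2 / y^2\<close>.\<close>
  have Nx: "N \<le> x" using re N by (simp add: re_eq field_simps)
  have yx: "y\<^sup>2 \<le> x * (1 - x)" using Nx by (simp add: N_def power2_eq_square algebra_simps)
  have x: "0 < x" using Nx N by linarith
  have x1: "x < 1" using yx y x by (smt (verit) mult_pos_neg mult_nonneg_nonpos)
  have "x * (1 - x) \<le> 1 - x" using x x1 by (simp add: mult_left_le_one_le)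
  then have N1: "N \<le> 1 - y\<^sup>2" using Nx yx by linarith
  have q: "y\<^sup>2 \<le> 1 / 4"
    using yx zero_le_power2[of "x - 1 / 2"] by (simp add: power2_eq_square algebra_simps)
  have "N\<^sup>2 \<le> (1 - y\<^sup>2)\<^sup>2" using N1 N by (intro power_mono) auto
  also have "\<dots> = 1 - 2 * y\<^sup>2 + y\<^sup>2 * y\<^sup>2" by (simp add: power2_eq_square algebra_simps)
  also have "\<dots> \<le> 1 - 2 * y\<^sup>2 + y\<^sup>2 * 1" using q y by (intro add_left_mono mult_left_mono) auto
  finally have "N\<^sup>2 \<le> 1 - y\<^sup>2" by simp
  then have "N\<^sup>2 / y\<^sup>2 \<le> (1 - y\<^sup>2) / y\<^sup>2" using y by (intro divide_right_mono) auto
  also have "\<dots> = 1 / y\<^sup>2 - 1" using y by (simp add: diff_divide_distrib)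
  finally show ?thesis by (simp add: im_eq power_divide y_def[symmetric])
qed

text \<open>The three-term equation with \<open>z = w - 1\<close>, solved for the value at
  \<open>w\<close>. Real points \<open>w >= 1\<close> lie on the cut; stopping there confines the
  recursion to nonreal points, where \<open>1 / (Im w)^2\<close> can bound the number of
  inversions.\<close>

function continuation :: "(complex \<Rightarrow> complex) \<Rightarrow> complex \<Rightarrow> complex \<Rightarrow> complex" where
  "continuation F lam w = (if Re w < 1 \<or> Im w = 0 then F w
     else (continuation F lam (w - 1) + 1 / (lam * (w - 1)\<^sup>2) * continuation F lam (1 / (w - 1))) / 2)"
  by pat_completeness auto
termination
\<comment> \<open>Lexicographic order: \<open>Suc\<close> ranks the base half-plane strictly below
  every other point. Translation either reaches it or keeps the first component and lowers the floor
  of \<open>Re w\<close>; inversion lowers the first component in any case.\<close>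
proof (relation "measures [\<lambda>(F, lam, w). if Re w < 1 then 0 else Suc (nat \<lfloor>1 / (Im w)\<^sup>2\<rfloor>),
    \<lambda>(F, lam, w). nat \<lfloor>Re w\<rfloor>]")
  fix F :: "complex \<Rightarrow> complex" and lam w :: complex
  assume w: "\<not> (Re w < 1 \<or> Im w = 0)"
  have "nat \<lfloor>Re w - 1\<rfloor> < nat \<lfloor>Re w\<rfloor>" using w by (simp add: le_floor_iff nat_less_iff)
  then show "((F, lam, w - 1), F, lam, w) \<in> measures
      [\<lambda>(F, lam, w). if Re w < 1 then 0 else Suc (nat \<lfloor>1 / (Im w)\<^sup>2\<rfloor>), \<lambda>(F, lam, w). nat \<lfloor>Re w\<rfloor>]"
    using w by auto
  have "nat \<lfloor>1 / (Im (1 / (w - 1)))\<^sup>2\<rfloor> < nat \<lfloor>1 / (Im w)\<^sup>2\<rfloor>" if "1 \<le> Re (1 / (w - 1))"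
  proof -
    define a where "a = 1 / (Im (1 / (w - 1)))\<^sup>2"
    have "a \<le> 1 / (Im w)\<^sup>2 - 1"
      unfolding a_def using inversion_Im_growth[of "w - 1"] w that by simp
    moreover have "0 \<le> a" by (simp add: a_def)
    ultimately have "\<lfloor>a\<rfloor> < \<lfloor>1 / (Im w)\<^sup>2\<rfloor>" "0 \<le> \<lfloor>a\<rfloor>" by linarith+
    then show ?thesis unfolding a_def[symmetric] by (simp only: nat_less_eq_zless)
  qed
  then show "((F, lam, 1 / (w - 1)), F, lam, w) \<in> measures
      [\<lambda>(F, lam, w). if Re w < 1 then 0 else Suc (nat \<lfloor>1 / (Im w)\<^sup>2\<rfloor>), \<lambda>(F, lam, w). nat \<lfloor>Re w\<rfloor>]"
    using w by auto
qed simp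

declare continuation.simps [simp del]

lemma continuation_base: "Re w < 1 \<Longrightarrow> continuation F lam w = F w"
  by (simp add: continuation.simps)

lemma Re_inverse_neg: "Re z < 0 \<Longrightarrow> Re (1 / z) < 0"
  by (simp add: Re_divide divide_neg_pos sum_power2_gt_zero_iff)

text \<open>For \<open>Re z < 0\<close> all three arguments lie in the base half-plane, where the
  equation holds for \<open>F\<close>. Otherwise \<open>z + 1\<close> has real part at least
  \<open>1\<close> and the recursion itself is the equation.\<close>

lemma continuation_three_term:
  assumes eq: "\<And>z. Re z < 0 \<Longrightarrow> 2 * F (z + 1) = F z + 1 / (lam * z\<^sup>2) * F (1 / z)"
    and z: "Re z < 0 \<or> Im z \<noteq> 0"
  shows "2 * continuation F lam (z + 1)
    = continuation F lam z + 1 / (lam * z\<^sup>2) * continuation F lam (1 / z)"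
proof (cases "Re z < 0")
  case True
  with Re_inverse_neg[OF True] show ?thesis
    using eq[OF True] by (simp add: continuation_base)
next
  case False
  then show ?thesis using z by (subst continuation.simps) simp
qed

lemma continuation_differentiable_left:
  assumes hol: "F holomorphic_on {z. Re z < 1}" and w: "Re w < 1"
  shows "continuation F lam field_differentiable at w"
proof -
  have "continuation F lam holomorphic_on {z. Re z < 1}"
    by (rule holomorphic_transform[OF hol]) (simp add: continuation_base)
  then show ?thesis
    using w by (auto intro: holomorphic_on_imp_differentiable_at open_halfspace_Re_lt)
qed

lemma continuation_differentiable_nonreal:
  assumes "\<And>z. Re z < 0 \<Longrightarrow> 2 * F (z + 1) = F z + 1 / (lam * z\<^sup>2) * F (1 / z)"
    and "F holomorphic_on {z. Re z < 1}" and "lam \<noteq> 0" and "Im w \<noteq> 0"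
  shows "continuation F lam field_differentiable at w"
  using assms
proof (induction F lam w rule: continuation.induct)
  case (1 F lam w)
  note eq = 1(3) and hol = 1(4) and lam = 1(5) and im = 1(6)
  show ?case
  proof (cases "Re w < 1")
    case True
    with hol show ?thesis by (rule continuation_differentiable_left)
  next
    case False
    have nz: "w - 1 \<noteq> 0" "Im (w - 1) \<noteq> 0" "Im (1 / (w - 1)) \<noteq> 0"
      using im by (auto simp: Im_divide complex_eq_iff)
    have d1: "continuation F lam field_differentiable at (w - 1)"
      by (rule 1(1)[OF _ eq hol lam]) (use False im nz in auto)
    have d2: "continuation F lam field_differentiable at (1 / (w - 1))"
      by (rule 1(2)[OF _ eq hol lam]) (use False im nz in auto)
    have d: "(\<lambda>u. (continuation F lam (u - 1)
        + 1 / (lam * (u - 1)\<^sup>2) * continuation F lam (1 / (u - 1))) / 2) field_differentiable at w"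
    proof -
      have s: "(\<lambda>u. u - 1) field_differentiable at w" by (intro derivative_intros)
      have i: "(\<lambda>u. 1 / (u - 1)) field_differentiable at w"
        using nz by (intro derivative_intros) auto
      have "(continuation F lam \<circ> (\<lambda>u. u - 1)) field_differentiable at w"
        "(continuation F lam \<circ> (\<lambda>u. 1 / (u - 1))) field_differentiable at w"
        using field_differentiable_compose[OF s] field_differentiable_compose[OF i] d1 d2 by auto
      then show ?thesis
        using nz lam unfolding o_def by (intro derivative_intros) auto
    qed
    \<comment> \<open>On the line \<open>Re w = 1\<close> the definition changes branch, so
      unfolding it describes only one side. The three-term equation holds on both sides and gives
      one formula on a full neighbourhood.\<close>
    have ev: "\<forall>\<^sub>F u in nhds w. continuation F lam u = (continuation F lam (u - 1)
        + 1 / (lam * (u - 1)\<^sup>2) * continuation F lam (1 / (u - 1))) / 2"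
    proof (rule eventually_mono[OF eventually_nhds_in_open])
      show "open {u. Im u \<noteq> 0}" by (intro open_Collect_neq continuous_intros)
      show "w \<in> {u. Im u \<noteq> 0}" using im by simp
      fix u assume "u \<in> {u. Im u \<noteq> 0}"
      then have "Im (u - 1) \<noteq> 0" by simp
      then show "continuation F lam u = (continuation F lam (u - 1)
        + 1 / (lam * (u - 1)\<^sup>2) * continuation F lam (1 / (u - 1))) / 2"
        using continuation_three_term[OF eq, of "u - 1"] by (simp add: field_simps)
    qed
    from d show ?thesis
      unfolding field_differentiable_def DERIV_cong_ev[OF refl ev refl] .
  qed
qed

section \<open>The Laplace transform of an eigenfunction\<close>

text \<open>The Bessel transform grows at most linearly, so the eigenvalue equation forces
  \<open>|g t| <= B * t * exp (- t)\<close>. This pushes the half-plane of convergence from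
  \<open>Re z <= 0\<close> to \<open>Re z < 1\<close>, as the term \<open>G (z + 1)\<close>
  requires.\<close>

lemma eigen_laplace_integrable:
  assumes g: "integrable pos_measure g" and lam: "lam \<noteq> 0"
    and eig: "AE s in pos_measure. bessel_transform g s = lam * of_real (2 * exp s - 1) * g s"
    and z: "Re z < 1"
  shows "integrable pos_measure (\<lambda>t. g t * exp (of_real t * z))"
proof (rule Bochner_Integration.integrable_bound)
  define B where "B = (\<integral>t. norm (g t) \<partial>pos_measure) / norm lam"
  have B: "0 \<le> B" by (simp add: B_def)
  show "integrable pos_measure (\<lambda>t. B * (t ^ 1 * exp (- (1 - Re z) * t)))"
    using z by (intro integrable_mult_right integrable_power_exp) simp
  show "(\<lambda>t. g t * exp (of_real t * z)) \<in> borel_measurable pos_measure"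
    by (intro borel_measurable_times borel_measurable_integrable[OF g] borel_measurable_pos_measureI
        borel_measurable_continuous_onI continuous_intros)
  show "AE t in pos_measure. norm (g t * exp (of_real t * z)) \<le> norm (B * (t ^ 1 * exp (- (1 - Re z) * t)))"
    using eig AE_space
  proof eventually_elim
    case (elim t)
    then have t: "0 < t" by simp
    then have e1: "1 \<le> exp t" by simp
    have "norm lam * (2 * exp t - 1) * norm (g t) = norm (bessel_transform g t)"
      using e1 unfolding elim(1) norm_mult norm_of_real by (subst abs_of_nonneg) (linarith, simp)
    also have "\<dots> \<le> t * (B * norm lam)"
      using norm_bessel_transform_le[OF g, of t] t lam by (simp add: B_def)
    finally have "norm lam * ((2 * exp t - 1) * norm (g t)) \<le> norm lam * (t * B)"
      by (simp only: mult_ac)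
    then have "(2 * exp t - 1) * norm (g t) \<le> t * B"
      by (rule mult_left_le_imp_le) (use lam in simp)
    moreover have "exp t * norm (g t) \<le> (2 * exp t - 1) * norm (g t)"
      using e1 by (intro mult_right_mono) auto
    ultimately have "exp t * norm (g t) \<le> t * B" by linarith
    then have "exp t * norm (g t) * exp (t * (Re z - 1)) \<le> t * B * exp (t * (Re z - 1))"
      by (rule mult_right_mono) simp
    moreover have "exp t * exp (t * (Re z - 1)) = exp (t * Re z)"
      by (simp add: algebra_simps flip: exp_add)
    ultimately have "norm (g t) * exp (t * Re z) \<le> t * B * exp (t * (Re z - 1))"
      by (metis mult.assoc mult.commute)
    then show ?case using B t by (simp add: norm_mult algebra_simps)
  qed
qed

text \<open>The transform of the Bessel transform is known at real arguments only. The equation is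
  therefore checked at \<open>z = - r\<close>, where \<open>2 * exp t - 1\<close> produces the shift
  by \<open>1\<close>, and continued to the half-plane as the vanishing of the holomorphic defect
  \<open>E\<close>.\<close>

lemma eigen_laplace_three_term:
  assumes g: "integrable pos_measure g" and lam: "lam \<noteq> 0"
    and eig: "AE s in pos_measure. bessel_transform g s = lam * of_real (2 * exp s - 1) * g s"
    and z: "Re z < 0"
  shows "2 * laplace g (z + 1) = laplace g z + 1 / (lam * z\<^sup>2) * laplace g (1 / z)"
proof -
  note int = eigen_laplace_integrable[OF g lam eig]
  have hol: "laplace g holomorphic_on {z. Re z < 1}" by (rule holomorphic_laplace[OF int])
  define E where "E z = 2 * laplace g (z + 1) - laplace g z - 1 / (lam * z\<^sup>2) * laplace g (1 / z)" for z
  have "E holomorphic_on {z. Re z < 0}"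
    unfolding E_def
  proof (intro holomorphic_intros)
    show "(\<lambda>z. laplace g (z + 1)) holomorphic_on {z. Re z < 0}"
      by (rule holomorphic_on_compose_gen[OF _ hol, unfolded o_def]) (auto intro!: holomorphic_intros)
    show "laplace g holomorphic_on {z. Re z < 0}" by (rule holomorphic_on_subset[OF hol]) auto
    show "(\<lambda>z. laplace g (1 / z)) holomorphic_on {z. Re z < 0}"
      by (rule holomorphic_on_compose_gen[OF _ hol, unfolded o_def])
        (auto intro!: holomorphic_intros dest: Re_inverse_neg)
  qed (use lam in auto)
  then have "E z = 0"
  proof (rule analytic_continuation[where U = "of_real ` {..<0}" and \<xi> = "-1"])
    show "open {z. Re z < 0}" by (rule open_halfspace_Re_lt)
    show "connected {z. Re z < 0}" by (intro convex_connected convex_halfspace_Re_lt)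
    have "-1 islimpt {..<(0::real)}" by (rule interior_limit_point) (simp add: interior_open)
    then have "complex_of_real (-1) islimpt of_real ` {..<0}"
      unfolding islimpt_approachable by (metis (no_types, lifting) dist_of_real image_eqI of_real_eq_iff)
    then show "-1 islimpt complex_of_real ` {..<0}" by simp
    fix w assume "w \<in> complex_of_real ` {..<0}"
    then obtain r where r: "0 < r" "w = of_real (- r)"
      by (metis imageE lessThan_iff neg_0_less_iff_less minus_minus)
    have i1: "integrable pos_measure (\<lambda>t. g t * of_real (exp (t * (- r + 1))))"
      using int[of "of_real (- r + 1)"] r by (simp add: exp_of_real[symmetric])
    have i2: "integrable pos_measure (\<lambda>t. g t * of_real (exp (t * (- r))))"
      using int[of "of_real (- r)"] r by (simp add: exp_of_real[symmetric])
    have "2 * laplace g (w + 1) - laplace g w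
        = 2 * laplace g (of_real (- r + 1)) - laplace g (of_real (- r))"
      by (simp add: r)
    also have "\<dots> = (\<integral>t. 2 * (g t * of_real (exp (t * (- r + 1)))) - g t * of_real (exp (t * (- r))) \<partial>pos_measure)"
      unfolding laplace_of_real
      by (subst Bochner_Integration.integral_diff) (use i1 i2 in auto)
    also have "\<dots> = (\<integral>t. (1 / lam) * (bessel_transform g t * of_real (exp (- r * t))) \<partial>pos_measure)"
    proof (rule integral_cong_AE)
      show "(\<lambda>t. 2 * (g t * of_real (exp (t * (- r + 1)))) - g t * of_real (exp (t * (- r)))) \<in> borel_measurable pos_measure"
        by (intro borel_measurable_integrable Bochner_Integration.integrable_diff integrable_mult_right i1 i2)
      show "(\<lambda>t. (1 / lam) * (bessel_transform g t * of_real (exp (- r * t)))) \<in> borel_measurable pos_measure"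
        by (intro borel_measurable_integrable integrable_mult_right laplace_bessel_transform(1)[OF g r(1)])
      show "AE t in pos_measure. 2 * (g t * of_real (exp (t * (- r + 1)))) - g t * of_real (exp (t * (- r)))
          = (1 / lam) * (bessel_transform g t * of_real (exp (- r * t)))"
        using eig
      proof eventually_elim
        case (elim t)
        have "exp (t * (- r + 1)) = exp t * exp (- r * t)"
          by (simp add: algebra_simps flip: exp_add)
        moreover have "exp (t * (- r)) = exp (- r * t)" by (simp add: mult.commute)
        ultimately show ?case unfolding elim using lam by (simp add: algebra_simps)
      qed
    qed
    also have "\<dots> = (1 / lam) * (laplace g (of_real (- 1 / r)) / of_real (r\<^sup>2))"
      unfolding integral_mult_right_zero laplace_bessel_transform(2)[OF g r(1)] laplace_of_real
      by (simp add: divide_inverse)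
    also have "\<dots> = 1 / (lam * w\<^sup>2) * laplace g (1 / w)"
      using r by simp
    finally show "E w = 0" by (simp add: E_def)
  qed (use z in auto)
  then show ?thesis by (simp add: E_def algebra_simps)
qed

lemma laplace_nonzero:
  assumes g: "integrable pos_measure g" and nz: "\<not> (AE t in pos_measure. g t = 0)"
  shows "\<exists>z. Re z < 0 \<and> laplace g z \<noteq> 0"
proof (rule ccontr)
  assume *: "\<not> ?thesis"
  have "AE t in pos_measure. g t = 0"
  proof (rule laplace_unique[where c = 0])
    fix x :: real assume x: "0 < x"
    then show "integrable pos_measure (\<lambda>t. g t * of_real (exp (- x * t)))"
      by (intro integrable_mult_exp_neg g) simp
    have "laplace g (of_real (- x)) = 0" using * x by auto
    then show "(\<integral>t. g t * of_real (exp (- x * t)) \<partial>pos_measure) = 0"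
      unfolding laplace_of_real by (simp add: mult.commute)
  qed
  with nz show False by simp
qed

lemma slit_from_iff: "z \<in> slit_from a \<longleftrightarrow> Re z < a \<or> Im z \<noteq> 0"
proof -
  have "z \<in> complex_of_real ` {a..} \<longleftrightarrow> a \<le> Re z \<and> Im z = 0"
    by (auto simp: image_iff complex_eq_iff intro!: bexI[of _ "Re z"])
  then show ?thesis by (auto simp: slit_from_def)
qed

lemma open_slit_from: "open (slit_from a)"
proof -
  have "slit_from a = {z. Re z < a} \<union> {z. Im z \<noteq> 0}" by (auto simp: slit_from_iff)
  then show ?thesis
    by (auto intro!: open_Un open_halfspace_Re_lt open_Collect_neq continuous_intros)
qed

lemma eigenvalue_imp_period_function:
  assumes "eigenvalue_K lam"
  shows "lam \<noteq> 0 \<and> (\<exists>G. period_function lam G)"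
proof -
  obtain A where A: "L2_pos A" "\<not> (AE t in pos_measure. A t = 0)"
    and eA: "AE s in pos_measure. op_K A s = lam * A s"
    using assms unfolding eigenvalue_K_def by blast
  define g where "g = weighted A"
  have g: "integrable pos_measure g" unfolding g_def by (rule integrable_weighted[OF A(1)])
  have gnz: "\<not> (AE t in pos_measure. g t = 0)"
  proof
    assume "AE t in pos_measure. g t = 0"
    then have "AE t in pos_measure. A t = 0"
      using AE_space
    proof eventually_elim
      case (elim t)
      then have "0 < t" "weighted A t = 0" by (simp_all add: g_def)
      then show ?case using weighted_eq_0_iff by blast
    qed
    with A(2) show False by simp
  qed
  have eig: "AE s in pos_measure. bessel_transform g s = lam * of_real (2 * exp s - 1) * g s"
    unfolding g_def by (rule weighted_eigen_equation[OF eA])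
  have lam: "lam \<noteq> 0"
  proof
    assume "lam = 0"
    then have "AE s in pos_measure. bessel_transform g s = 0" using eig by simp
    from bessel_transform_inj[OF g this] gnz show False by simp
  qed
  note int = eigen_laplace_integrable[OF g lam eig]
  note eq = eigen_laplace_three_term[OF g lam eig]
  have hol: "laplace g holomorphic_on {z. Re z < 1}" by (rule holomorphic_laplace[OF int])
  let ?G = "continuation (laplace g) lam"
  have "period_function lam ?G"
    unfolding period_function_def
  proof (intro conjI)
    obtain z where z: "Re z < 0" "laplace g z \<noteq> 0" using laplace_nonzero[OF g gnz] by blast
    then show "\<exists>z\<in>slit_from 1. ?G z \<noteq> 0"
      by (intro bexI[of _ z]) (auto simp: continuation_base slit_from_iff)
    show "?G holomorphic_on slit_from 1"
      unfolding holomorphic_on_def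
    proof
      fix z assume "z \<in> slit_from 1"
      then consider "Re z < 1" | "Im z \<noteq> 0" by (auto simp: slit_from_iff)
      then show "?G field_differentiable at z within slit_from 1"
        by cases (auto intro: field_differentiable_at_within continuation_differentiable_left[OF hol]
          continuation_differentiable_nonreal[OF eq hol lam])
    qed
    show "three_term_equation lam ?G"
      unfolding three_term_equation_def
      by (intro ballI continuation_three_term[OF eq]) (auto simp: slit_from_iff)
    show "laplace_image ?G"
      unfolding laplace_image_def
    proof (intro exI allI impI conjI)
      fix z assume z: "Re z < 0"
      show "integrable pos_measure (\<lambda>t. g t * exp (of_real t * z))" using z by (intro int) simp
      show "?G z = (\<integral>t. g t * exp (of_real t * z) \<partial>pos_measure)"
        using z by (simp add: continuation_base laplace_def)
    qed
  qed
  with lam show ?thesis by blast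
qed

section \<open>From solutions of the three-term equation to eigenfunctions\<close>

lemma connected_slit_from:
  assumes "0 < a"
  shows "connected (slit_from a)"
proof (rule starlike_imp_connected)
  show "starlike (slit_from a)"
    unfolding starlike_def
  proof (intro bexI[of _ 0] ballI subsetI)
    show "0 \<in> slit_from a" using assms by (simp add: slit_from_iff)
    fix x y assume x: "x \<in> slit_from a" and "y \<in> closed_segment 0 x"
    then obtain u where u: "0 \<le> u" "u \<le> 1" "y = of_real u * x"
      by (auto simp: in_segment scaleR_conv_of_real)
    show "y \<in> slit_from a"
    proof (cases "Im x = 0")
      case True
      with x have "Re x < a" by (simp add: slit_from_iff)
      have "u * Re x < a"
      proof (cases "0 \<le> Re x")
        case True
        then have "u * Re x \<le> 1 * Re x" using u by (intro mult_right_mono) auto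
        with \<open>Re x < a\<close> show ?thesis by simp
      next
        case False
        then have "u * Re x \<le> 0" using u by (simp add: mult_nonneg_nonpos)
        with assms show ?thesis by simp
      qed
      then show ?thesis by (simp add: u slit_from_iff)
    next
      case False
      then show ?thesis using assms by (cases "u = 0") (auto simp: u slit_from_iff)
    qed
  qed
qed

text \<open>The map \<open>w = 2 * v / (v - 2)\<close> is an involution. A real value
  \<open>w = a\<close> with \<open>a >= 1\<close> would come from a \<open>v\<close> of modulus
  \<open>2 * a / |a - 2|\<close>, which is at least \<open>2\<close>.\<close>

lemma moebius_in_slit:
  assumes v: "norm v < 2"
  shows "2 * v / (v - 2) \<in> slit_from 1"
proof (rule ccontr)
  assume n: "2 * v / (v - 2) \<notin> slit_from 1"
  define a where "a = Re (2 * v / (v - 2))"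
  have a: "1 \<le> a" and w: "2 * v / (v - 2) = of_real a"
    using n by (auto simp: slit_from_iff a_def complex_eq_iff)
  have v2: "v \<noteq> 2" using v by auto
  then have "v * of_real (a - 2) = of_real (2 * a)" using w by (simp add: field_simps)
  then have "norm v * \<bar>a - 2\<bar> = 2 * a"
    using a by (metis norm_mult norm_of_real abs_of_nonneg mult_nonneg_nonneg order_trans zero_le_one zero_le_numeral)
  moreover have "norm v * \<bar>a - 2\<bar> \<le> 2 * \<bar>a - 2\<bar>" using v by (intro mult_right_mono) auto
  ultimately have "a \<le> \<bar>a - 2\<bar>" by simp
  then have a1: "a = 1" using a by linarith
  with \<open>norm v * \<bar>a - 2\<bar> = 2 * a\<close> v show False by simp
qed

text \<open>In the variable \<open>v = - 1 / (z - 1/2)\<close> the function \<open>G (1 / z)\<close> is holomorphic on the disc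
  \<open>|v| < 2\<close>. Expanding there instead of in powers of \<open>1 / z\<close> makes the inverse Laplace
  transform of \<open>G (1 / z) / z\<^sup>2\<close> grow more slowly than \<open>exp s\<close>.\<close>

lemma inverse_laplace_of_inversion:
  assumes hol: "G holomorphic_on slit_from 1"
  obtains V :: "real \<Rightarrow> complex" and C where
    "\<And>r. 1 < r \<Longrightarrow> integrable pos_measure (\<lambda>s. V s * of_real (exp (- r * s)))"
    "\<And>r. 1 < r \<Longrightarrow> (\<integral>s. V s * of_real (exp (- r * s)) \<partial>pos_measure) = G (of_real (- 1 / r)) / of_real (r\<^sup>2)"
    "\<And>s. 0 \<le> s \<Longrightarrow> norm (V s) \<le> C * (s * exp (s / 6))" "0 \<le> C"
proof -
  \<comment> \<open>Chosen so that \<open>v^2 * P v = G (1 / z) / z^2\<close> when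
    \<open>1 / z = 2 * v / (v - 2)\<close>; the factor \<open>v^2\<close> matches the starting
    exponent of \<open>laplace_borel_series\<close>.\<close>
  define P where "P v = 4 * G (2 * v / (v - 2)) / (2 - v)\<^sup>2" for v
  have n2: "2 - v \<noteq> 0" "v - 2 \<noteq> 0" if "v \<in> ball 0 2" for v :: complex using that by auto
  have Phol: "P holomorphic_on ball 0 2"
    unfolding P_def
  proof (intro holomorphic_intros)
    show "(\<lambda>v. G (2 * v / (v - 2))) holomorphic_on ball 0 2"
      by (rule holomorphic_on_compose_gen[OF _ hol, unfolded o_def])
        (use n2 in \<open>auto intro!: holomorphic_intros moebius_in_slit\<close>)
  qed (use n2 in auto)
  define c where "c n = (deriv ^^ n) P 0 / fact n" for n
  have sums: "(\<lambda>n. c n * v ^ n) sums P v" if "norm v < 2" for v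
    using holomorphic_power_series[OF Phol, of v] that by (simp add: c_def)
  \<comment> \<open>The series converges for \<open>|v| < 2\<close>, and \<open>7/4\<close> is just
    a point of convergence beyond \<open>3/2\<close>. Summability at radius \<open>3/2\<close> makes
    \<open>U\<close> grow at most like \<open>s * exp (2/3 * s)\<close>; any radius above
    \<open>1\<close> would leave a rate below \<open>1/2\<close> after the shift.\<close>
  have "summable (\<lambda>n. norm (c n * (of_real (3 / 2)) ^ n))"
    by (rule powser_insidea[where x = "of_real (7 / 4)"]) (use sums[of "of_real (7 / 4)"] in \<open>auto simp: sums_iff\<close>)
  then have c: "summable (\<lambda>n. norm (c n) / (2 / 3) ^ n)"
    unfolding norm_mult norm_power norm_of_real by (simp add: power_divide)
  have c': "summable (\<lambda>n. norm (c n) / r ^ n)" if "2 / 3 \<le> r" for r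
    by (rule summable_comparison_test'[OF c]) (use that in \<open>auto intro!: divide_left_mono power_mono\<close>)
  define U where "U s = (\<Sum>k. c k * of_real (s ^ Suc k / fact (Suc k)))" for s
  \<comment> \<open>Recentring at \<open>1/2\<close> in the variable \<open>z\<close> is
    multiplication by \<open>exp (- s / 2)\<close> before the transform; it lowers the growth rate
    from \<open>2/3\<close> to \<open>1/6\<close>.\<close>
  define V where "V s = U s * of_real (exp (- s / 2))" for s
  have VU: "V s * of_real (exp (- r * s)) = U s * of_real (exp (- (r + 1 / 2) * s))" for r s
    by (simp add: V_def mult.assoc algebra_simps flip: exp_add of_real_mult)
  show thesis
  proof (rule that)
    fix r :: real assume r: "1 < r"
    then have r': "0 < r + 1 / 2" "2 / 3 \<le> r + 1 / 2" by auto
    show "integrable pos_measure (\<lambda>s. V s * of_real (exp (- r * s)))"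
      unfolding VU unfolding U_def by (rule laplace_borel_series(1)[OF r'(1) c'[OF r'(2)]])
    define v :: complex where "v = 1 / of_real (r + 1 / 2)"
    have rnz: "complex_of_real r \<noteq> 0" "complex_of_real (2 * r + 1) \<noteq> 0"
      using r unfolding of_real_eq_0_iff by auto
    have v_eq: "v = 2 / complex_of_real (2 * r + 1)"
    proof -
      have "1 / (r + 1 / 2) = 2 / (2 * r + 1)" using r by (simp add: field_simps)
      then have "complex_of_real (1 / (r + 1 / 2)) = of_real (2 / (2 * r + 1))" by (simp only:)
      then show ?thesis unfolding v_def of_real_divide by simp
    qed
    have nv: "norm v < 2"
      using r unfolding v_def norm_divide norm_of_real by (simp add: field_simps)
    have "v - 2 \<noteq> 0" using nv by auto
    have v2: "v - 2 = - (2 * of_real r) * v"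
    proof -
      have "v * complex_of_real (2 * r + 1) = 2" using rnz by (simp add: v_eq del: of_real_add of_real_mult)
      then show ?thesis by (simp add: algebra_simps)
    qed
    have vnz: "v \<noteq> 0" using rnz by (simp add: v_eq del: of_real_add of_real_mult)
    have w: "2 * v / (v - 2) = of_real (- 1 / r)"
      unfolding v2 using vnz rnz by (simp add: field_simps)
    have sq: "(2 - v)\<^sup>2 = (2 * of_real r * v)\<^sup>2"
      using v2 by (metis minus_diff_eq minus_mult_left power2_minus)
    have "(\<integral>s. V s * of_real (exp (- r * s)) \<partial>pos_measure) = (\<Sum>k. c k / of_real (r + 1 / 2) ^ (k + 2))"
      unfolding VU unfolding U_def by (rule laplace_borel_series(2)[OF r'(1) c'[OF r'(2)]])
    also have "\<dots> = (\<Sum>k. c k * v ^ k * v\<^sup>2)"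
    proof -
      have "c k / X ^ (k + 2) = c k * (1 / X) ^ k * (1 / X)\<^sup>2" for k X
        by (simp add: power_one_over power_add power2_eq_square divide_inverse power_inverse)
      then show ?thesis unfolding v_def by (simp only:)
    qed
    also have "\<dots> = P v * v\<^sup>2"
      using sums_mult2[OF sums[OF nv]] by (rule sums_unique[symmetric])
    also have "\<dots> = G (of_real (- 1 / r)) / of_real (r\<^sup>2)"
      unfolding P_def w sq using vnz rnz by (simp add: power_mult_distrib field_simps)
    finally show "(\<integral>s. V s * of_real (exp (- r * s)) \<partial>pos_measure) = G (of_real (- 1 / r)) / of_real (r\<^sup>2)" .
  next
    fix s :: real assume s: "0 \<le> s"
    have "norm (V s) = norm (U s) * exp (- s / 2)" by (simp add: V_def norm_mult)
    also have "\<dots> \<le> (\<Sum>k. norm (c k) / (2 / 3) ^ k) * (s * exp (2 / 3 * s)) * exp (- s / 2)"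
      unfolding U_def by (intro mult_right_mono laplace_borel_series(3) c s) auto
    also have "\<dots> = (\<Sum>k. norm (c k) / (2 / 3) ^ k) * (s * exp (s / 6))"
    proof -
      have "exp (2 / 3 * s) * exp (- s / 2) = exp (s / 6)" by (simp flip: exp_add)
      then show ?thesis by (simp only: mult.assoc)
    qed
    finally show "norm (V s) \<le> (\<Sum>k. norm (c k) / (2 / 3) ^ k) * (s * exp (s / 6))" .
  next
    show "0 \<le> (\<Sum>k. norm (c k) / (2 / 3) ^ k)" by (rule suminf_nonneg[OF c]) simp
  qed
qed

text \<open>Both \<open>lam * (2 * exp s - 1) * g s\<close> and the Bessel transform of
  \<open>g\<close> are identified with \<open>V\<close> by uniqueness. The order matters: the first
  identity transfers the growth bound of \<open>V\<close> to \<open>g\<close>, whence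
  \<open>A\<close> is square integrable and \<open>g\<close> integrable, and only then is the Bessel
  transform covered by the earlier lemmas.\<close>

lemma period_function_imp_eigenvalue:
  assumes lam: "lam \<noteq> 0" and pf: "period_function lam G"
  shows "eigenvalue_K lam"
proof -
  have hol: "G holomorphic_on slit_from 1" and three: "three_term_equation lam G"
    and nz: "\<exists>z\<in>slit_from 1. G z \<noteq> 0"
    using pf by (auto simp: period_function_def)
  obtain g where g: "\<And>z. Re z < 0 \<Longrightarrow> integrable pos_measure (\<lambda>t. g t * exp (of_real t * z))"
    and Gg: "\<And>z. Re z < 0 \<Longrightarrow> G z = laplace g z"
    using pf unfolding period_function_def laplace_image_def laplace_def by blast
  have gr: "integrable pos_measure (\<lambda>t. g t * of_real (exp (- r * t)))"
    and Gr: "(\<integral>t. g t * of_real (exp (- r * t)) \<partial>pos_measure) = G (of_real (- r))" if "0 < r" for r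
    using g[of "of_real (- r)"] Gg[of "of_real (- r)"] that
    by (simp_all add: laplace_def mult.commute flip: exp_of_real)
  obtain V C where Vint: "\<And>r. 1 < r \<Longrightarrow> integrable pos_measure (\<lambda>s. V s * of_real (exp (- r * s)))"
    and Vval: "\<And>r. 1 < r \<Longrightarrow> (\<integral>s. V s * of_real (exp (- r * s)) \<partial>pos_measure) = G (of_real (- 1 / r)) / of_real (r\<^sup>2)"
    and VC: "\<And>s. 0 \<le> s \<Longrightarrow> norm (V s) \<le> C * (s * exp (s / 6))" and C: "0 \<le> C"
    using inverse_laplace_of_inversion[OF hol] by blast
  \<comment> \<open>The bound \<open>r > 1\<close> keeps \<open>r - 1\<close> positive, so the
    Laplace integral of \<open>g\<close> also represents \<open>G\<close> at the shifted
    argument.\<close>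
  have gV: "AE t in pos_measure. lam * of_real (2 * exp t - 1) * g t - V t = 0"
  proof (rule laplace_unique[where c = 1])
    fix r :: real assume r: "1 < r"
    then have r1: "0 < r - 1" and r0: "0 < r" by auto
    have i1: "integrable pos_measure (\<lambda>t. g t * of_real (exp (- (r - 1) * t)))"
      and i2: "integrable pos_measure (\<lambda>t. g t * of_real (exp (- r * t)))"
      by (rule gr, use r in simp)+
    have eq: "(lam * of_real (2 * exp t - 1) * g t - V t) * of_real (exp (- r * t))
      = lam * (2 * (g t * of_real (exp (- (r - 1) * t))) - g t * of_real (exp (- r * t))) - V t * of_real (exp (- r * t))" for t
    proof -
      have "exp (- (r - 1) * t) = exp t * exp (- r * t)" by (simp add: algebra_simps flip: exp_add)
      then show ?thesis by (simp add: algebra_simps)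
    qed
    show "integrable pos_measure (\<lambda>t. (lam * of_real (2 * exp t - 1) * g t - V t) * of_real (exp (- r * t)))"
      unfolding eq by (intro Bochner_Integration.integrable_diff integrable_mult_right i1 i2 Vint r)
    have "(\<integral>t. (lam * of_real (2 * exp t - 1) * g t - V t) * of_real (exp (- r * t)) \<partial>pos_measure)
      = lam * (2 * G (of_real (- (r - 1))) - G (of_real (- r))) - G (of_real (- 1 / r)) / of_real (r\<^sup>2)"
    proof -
      have "(\<integral>t. (lam * of_real (2 * exp t - 1) * g t - V t) * of_real (exp (- r * t)) \<partial>pos_measure)
        = (\<integral>t. lam * (2 * (g t * of_real (exp (- (r - 1) * t))) - g t * of_real (exp (- r * t))) \<partial>pos_measure)
          - (\<integral>t. V t * of_real (exp (- r * t)) \<partial>pos_measure)"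
        unfolding eq by (intro Bochner_Integration.integral_diff Bochner_Integration.integrable_diff integrable_mult_right i1 i2 Vint r)
      also have "(\<integral>t. lam * (2 * (g t * of_real (exp (- (r - 1) * t))) - g t * of_real (exp (- r * t))) \<partial>pos_measure)
        = lam * ((\<integral>t. 2 * (g t * of_real (exp (- (r - 1) * t))) \<partial>pos_measure) - (\<integral>t. g t * of_real (exp (- r * t)) \<partial>pos_measure))"
        unfolding integral_mult_right_zero
        by (subst Bochner_Integration.integral_diff[OF integrable_mult_right[OF i1] i2]) (simp only: integral_mult_right_zero)
      finally show ?thesis
        unfolding integral_mult_right_zero Gr[OF r1] Gr[OF r0] Vval[OF r] .
    qed
    moreover have "lam * (2 * G (of_real (- (r - 1))) - G (of_real (- r))) = G (of_real (- 1 / r)) / of_real (r\<^sup>2)"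
    proof -
      have "of_real (- r) \<in> slit_from 0" using r by (simp add: slit_from_iff)
      with three have "2 * G (of_real (- r) + 1) = G (of_real (- r))
          + 1 / (lam * (of_real (- r))\<^sup>2) * G (1 / of_real (- r))"
        unfolding three_term_equation_def by blast
      moreover have "complex_of_real (- r) + 1 = of_real (- (r - 1))" "1 / complex_of_real (- r) = of_real (- 1 / r)"
        by simp_all
      ultimately show ?thesis using lam r by (simp only:) (simp add: field_simps)
    qed
    ultimately show "(\<integral>t. (lam * of_real (2 * exp t - 1) * g t - V t) * of_real (exp (- r * t)) \<partial>pos_measure) = 0"
      by simp
  qed
  define A where "A t = of_real (psi t / sqrt t) * g t" for t
  have wA: "weighted A t = g t" if "0 < t" for t
  proof -
    have "sqrt t / psi t * (psi t / sqrt t) = 1" using that psi_square(3)[of t] by simp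
    then show ?thesis unfolding A_def mult.assoc[symmetric] of_real_mult[symmetric] by simp
  qed
  have g_meas: "g \<in> borel_measurable pos_measure"
  proof -
    have "(\<lambda>t. g t * of_real (exp (- 1 * t))) \<in> borel_measurable pos_measure"
      by (rule borel_measurable_integrable[OF gr]) simp
    moreover have "(\<lambda>t. complex_of_real (exp t)) \<in> borel_measurable pos_measure"
      by (rule borel_measurable_pos_measureI) measurable
    ultimately have "(\<lambda>t. g t * of_real (exp (- 1 * t)) * of_real (exp t)) \<in> borel_measurable pos_measure"
      by (rule borel_measurable_times)
    then show ?thesis by (simp add: mult.assoc flip: of_real_mult exp_add)
  qed
  have L2A: "L2_pos A"
    unfolding L2_pos_def
  proof
    show A_meas: "A \<in> borel_measurable pos_measure"
      unfolding A_def by (intro borel_measurable_times g_meas borel_measurable_pos_measureI) measurable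
    \<comment> \<open>By \<open>gV\<close>, \<open>psi^2 * |g|\<close> is at most
      \<open>C / |lam| * t * exp (t / 6)\<close>. Squaring gives the rate \<open>1/3\<close>, and
      division by \<open>psi^2 >= exp t\<close> leaves
      \<open>D * t * exp (- 2/3 * t)\<close>.\<close>
    define D where "D = (C / norm lam)\<^sup>2"
    show "integrable pos_measure (\<lambda>t. (cmod (A t))\<^sup>2)"
    proof (rule Bochner_Integration.integrable_bound)
      show "integrable pos_measure (\<lambda>t. D * (t ^ 1 * exp (- (2 / 3) * t)))"
        by (intro integrable_mult_right integrable_power_exp) simp
      show "(\<lambda>t. (cmod (A t))\<^sup>2) \<in> borel_measurable pos_measure" using A_meas by measurable
      show "AE t in pos_measure. norm ((cmod (A t))\<^sup>2) \<le> norm (D * (t ^ 1 * exp (- (2 / 3) * t)))"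
        using gV AE_space
      proof eventually_elim
        case (elim t)
        then have t: "0 < t" by simp
        note ps = psi_square[OF less_imp_le[OF t]]
        have "norm lam * (psi t)\<^sup>2 * norm (g t) = norm (V t)"
        proof -
          have "V t = lam * of_real ((psi t)\<^sup>2) * g t" using elim(1) by (simp add: ps(1))
          then show ?thesis by (simp only: norm_mult norm_of_real) simp
        qed
        also have "\<dots> \<le> C * (t * exp (t / 6))" using t by (intro VC) simp
        finally have "norm lam * ((psi t)\<^sup>2 * norm (g t)) \<le> norm lam * (C / norm lam * (t * exp (t / 6)))"
          using lam by (simp add: mult_ac)
        then have gb: "(psi t)\<^sup>2 * norm (g t) \<le> C / norm lam * (t * exp (t / 6))"
          by (rule mult_left_le_imp_le) (use lam in simp)
        have "(psi t)\<^sup>2 * (t * (cmod (A t))\<^sup>2) = ((psi t)\<^sup>2 * norm (g t))\<^sup>2"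
          using t ps(3) by (simp add: A_def norm_mult norm_divide power_mult_distrib power_divide)
        also have "\<dots> \<le> (C / norm lam * (t * exp (t / 6)))\<^sup>2"
          using gb by (intro power_mono) auto
        also have "\<dots> = D * (t * (t * exp (t / 3)))"
        proof -
          have "(exp (t / 6))\<^sup>2 = exp (t / 3)" by (simp add: power2_eq_square flip: exp_add)
          then show ?thesis unfolding D_def power_mult_distrib by (simp only: power2_eq_square[of t] mult_ac)
        qed
        also have "\<dots> = exp t * (t * (D * (t * exp (- (2 / 3) * t))))"
          by (simp add: mult_ac flip: exp_add)
        also have "\<dots> \<le> (psi t)\<^sup>2 * (t * (D * (t * exp (- (2 / 3) * t))))"
          using ps(2) t by (intro mult_right_mono) (auto simp: D_def)
        finally have "(psi t)\<^sup>2 * (t * (cmod (A t))\<^sup>2) \<le> (psi t)\<^sup>2 * (t * (D * (t * exp (- (2 / 3) * t))))" .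
        then have "t * (cmod (A t))\<^sup>2 \<le> t * (D * (t * exp (- (2 / 3) * t)))"
          by (rule mult_left_le_imp_le) (use ps(3) in simp)
        then have "(cmod (A t))\<^sup>2 \<le> D * (t * exp (- (2 / 3) * t))"
          by (rule mult_left_le_imp_le) (rule t)
        then show ?case by simp
      qed
    qed
  qed
  have gint: "integrable pos_measure g"
    using integrable_weighted[OF L2A]
    by (rule Bochner_Integration.integrable_cong[THEN iffD1, OF refl, rotated]) (simp only: space_pos_measure greaterThan_iff wA)
  have bt: "AE s in pos_measure. bessel_transform g s - V s = 0"
  proof (rule laplace_unique[where c = 1])
    fix r :: real assume r: "1 < r"
    have r0: "0 < r" using r by simp
    note bt = laplace_bessel_transform[OF gint r0]
    show "integrable pos_measure (\<lambda>s. (bessel_transform g s - V s) * of_real (exp (- r * s)))"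
      unfolding left_diff_distrib by (intro Bochner_Integration.integrable_diff bt Vint r)
    have "(\<integral>s. (bessel_transform g s - V s) * of_real (exp (- r * s)) \<partial>pos_measure)
      = (\<integral>s. bessel_transform g s * of_real (exp (- r * s)) \<partial>pos_measure) - (\<integral>s. V s * of_real (exp (- r * s)) \<partial>pos_measure)"
      unfolding left_diff_distrib by (intro Bochner_Integration.integral_diff bt Vint r)
    also have "\<dots> = 0"
      unfolding bt Vval[OF r] using Gr[of "1 / r"] r0 by simp
    finally show "(\<integral>s. (bessel_transform g s - V s) * of_real (exp (- r * s)) \<partial>pos_measure) = 0" .
  qed
  have btA: "bessel_transform (weighted A) = bessel_transform g"
    unfolding bessel_transform_def
    by (intro ext Bochner_Integration.integral_cong refl) (simp only: space_pos_measure greaterThan_iff wA)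
  have "AE s in pos_measure. op_K A s = lam * A s"
    using bt gV AE_space
  proof eventually_elim
    case (elim s)
    then have s: "0 < s" by simp
    note ps = psi_square[OF less_imp_le[OF s]]
    have "bessel_transform g s = lam * of_real ((psi s)\<^sup>2) * g s" using elim by (simp add: ps(1))
    then have "op_K A s = lam * of_real ((psi s)\<^sup>2 / (sqrt s * psi s)) * g s"
      unfolding op_K_eq_bessel_transform[OF s] btA by simp
    also have "(psi s)\<^sup>2 / (sqrt s * psi s) = psi s / sqrt s"
      using ps(3) by (simp add: power2_eq_square)
    finally show ?case by (simp only: A_def[of s] mult.assoc)
  qed
  moreover have "\<not> (AE t in pos_measure. A t = 0)"
  proof
    assume A0: "AE t in pos_measure. A t = 0"
    have g0: "AE t in pos_measure. g t = 0"
      using A0 AE_space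
    proof eventually_elim
      case (elim t)
      then show ?case using wA[of t] by simp
    qed
    \<comment> \<open>If \<open>g\<close> vanishes, so does \<open>G\<close> on the left half-plane,
      and the identity theorem on the connected slit plane then contradicts
      \<open>nz\<close>.\<close>
    have G0: "G z = 0" if "Re z < 0" for z
      unfolding Gg[OF that] laplace_def
      by (rule integral_eq_zero_AE) (use g0 in \<open>auto elim!: eventually_mono\<close>)
    have "G z = 0" if "z \<in> slit_from 1" for z
    proof (rule analytic_continuation[OF hol open_slit_from connected_slit_from])
      show "{z. Re z < 0} \<subseteq> slit_from 1" by (auto simp: slit_from_iff)
      show "-1 \<in> slit_from 1" by (simp add: slit_from_iff)
      show "-1 islimpt {z. Re z < 0}"
        by (rule interior_limit_point) (simp add: interior_open open_halfspace_Re_lt)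
    qed (use that G0 in auto)
    with nz show False by blast
  qed
  ultimately show ?thesis unfolding eigenvalue_K_def using L2A by blast
qed

section \<open>The spectrum\<close>

lemma measurable_kernel_K: "(\<lambda>(s, t). kernel_K s t) \<in> borel_measurable (pos_measure \<Otimes>\<^sub>M pos_measure)"
proof -
  have [measurable]: "fst \<in> borel_measurable (pos_measure \<Otimes>\<^sub>M pos_measure)"
    "snd \<in> borel_measurable (pos_measure \<Otimes>\<^sub>M pos_measure)"
    by (rule measurable_fst_pos measurable_snd_pos)+
  have eq: "kernel_K s t = sqrt (s * t) * bessel_series (s * t) / (psi s * psi t)" if "0 < s" "0 < t" for s t
    using that bessel_J_1_eq[of "s * t"] by (simp only: kernel_K_def mult_nonneg_nonneg less_imp_le)
  have "(\<lambda>x. sqrt (fst x * snd x) * bessel_series (fst x * snd x) / (psi (fst x) * psi (snd x)))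
      \<in> borel_measurable (pos_measure \<Otimes>\<^sub>M pos_measure)"
    by measurable
  then show ?thesis
    by (rule measurable_cong[THEN iffD1, rotated]) (auto simp: space_pair_measure eq)
qed

lemma square_integrable_inverse_psi: "square_integrable pos_measure (\<lambda>t. 1 / psi t)"
  using integrable_div_psi_square[of 0] unfolding square_integrable_def
  by (auto simp: power_divide intro!: borel_measurable_pos_measureI)

lemma square_integrable_weight: "square_integrable pos_measure (\<lambda>t. sqrt t / psi t)"
  unfolding square_integrable_def
proof
  show "(\<lambda>t. sqrt t / psi t) \<in> borel_measurable pos_measure"
    by (rule borel_measurable_pos_measureI) measurable
  show "integrable pos_measure (\<lambda>t. (sqrt t / psi t)\<^sup>2)"
    using integrable_div_psi_square[of 1]
    by (rule Bochner_Integration.integrable_cong[THEN iffD1, OF refl, rotated]) (simp add: power_divide)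
qed

lemma L2_pos_of_real: "square_integrable pos_measure f \<Longrightarrow> L2_pos (\<lambda>t. of_real (f t))"
  by (auto simp: square_integrable_def L2_pos_def)

lemma square_integrable_Re_Im:
  assumes "L2_pos A"
  shows "square_integrable pos_measure (\<lambda>t. Re (A t))" "square_integrable pos_measure (\<lambda>t. Im (A t))"
proof -
  have A: "A \<in> borel_measurable pos_measure" and i: "integrable pos_measure (\<lambda>t. (cmod (A t))\<^sup>2)"
    using assms by (auto simp: L2_pos_def)
  show "square_integrable pos_measure (\<lambda>t. Re (A t))"
    unfolding square_integrable_def
  proof
    show m: "(\<lambda>t. Re (A t)) \<in> borel_measurable pos_measure" using A by measurable
    show "integrable pos_measure (\<lambda>t. (Re (A t))\<^sup>2)"
      by (rule Bochner_Integration.integrable_bound[OF i])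
        (use m in \<open>auto simp: cmod_power2\<close>)
  qed
  show "square_integrable pos_measure (\<lambda>t. Im (A t))"
    unfolding square_integrable_def
  proof
    show m: "(\<lambda>t. Im (A t)) \<in> borel_measurable pos_measure" using A by measurable
    show "integrable pos_measure (\<lambda>t. (Im (A t))\<^sup>2)"
      by (rule Bochner_Integration.integrable_bound[OF i])
        (use m in \<open>auto simp: cmod_power2\<close>)
  qed
qed

section \<open>Compactness and symmetry of the operator\<close>

text \<open>The Arzela-Ascoli argument: a diagonal subsequence converges at the positive rationals,
  and the common Lipschitz constant transports the Cauchy property to every positive point.\<close>

lemma convergent_subsequence_lipschitz:
  fixes f :: "nat \<Rightarrow> real \<Rightarrow> 'a::{real_normed_vector, heine_borel}"
  assumes bound: "\<And>n s. 0 < s \<Longrightarrow> norm (f n s) \<le> B * s"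
    and lip: "\<And>n s s'. 0 < s \<Longrightarrow> 0 < s' \<Longrightarrow> norm (f n s - f n s') \<le> B * \<bar>s - s'\<bar>"
  shows "\<exists>r. strict_mono (r :: nat \<Rightarrow> nat) \<and> (\<forall>s>0. convergent (\<lambda>n. f (r n) s))"
proof -
  let ?S = "{s \<in> \<rat>. 0 < s} :: real set"
  have "countable ?S" by (rule countable_subset[OF _ countable_rat]) auto
  \<comment> \<open>The diagonal argument takes one bound for all points; dividing by
    \<open>s\<close> removes the linear growth.\<close>
  moreover have "norm ((1 / s) *\<^sub>R f n s) \<le> B" if "s \<in> ?S" for n s
    using bound[of s n] that by (simp add: field_simps)
  ultimately obtain r where r: "strict_mono (r :: nat \<Rightarrow> nat)"
    and lims: "\<And>s. s \<in> ?S \<Longrightarrow> \<exists>l. (\<lambda>n. (1 / s) *\<^sub>R f (r n) s) \<longlonglongrightarrow> l"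
    using function_convergent_subsequence[of ?S "\<lambda>n s. (1 / s) *\<^sub>R f n s" B] by blast
  then have convS: "convergent (\<lambda>n. f (r n) q)" if q: "q \<in> ?S" for q
  proof -
    obtain l where "(\<lambda>n. (1 / q) *\<^sub>R f (r n) q) \<longlonglongrightarrow> l" using lims[OF q] by blast
    then have "(\<lambda>n. q *\<^sub>R ((1 / q) *\<^sub>R f (r n) q)) \<longlonglongrightarrow> q *\<^sub>R l" by (rule tendsto_scaleR[OF tendsto_const])
    then show ?thesis using q by (auto simp: convergent_def)
  qed
  have B: "0 \<le> B" using bound[of 1 0] norm_ge_zero[of "f 0 1"] by linarith
  have "convergent (\<lambda>n. f (r n) s)" if s: "0 < s" for s
  proof (rule Cauchy_convergent, rule CauchyI')
    fix e :: real assume e: "0 < e"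
    define d where "d = e / (3 * (B + 1))"
    have d: "0 < d" using e B by (simp add: d_def)
    obtain q where q: "q \<in> \<rat>" "s < q" "q < s + d" using Rats_dense_in_real[of s "s + d"] d by auto
    then have qS: "q \<in> ?S" using s by simp
    have near: "norm (f n s - f n q) < e / 3" for n
    proof -
      have "norm (f n s - f n q) \<le> B * \<bar>s - q\<bar>" using q s by (intro lip) auto
      also have "\<dots> \<le> B * d" using q B by (intro mult_left_mono) auto
      also have "\<dots> < (B + 1) * d" using d by simp
      also have "\<dots> = e / 3" using B by (simp add: d_def field_simps)
      finally show ?thesis .
    qed
    have "Cauchy (\<lambda>n. f (r n) q)" using convS[OF qS] by (rule convergent_Cauchy)
    then obtain N where N: "\<And>m n. N \<le> m \<Longrightarrow> N \<le> n \<Longrightarrow> norm (f (r m) q - f (r n) q) < e / 3"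
      using e unfolding Cauchy_iff by (metis divide_pos_pos zero_less_numeral)
    show "\<exists>M. \<forall>m\<ge>M. \<forall>n>m. dist (f (r m) s) (f (r n) s) < e"
    proof (intro exI allI impI)
      fix m n assume mn: "N \<le> m" "m < n"
      have "f (r m) s - f (r n) s = (f (r m) s - f (r m) q) + (f (r m) q - f (r n) q) + (f (r n) q - f (r n) s)"
        by simp
      then have "norm (f (r m) s - f (r n) s)
          \<le> norm (f (r m) s - f (r m) q) + norm (f (r m) q - f (r n) q) + norm (f (r n) q - f (r n) s)"
        by (metis norm_triangle_mono norm_triangle_ineq order_refl)
      then show "dist (f (r m) s) (f (r n) s) < e"
        using near[of "r m"] near[of "r n"] N[of m n] mn by (simp add: dist_norm norm_minus_commute)
    qed
  qed
  with r show ?thesis by blast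
qed

lemma real_op_eq:
  "complex_of_real (\<integral>t. kernel_K s t * f t \<partial>pos_measure) = op_K (\<lambda>t. of_real (f t)) s"
  unfolding op_K_def by (simp flip: integral_complex_of_real)

text \<open>Cauchy-Schwarz for the weight against \<open>|f|\<close>. The bound is the same for the
  whole unit ball, so the Bessel transforms of its elements share one Lipschitz constant.\<close>

lemma integral_norm_weighted_le:
  assumes f: "square_integrable pos_measure f" and n: "L2_inner pos_measure f f \<le> 1"
  shows "(\<integral>t. norm (weighted (\<lambda>t. of_real (f t)) t) \<partial>pos_measure)
    \<le> sqrt (L2_inner pos_measure (\<lambda>t. sqrt t / psi t) (\<lambda>t. sqrt t / psi t))"
proof -
  let ?w = "\<lambda>t. sqrt t / psi t"
  have af: "square_integrable pos_measure (\<lambda>t. \<bar>f t\<bar>)"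
    using f by (auto simp: square_integrable_def)
  have "(\<integral>t. norm (weighted (\<lambda>t. of_real (f t)) t) \<partial>pos_measure) = L2_inner pos_measure ?w (\<lambda>t. \<bar>f t\<bar>)"
    unfolding L2_inner_def
  proof (rule Bochner_Integration.integral_cong[OF refl])
    fix t assume "t \<in> space pos_measure"
    then have "0 \<le> sqrt t / psi t" using psi_square(3)[of t] by simp
    then show "norm (weighted (\<lambda>t. of_real (f t)) t) = sqrt t / psi t * \<bar>f t\<bar>"
      by (simp only: norm_mult norm_of_real abs_of_nonneg)
  qed
  also have "\<dots> \<le> sqrt (L2_inner pos_measure ?w ?w)"
  proof (rule real_le_rsqrt)
    have "L2_inner pos_measure (\<lambda>t. \<bar>f t\<bar>) (\<lambda>t. \<bar>f t\<bar>) = L2_inner pos_measure f f"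
      by (simp add: L2_inner_def)
    then show "(L2_inner pos_measure ?w (\<lambda>t. \<bar>f t\<bar>))\<^sup>2 \<le> L2_inner pos_measure ?w ?w"
      using L2_Cauchy_Schwarz[OF square_integrable_weight af] n
        mult_left_le[of "L2_inner pos_measure f f" "L2_inner pos_measure ?w ?w"]
        L2_inner_self_nonneg[of pos_measure ?w] by simp
  qed
  finally show ?thesis .
qed

text \<open>The majorant \<open>1 / psi\<close> comes from the bound of \<open>J\<^sub>1\<close> by
  \<open>1\<close>. Compactness holds because the Bessel transforms of the weighted unit ball are
  equi-Lipschitz, and the image under the operator differs from them only by the fixed factor
  \<open>sqrt s * psi s\<close>.\<close>

interpretation K: L2_kernel pos_measure kernel_K "\<lambda>t. 1 / psi t"
proof
  show "(\<lambda>(s, t). kernel_K s t) \<in> borel_measurable (pos_measure \<Otimes>\<^sub>M pos_measure)"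
    by (rule measurable_kernel_K)
  show "kernel_K s t = kernel_K t s" for s t
    by (simp add: kernel_K_def mult.commute)
  show "square_integrable pos_measure (\<lambda>t. 1 / psi t)" by (rule square_integrable_inverse_psi)
  show "0 \<le> 1 / psi s" if "s \<in> space pos_measure" for s
    using psi_square(3)[of s] that by simp
  show "\<bar>kernel_K s t\<bar> \<le> 1 / psi s * (1 / psi t)" if "s \<in> space pos_measure" "t \<in> space pos_measure" for s t
  proof -
    have st: "0 \<le> s * t" "0 < psi s * psi t" using that psi_square(3)[of s] psi_square(3)[of t] by auto
    have "\<bar>kernel_K s t\<bar> = \<bar>bessel_J 1 (2 * sqrt (s * t))\<bar> / (psi s * psi t)"
      unfolding kernel_K_def abs_divide using st(2) by (simp only: abs_of_pos)
    also have "\<dots> \<le> 1 / (psi s * psi t)"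
      using abs_bessel_J_1_le[OF st(1)] st(2) by (intro divide_right_mono) auto
    finally show ?thesis by simp
  qed
  fix h :: "nat \<Rightarrow> real \<Rightarrow> real"
  assume h: "\<And>n. square_integrable pos_measure (h n)" and h1: "\<And>n. L2_inner pos_measure (h n) (h n) \<le> 1"
  define g where "g n = weighted (\<lambda>t. of_real (h n t))" for n
  have g: "integrable pos_measure (g n)" for n
    unfolding g_def by (intro integrable_weighted L2_pos_of_real h)
  define B where "B = sqrt (L2_inner pos_measure (\<lambda>t. sqrt t / psi t) (\<lambda>t. sqrt t / psi t))"
  have gB: "(\<integral>t. norm (g n t) \<partial>pos_measure) \<le> B" for n
    unfolding g_def B_def by (rule integral_norm_weighted_le[OF h h1])
  have "\<exists>r. strict_mono (r :: nat \<Rightarrow> nat) \<and> (\<forall>s>0. convergent (\<lambda>n. bessel_transform (g (r n)) s))"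
  proof (rule convergent_subsequence_lipschitz)
    show "norm (bessel_transform (g n) s) \<le> B * s" if "0 < s" for n s
      using order_trans[OF norm_bessel_transform_le[OF g, of s n] mult_left_mono[OF gB[of n], of s]] that
      by (simp add: mult.commute)
    show "norm (bessel_transform (g n) s - bessel_transform (g n) s') \<le> B * \<bar>s - s'\<bar>" if "0 < s" "0 < s'" for n s s'
      using order_trans[OF norm_bessel_transform_diff_le[OF g, of s s' n]
          mult_left_mono[OF gB[of n], of "\<bar>s - s'\<bar>"]] that
      by (simp add: mult.commute)
  qed
  then obtain r where r: "strict_mono (r :: nat \<Rightarrow> nat)"
    and conv: "\<And>s. 0 < s \<Longrightarrow> convergent (\<lambda>n. bessel_transform (g (r n)) s)" by blast
  have "convergent (\<lambda>n. \<integral>t. kernel_K s t * h (r n) t \<partial>pos_measure)" if "s \<in> space pos_measure" for s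
  proof -
    have s: "0 < s" using that by simp
    have "(\<integral>t. kernel_K s t * h (r n) t \<partial>pos_measure) = Re (bessel_transform (g (r n)) s / of_real (sqrt s * psi s))" for n
      using real_op_eq[of s "h (r n)"] op_K_eq_bessel_transform[OF s] unfolding g_def
      by (metis Re_complex_of_real)
    moreover obtain l where "(\<lambda>n. bessel_transform (g (r n)) s) \<longlonglongrightarrow> l"
      using conv[OF s] by (auto simp: convergent_def)
    then have "(\<lambda>n. Re (bessel_transform (g (r n)) s / of_real (sqrt s * psi s))) \<longlonglongrightarrow> Re (l / of_real (sqrt s * psi s))"
      using s psi_square(3)[of s] by (intro tendsto_intros) auto
    ultimately show ?thesis by (auto simp: convergent_def)
  qed
  with r show "\<exists>r. strict_mono (r :: nat \<Rightarrow> nat) \<and>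
      (\<forall>s\<in>space pos_measure. convergent (\<lambda>n. \<integral>t. kernel_K s t * h (r n) t \<partial>pos_measure))"
    by blast
qed

lemma op_K_of_real: "op_K (\<lambda>t. of_real (f t)) s = of_real (K.op f s)"
  unfolding K.op_def by (rule real_op_eq[symmetric])

text \<open>Complex eigenvalues are real by symmetry: for \<open>A = u + i v\<close> and
  \<open>lam = a + i b\<close> the equation reads \<open>op u = a u - b v\<close>,
  \<open>op v = b u + a v\<close>, and equating \<open><op u, v>\<close> with
  \<open><u, op v>\<close> leaves \<open>b * (<u, u> + <v, v>) = 0\<close>. Then whichever of
  \<open>u\<close>, \<open>v\<close> is nonzero is a real eigenvector.\<close>

lemma eigenvalue_K_iff: "eigenvalue_K lam \<longleftrightarrow> (\<exists>l e. lam = of_real l \<and> K.eig l e)"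
proof
  assume "\<exists>l e. lam = of_real l \<and> K.eig l e"
  then obtain l e where lam: "lam = of_real l" and e: "K.eig l e" by blast
  have eL: "square_integrable pos_measure e" "0 < L2_inner pos_measure e e"
    and ee: "AE s in pos_measure. K.op e s = l * e s" using e by (auto simp: K.eig_def)
  have "\<not> (AE t in pos_measure. e t = 0)"
    using eL L2_inner_self_eq_0_iff[OF eL(1)] by auto
  moreover have "AE s in pos_measure. op_K (\<lambda>t. of_real (e t)) s = lam * of_real (e s)"
    using ee by eventually_elim (simp add: op_K_of_real lam)
  ultimately show "eigenvalue_K lam"
    unfolding eigenvalue_K_def
    by (intro exI[of _ "\<lambda>t. of_real (e t)"]) (use L2_pos_of_real[OF eL(1)] in simp)
next
  assume "eigenvalue_K lam"
  then obtain A where A: "L2_pos A" and nz: "\<not> (AE t in pos_measure. A t = 0)"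
    and eA: "AE s in pos_measure. op_K A s = lam * A s"
    unfolding eigenvalue_K_def by blast
  define u v where "u t = Re (A t)" and "v t = Im (A t)" for t
  define a b where "a = Re lam" and "b = Im lam"
  have u: "square_integrable pos_measure u" and v: "square_integrable pos_measure v"
    using square_integrable_Re_Im[OF A] unfolding u_def v_def by auto
  have op_A: "op_K A s = Complex (K.op u s) (K.op v s)" if "s \<in> space pos_measure" for s
  proof -
    have ks: "square_integrable pos_measure (kernel_K s)" by (rule K.kernel_L2[OF that])
    have iu: "integrable pos_measure (\<lambda>t. kernel_K s t * u t)" and iv: "integrable pos_measure (\<lambda>t. kernel_K s t * v t)"
      by (rule integrable_mult_L2[OF ks u] integrable_mult_L2[OF ks v])+
    have eq: "of_real (kernel_K s t) * A t = of_real (kernel_K s t * u t) + \<i> * of_real (kernel_K s t * v t)" for t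
      by (simp add: complex_eq_iff u_def v_def)
    have "op_K A s = of_real (K.op u s) + \<i> * of_real (K.op v s)"
      unfolding op_K_def eq K.op_def
      by (subst Bochner_Integration.integral_add)
        (use iu iv in \<open>auto simp del: of_real_mult simp: integral_complex_of_real\<close>)
    then show ?thesis by (simp add: complex_eq_iff)
  qed
  have opu: "AE s in pos_measure. K.op u s = a * u s - b * v s"
    and opv: "AE s in pos_measure. K.op v s = b * u s + a * v s"
  proof -
    have "AE s in pos_measure. K.op u s = a * u s - b * v s \<and> K.op v s = b * u s + a * v s"
      using eA AE_space
      by eventually_elim (simp add: op_A complex_eq_iff a_def b_def u_def v_def)
    then show "AE s in pos_measure. K.op u s = a * u s - b * v s"
      "AE s in pos_measure. K.op v s = b * u s + a * v s" by auto
  qed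
  let ?ip = "L2_inner pos_measure"
  note sq = square_integrable_cmult square_integrable_add square_integrable_diff K.op_L2 u v
  have "?ip (K.op u) v = ?ip (\<lambda>s. a * u s - b * v s) v"
    by (rule L2_inner_cong_AE[OF opu]) (intro square_integrable_measurable sq)+
  also have "\<dots> = a * ?ip u v - b * ?ip v v"
    by (subst L2_inner_diff_left) (auto intro: sq simp: L2_inner_cmult_left)
  finally have 1: "?ip (K.op u) v = a * ?ip u v - b * ?ip v v" .
  have "?ip (K.op v) u = ?ip (\<lambda>s. b * u s + a * v s) u"
    by (rule L2_inner_cong_AE[OF opv]) (intro square_integrable_measurable sq)+
  also have "\<dots> = b * ?ip u u + a * ?ip v u"
    by (subst L2_inner_add_left) (auto intro: sq simp: L2_inner_cmult_left)
  finally have 2: "?ip (K.op v) u = b * ?ip u u + a * ?ip v u" .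
  have "b * (?ip u u + ?ip v v) = 0"
    using 1 2 K.op_sym[OF u v] L2_inner_commute[of pos_measure "K.op v" u] L2_inner_commute[of pos_measure v u]
    by (simp add: algebra_simps)
  moreover have pos: "0 < ?ip u u \<or> 0 < ?ip v v"
  proof (rule ccontr)
    assume "\<not> ?thesis"
    then have "?ip u u = 0" "?ip v v = 0"
      using L2_inner_self_nonneg[of pos_measure u] L2_inner_self_nonneg[of pos_measure v] by auto
    then have "AE t in pos_measure. u t = 0" "AE t in pos_measure. v t = 0"
      using L2_inner_self_eq_0_iff[OF u] L2_inner_self_eq_0_iff[OF v] by auto
    then have "AE t in pos_measure. A t = 0"
      by eventually_elim (simp add: u_def v_def complex_eq_iff)
    with nz show False by simp
  qed
  ultimately have b: "b = 0"
    using L2_inner_self_nonneg[of pos_measure u] L2_inner_self_nonneg[of pos_measure v] by (auto simp: add_nonneg_eq_0_iff)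
  then have lam: "lam = of_real a" by (simp add: a_def b_def complex_eq_iff)
  from pos show "\<exists>l e. lam = of_real l \<and> K.eig l e"
  proof
    assume "0 < ?ip u u"
    then have "K.eig a u" using u opu b by (simp add: K.eig_def)
    with lam show ?thesis by blast
  next
    assume "0 < ?ip v v"
    then have "K.eig a v" using v opv b by (simp add: K.eig_def)
    with lam show ?thesis by blast
  qed
qed

section \<open>Infinitely many eigenvalues and their enumeration\<close>

lemma AE_pos_ex_in_interval:
  assumes ae: "AE x in pos_measure. P x" and ab: "0 \<le> a" "a < b"
  shows "\<exists>x. a < x \<and> x < b \<and> P x"
proof (rule ccontr)
  assume *: "\<not> ?thesis"
  have "AE x in lebesgue. x \<in> {0<..} \<longrightarrow> P x"
    using ae by (subst (asm) AE_restrict_space_iff) auto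
  then have "AE x in lebesgue. x \<notin> {a<..<b}"
    by eventually_elim (use * ab in auto)
  then have "{a<..<b} \<in> null_sets lebesgue"
    by (subst AE_iff_null_sets) auto
  then have "emeasure lebesgue {a<..<b} = 0" by auto
  then show False using ab by simp
qed

lemma infinite_eigenvalues_K: "infinite {l. l \<noteq> 0 \<and> (\<exists>e. K.eig l e)}"
proof (rule K.infinite_eigenvalues)
  fix f assume f: "square_integrable pos_measure f" and z: "AE x in pos_measure. K.op f x = 0"
  define A where "A = (\<lambda>t. complex_of_real (f t))"
  have g: "integrable pos_measure (weighted A)"
    unfolding A_def by (intro integrable_weighted L2_pos_of_real f)
  have "AE s in pos_measure. bessel_transform (weighted A) s = 0"
    using z AE_space
  proof eventually_elim
    case (elim s)
    then have s: "0 < s" by simp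
    have "op_K A s = 0" using elim(1) by (simp add: A_def op_K_of_real)
    then show ?case
      using op_K_eq_bessel_transform[OF s, of A] s psi_square(3)[of s] by (simp del: of_real_mult)
  qed
  from bessel_transform_inj[OF g this] show "AE x in pos_measure. f x = 0"
    using AE_space
  proof eventually_elim
    case (elim t)
    then have "0 < t" by simp
    then have "A t = 0" using elim(1) weighted_eq_0_iff by blast
    then show ?case by (simp add: A_def)
  qed
next
  show "square_integrable pos_measure (indicator {0<..1})"
  proof (rule square_integrable_bound[OF square_integrable_inverse_psi, of _ "(psi 1)\<^sup>2"])
    show "indicator {0<..1} \<in> borel_measurable pos_measure" by (rule borel_measurable_pos_measureI) simp
    fix x assume "x \<in> space pos_measure"
    then have x: "0 < x" by simp
    show "(indicator {0<..1} x)\<^sup>2 \<le> (psi 1)\<^sup>2 * (1 / psi x)\<^sup>2"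
    proof (cases "x \<le> 1")
      case True
      then have "(psi x)\<^sup>2 \<le> (psi 1)\<^sup>2" using x by (simp add: psi_square)
      then show ?thesis using True x psi_square(3)[of x] by (simp add: power_divide)
    qed simp
  qed
next
  fix g assume g: "square_integrable pos_measure g"
  define G where "G = weighted (\<lambda>t. of_real (g t))"
  have Gi: "integrable pos_measure G"
    unfolding G_def by (intro integrable_weighted L2_pos_of_real g)
  define F where "F s = Re (bessel_transform G s / of_real (sqrt s * psi s))" for s
  have op_F: "K.op g s = F s" if "0 < s" for s
    using op_K_of_real[of g s] op_K_eq_bessel_transform[OF that, of "\<lambda>t. of_real (g t)"]
    unfolding F_def G_def by (metis Re_complex_of_real)
  show "\<not> (AE x in pos_measure. indicator {0<..1} x = K.op g x)"
  proof
    assume "AE x in pos_measure. indicator {0<..1} x = K.op g x"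
    then have ae: "AE x in pos_measure. F x = indicator {0<..1} x"
      using AE_space by eventually_elim (simp add: op_F)
    have "continuous_on {0<..} (bessel_transform G)"
    proof (rule lipschitz_on_continuous_on[where L = "\<integral>t. norm (G t) \<partial>pos_measure"], rule lipschitz_onI)
      show "dist (bessel_transform G x) (bessel_transform G y) \<le> (\<integral>t. norm (G t) \<partial>pos_measure) * dist x y"
        if "x \<in> {0<..}" "y \<in> {0<..}" for x y
        using norm_bessel_transform_diff_le[OF Gi, of x y] that
        by (simp add: dist_norm mult.commute)
    qed simp
    moreover have "continuous_on {0<..} (\<lambda>s. complex_of_real (sqrt s * psi s))"
      unfolding psi_def by (intro continuous_intros)
    moreover have "complex_of_real (sqrt s * psi s) \<noteq> 0" if "s \<in> {0<..}" for s
      using that psi_square(3)[of s] by simp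
    ultimately have "continuous_on {0<..} F"
      unfolding F_def by (intro continuous_on_Re continuous_on_divide) auto
    then obtain d where d: "0 < d" "\<And>x. 0 < x \<Longrightarrow> dist x 1 < d \<Longrightarrow> dist (F x) (F 1) < 1 / 2"
      unfolding continuous_on_iff by (metis greaterThan_iff half_gt_zero_iff zero_less_one)
    \<comment> \<open>The cap by \<open>1\<close> keeps the interval left of \<open>1\<close> inside
      the half-line. On both sides of \<open>1\<close> there are points where \<open>F\<close>
      agrees with the indicator, and a continuous \<open>F\<close> cannot be close to
      \<open>1\<close> and to \<open>0\<close> at once.\<close>
    define d' where "d' = min d 1"
    have d': "0 < d'" "d' \<le> d" "d' \<le> 1" using d by (auto simp: d'_def)
    obtain x where x: "1 - d' < x" "x < 1" "F x = indicator {0<..1} x"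
      using AE_pos_ex_in_interval[OF ae, of "1 - d'" 1] d' by auto
    obtain y where y: "1 < y" "y < 1 + d'" "F y = indicator {0<..1} y"
      using AE_pos_ex_in_interval[OF ae, of 1 "1 + d'"] d' by auto
    have "F x = 1" "F y = 0" using x y d' by auto
    moreover have "dist (F x) (F 1) < 1 / 2"
      by (rule d(2)) (use x d' in \<open>auto simp: dist_real_def\<close>)
    moreover have "dist (F y) (F 1) < 1 / 2"
      by (rule d(2)) (use y d' in \<open>auto simp: dist_real_def\<close>)
    ultimately have "\<bar>1 - F 1\<bar> < 1 / 2" "\<bar>0 - F 1\<bar> < 1 / 2" by (simp_all only: dist_real_def)
    then show False by linarith
  qed
qed

text \<open>Any bijective enumeration works: injectivity leaves only finitely many indices whose
  value has norm at least \<open>\<epsilon>\<close>. Infinitude of \<open>S\<close> allows all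
  natural numbers as indices.\<close>

lemma enumeration_tendsto_0:
  fixes S :: "'a::real_normed_vector set"
  assumes inf: "infinite S" and fin: "\<And>\<epsilon>. 0 < \<epsilon> \<Longrightarrow> finite {x \<in> S. \<epsilon> \<le> norm x}"
  shows "countable S \<and> (\<exists>e :: nat \<Rightarrow> 'a. bij_betw e UNIV S \<and> e \<longlonglongrightarrow> 0)"
proof
  have "S \<subseteq> insert 0 (\<Union>n. {x \<in> S. 1 / real (Suc n) \<le> norm x})"
  proof
    fix x assume x: "x \<in> S"
    show "x \<in> insert 0 (\<Union>n. {x \<in> S. 1 / real (Suc n) \<le> norm x})"
    proof (cases "x = 0")
      case False
      then obtain n where "1 / real (Suc n) < norm x"
        using reals_Archimedean[of "norm x"] by (auto simp: divide_inverse)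
      with x show ?thesis by (auto intro: less_imp_le)
    qed simp
  qed
  moreover have "countable {x \<in> S. 1 / real (Suc n) \<le> norm x}" for n
    by (intro countable_finite fin) simp
  then have "countable (insert 0 (\<Union>n. {x \<in> S. 1 / real (Suc n) \<le> norm x}))"
    by (intro countable_insert countable_UN) auto
  ultimately show c: "countable S" by (rule countable_subset)
  define e where "e = from_nat_into S"
  have e: "bij_betw e UNIV S" unfolding e_def by (rule bij_betw_from_nat_into[OF c inf])
  have "e \<longlonglongrightarrow> 0"
  proof (rule LIMSEQ_I)
    fix \<epsilon> :: real assume \<epsilon>: "0 < \<epsilon>"
    have "finite (e -` {x \<in> S. \<epsilon> \<le> norm x})"
      by (rule finite_vimageI[OF fin[OF \<epsilon>]]) (use e in \<open>simp add: bij_betw_def\<close>)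
    then obtain N where N: "\<forall>n \<in> e -` {x \<in> S. \<epsilon> \<le> norm x}. n < N"
      unfolding finite_nat_set_iff_bounded by (elim exE)
    have "norm (e n - 0) < \<epsilon>" if "N \<le> n" for n
    proof (rule ccontr)
      assume "\<not> ?thesis"
      then have "n \<in> e -` {x \<in> S. \<epsilon> \<le> norm x}" using bij_betwE[OF e] by auto
      with N have "n < N" by (rule bspec)
      with that show False by simp
    qed
    then show "\<exists>N. \<forall>n\<ge>N. norm (e n - 0) < \<epsilon>" by blast
  qed
  with e show "\<exists>e :: nat \<Rightarrow> 'a. bij_betw e UNIV S \<and> e \<longlonglongrightarrow> 0" by blast
qed

text \<open>The enumeration by all of \<open>nat\<close> includes the claim that there are
  infinitely many such numbers; this is where \<open>infinite_eigenvalues_K\<close> enters, next to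
  the finiteness away from \<open>0\<close>.\<close>

theorem theorem3:
  shows "(\<forall>lam. eigenvalue_K lam \<longrightarrow> lam \<noteq> 0 \<and> (\<exists>G. period_function lam G))
    \<and> (\<forall>lam. lam \<noteq> 0 \<and> (\<exists>G. period_function lam G) \<longrightarrow> eigenvalue_K lam)
    \<and> countable {lam. lam \<noteq> 0 \<and> (\<exists>G. period_function lam G)}
    \<and> (\<exists>e :: nat \<Rightarrow> complex.
          bij_betw e UNIV {lam. lam \<noteq> 0 \<and> (\<exists>G. period_function lam G)}
          \<and> e \<longlonglongrightarrow> 0)"
proof -
  define S where "S = {lam. lam \<noteq> 0 \<and> (\<exists>G. period_function lam G)}"
  have S: "S = complex_of_real ` {l. l \<noteq> 0 \<and> (\<exists>e. K.eig l e)}"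
  proof -
    have "S = {lam. lam \<noteq> 0 \<and> eigenvalue_K lam}"
      using eigenvalue_imp_period_function period_function_imp_eigenvalue unfolding S_def by blast
    also have "\<dots> = complex_of_real ` {l. l \<noteq> 0 \<and> (\<exists>e. K.eig l e)}"
      unfolding eigenvalue_K_iff by (auto simp: image_iff)
    finally show ?thesis .
  qed
  have "infinite S"
    unfolding S using infinite_eigenvalues_K by (simp add: finite_image_iff inj_on_def)
  moreover have "finite {x \<in> S. \<epsilon> \<le> norm x}" if "0 < \<epsilon>" for \<epsilon>
    by (rule finite_subset[OF _ finite_imageI[OF K.finite_large_eigenvalues[OF that], of complex_of_real]])
      (auto simp: S)
  ultimately have "countable S \<and> (\<exists>e :: nat \<Rightarrow> complex. bij_betw e UNIV S \<and> e \<longlonglongrightarrow> 0)"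
    by (rule enumeration_tendsto_0)
  then show ?thesis
    using eigenvalue_imp_period_function period_function_imp_eigenvalue unfolding S_def by blast
qed

end
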